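(* Let $n\ge 2$ be an integer, $\lambda\ge 0$, $\alpha=\sqrt{n}-1$, $c_0>0$, $c_1\in\mathbb{R}$ and $c_2:=\frac{(n-1)(\alpha-1)}{2}=\frac{(n-1)(\sqrt{n}-2)}{2}$. Then there exists a constant $\varepsilon>0$ such that there is a unique function $h\in C^2((0,\infty))$ with all of the following properties: (i) $h(r)>0$ and $2r^2h(r)h_{rr}(r)=(n-1)h(r)(h(r)-1)+rh_r(r)\big(rh_r(r)-\lambda r-(n-1)\big)$ for all $r\in(0,\infty)$; (ii) $\lim_{r\to 0^+}r^{\alpha}h(r)=c_0$; (iii) the function $w(r)=r^{\alpha}h(r)$ satisfies, for all $0<r<\varepsilon$, $$w_r(r)=-c_2r^{\alpha-1}+c_1r^{\alpha}+\frac{\alpha\lambda}{2}r^{\alpha}\log r+r^{\alpha}\left\{\frac{n-1}{2}\int_r^{\varepsilon}\frac{\rho^{-1}w_r(\rho)}{w(\rho)}\,d\rho-\frac{\lambda}{2}\int_0^r\frac{w_r(\rho)}{w(\rho)}\,d\rho-\frac12\int_r^{\varepsilon}\frac{\rho^{-\alpha}w_r(\rho)^2}{w(\rho)}\,d\rho\right\}.$$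
   Context: Subscripts $r$ denote derivatives with respect to $r$. *)

theory Defs
  imports "HOL-Analysis.Analysis"
begin

text \<open>Meant for open \<open>S\<close>, where \<open>deriv\<close> at a point of \<open>S\<close> does not depend on values off \<open>S\<close>.\<close>
definition C2_on :: "(real \<Rightarrow> real) \<Rightarrow> real set \<Rightarrow> bool" where
  "C2_on f S \<longleftrightarrow> f differentiable_on S \<and> deriv f differentiable_on S
     \<and> continuous_on S (deriv (deriv f))"

definition soliton_ode :: "nat \<Rightarrow> real \<Rightarrow> (real \<Rightarrow> real) \<Rightarrow> real \<Rightarrow> bool" where
  "soliton_ode n lam h r \<longleftrightarrow>
     2 * r\<^sup>2 * h r * deriv (deriv h) r =
       (real n - 1) * h r * (h r - 1)
       + r * deriv h r * (r * deriv h r - lam * r - (real n - 1))"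

definition weighted :: "real \<Rightarrow> (real \<Rightarrow> real) \<Rightarrow> real \<Rightarrow> real" where
  "weighted \<alpha> h r = r powr \<alpha> * h r"

text \<open>
  The integrand of \<open>\<integral>\<^sub>0\<^sup>r w\<^sub>r / w\<close> may be unbounded at \<open>0\<close>, so its integrability is required
  explicitly (\<open>integral\<close> is \<open>0\<close> for a non-integrable function). For a continuous integrand
  on \<open>(0, r]\<close> the Henstock-Kurzweil integral over \<open>[0, r]\<close> is the improper Riemann integral,
  and the value of the integrand at \<open>0\<close> is irrelevant. The integrals over \<open>[r, \<epsilon>]\<close>
  have continuous integrands when \<open>w\<close> is positive and \<open>C\<^sup>2\<close> on \<open>(0, \<infinity>)\<close>.
\<close>
definition integral_identity ::
  "nat \<Rightarrow> real \<Rightarrow> real \<Rightarrow> real \<Rightarrow> real \<Rightarrow> real \<Rightarrow> (real \<Rightarrow> real) \<Rightarrow> real \<Rightarrow> bool" where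
  "integral_identity n lam \<alpha> c1 c2 \<epsilon> w r \<longleftrightarrow>
     (\<lambda>\<rho>. deriv w \<rho> / w \<rho>) integrable_on {0..r} \<and>
     deriv w r =
       - c2 * r powr (\<alpha> - 1) + c1 * r powr \<alpha> + \<alpha> * lam / 2 * r powr \<alpha> * ln r
       + r powr \<alpha> *
         ((real n - 1) / 2 * integral {r..\<epsilon>} (\<lambda>\<rho>. inverse \<rho> * deriv w \<rho> / w \<rho>)
          - lam / 2 * integral {0..r} (\<lambda>\<rho>. deriv w \<rho> / w \<rho>)
          - 1 / 2 * integral {r..\<epsilon>} (\<lambda>\<rho>. \<rho> powr (- \<alpha>) * (deriv w \<rho>)\<^sup>2 / w \<rho>))"

definition singular_solution ::
  "nat \<Rightarrow> real \<Rightarrow> real \<Rightarrow> real \<Rightarrow> real \<Rightarrow> real \<Rightarrow> real \<Rightarrow> (real \<Rightarrow> real) \<Rightarrow> bool" where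
  "singular_solution n lam \<alpha> c0 c1 c2 \<epsilon> h \<longleftrightarrow>
     C2_on h {0<..} \<and>
     (\<forall>r>0. h r > 0 \<and> soliton_ode n lam h r) \<and>
     (weighted \<alpha> h \<longlongrightarrow> c0) (at_right 0) \<and>
     (\<forall>r. 0 < r \<and> r < \<epsilon> \<longrightarrow> integral_identity n lam \<alpha> c1 c2 \<epsilon> (weighted \<alpha> h) r)"

end

theory Submission
  imports Defs "HOL-Real_Asymp.Real_Asymp"
begin

text \<open>
  Put \<open>w = r powr \<alpha> * h\<close>, \<open>s = sqrt w\<close> and \<open>V = r powr (- \<alpha>) * w'\<close>, and define \<open>K\<close> by
  \<open>V = \<nu> / r + lam - 2 s K\<close> with \<open>\<nu> = n - 1\<close>. The equation becomes a first-order system for \<open>(s, K)\<close> in which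
  \<open>K'\<close> depends on \<open>s\<close> only. Integrating the equation, condition (iii) at any single radius is equivalent to
  \<open>\<Phi>(\<epsilon>) = c1\<close>, where \<open>\<Phi> = V + c2 / r + lam / 2 * ln (h / c0)\<close>. The solutions with \<open>w \<rightarrow> c0\<close> form a totally ordered
  one-parameter family, all of them global and positive (as \<open>K\<close> decreases, \<open>s\<close> cannot reach \<open>0\<close>). So one needs an \<open>\<epsilon>\<close>
  for which exactly one member of the family satisfies \<open>\<Phi>(\<epsilon>) = c1\<close>.

  A small \<open>\<epsilon>\<close> does not always do: for \<open>\<alpha> > 1\<close> (that is, \<open>n \<ge> 5\<close>) and \<open>lam = 0\<close>, solutions that drop steeply towards \<open>0\<close>
  before \<open>\<epsilon>\<close> have \<open>\<Phi>(\<epsilon>)\<close> close to \<open>c2 / \<epsilon>\<close>, while milder ones have \<open>\<Phi>(\<epsilon>)\<close> very negative, so the level \<open>c1\<close> is hit twice.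
  The choice of \<open>\<epsilon>\<close> depends on the parameters. If \<open>lam > 0\<close>, then \<open>\<epsilon>\<close> is large. If \<open>lam = 0\<close> and \<open>c1 > 0\<close>, then \<open>\<epsilon>\<close> is
  chosen such that \<open>\<Phi>(\<epsilon>) = c1\<close> means \<open>K(\<epsilon>) = 0\<close>. If \<open>lam = 0\<close>, \<open>c1 \<le> 0\<close> and \<open>\<alpha> < 1\<close> (or \<open>\<alpha> = 1\<close>, \<open>c1 = 0\<close>), then \<open>\<epsilon>\<close> is
  small. In the remaining cases \<open>\<epsilon>\<close> is the largest radius at which the level \<open>c1\<close> is attained; it is attained only once
  there because \<open>\<Phi>\<close> is a strictly convex function of \<open>w\<close> along the family, as long as \<open>\<Phi> \<le> 0\<close>.
\<close>

section \<open>Calculus\<close>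

text \<open>The condition at \<open>0\<close> does not single out a solution: for every solution
  \<open>r * K r\<close> tends to the same limit \<open>\<beta> / (2 * sqrt c0)\<close>, and the
  free parameter is hidden below the leading order. This has two consequences. The family is
  parametrised by the value of \<open>K\<close> at a small radius \<open>R > 0\<close>, on the scale
  \<open>1 / R\<close>, so that steep solutions are reached as well. And the order of two solutions
  has to be carried out of \<open>0\<close>, where their difference vanishes and Gronwall cannot
  start. The order rests on \<open>N = r * r powr \<alpha> * K + (\<alpha> + 1) * s\<close>, whose
  derivative is positive and free of \<open>K\<close>. For two solutions put
  \<open>D = s2 - s1\<close> and \<open>Q = N1 - N2\<close>. They satisfy a linear system in which
  each drives the other with a positive coefficient, so a common strict sign persists. The pair
  \<open>D\<close>, \<open>K1 - K2\<close> lacks this property, because a positive \<open>D\<close>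
  makes \<open>K1 - K2\<close> decrease.\<close>

lemma deriv_dominated:
  fixes f g :: "real \<Rightarrow> real"
  assumes "a \<le> b" "continuous_on {a..b} f" "continuous_on {a..b} g"
    and "\<And>x. a < x \<Longrightarrow> x < b \<Longrightarrow> (f has_real_derivative f' x) (at x)"
    and "\<And>x. a < x \<Longrightarrow> x < b \<Longrightarrow> (g has_real_derivative g' x) (at x)"
    and "\<And>x. a < x \<Longrightarrow> x < b \<Longrightarrow> \<bar>f' x\<bar> \<le> g' x"
  shows "\<bar>f b - f a\<bar> \<le> g b - g a"
proof -
  have "(\<lambda>x. g x - f x) a \<le> (\<lambda>x. g x - f x) b"
    by (rule DERIV_nonneg_imp_increasing_open[OF assms(1)])
       (auto intro!: continuous_intros assms exI[of _ "g' x - f' x" for x] derivative_eq_intros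
             dest: assms(6) simp: abs_le_iff)
  moreover have "(\<lambda>x. g x + f x) a \<le> (\<lambda>x. g x + f x) b"
    by (rule DERIV_nonneg_imp_increasing_open[OF assms(1)])
       (auto intro!: continuous_intros assms exI[of _ "g' x + f' x" for x] derivative_eq_intros
             dest: assms(6) simp: abs_le_iff)
  ultimately show ?thesis by (simp add: abs_le_iff)
qed

lemma continuous_on_DERIV:
  fixes f :: "real \<Rightarrow> real"
  assumes "\<And>x. x \<in> S \<Longrightarrow> (f has_real_derivative f' x) (at x)"
  shows "continuous_on S f"
  by (meson DERIV_isCont assms continuous_at_imp_continuous_on)

text \<open>After the last point with \<open>z \<le> 0\<close> the function stays between
  \<open>0\<close> and \<open>\<eta>\<close> for a while and cannot increase there. The threshold
  \<open>\<eta>\<close> serves the applications in which the sign of \<open>z'\<close> is known only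
  while \<open>z\<close> is small.\<close>

lemma barrier_nonpos:
  fixes z :: "real \<Rightarrow> real"
  assumes "a \<le> b" "continuous_on {a..b} z" "z a \<le> 0" "0 < \<eta>"
    and der: "\<And>x. a < x \<Longrightarrow> x < b \<Longrightarrow> (z has_real_derivative z' x) (at x)"
    and z': "\<And>x. a < x \<Longrightarrow> x < b \<Longrightarrow> 0 < z x \<Longrightarrow> z x < \<eta> \<Longrightarrow> z' x \<le> 0"
  shows "z b \<le> 0"
proof (rule ccontr)
  assume "\<not> z b \<le> 0"
  hence zb: "z b > 0" by simp
  define S where "S = {x \<in> {a..b}. z x \<le> 0}"
  have "S = {a..b} \<inter> z -` {..0}" by (auto simp: S_def)
  hence "closed S" using continuous_closed_preimage[OF assms(2), of "{..0}"] by simp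
  moreover have "S \<noteq> {}" "bdd_above S" using assms by (auto simp: S_def)
  ultimately have cS: "Sup S \<in> S" by (intro closed_contains_Sup)
  define c where "c = Sup S"
  have c: "a \<le> c" "c \<le> b" "z c \<le> 0" using cS by (auto simp: S_def c_def)
  have "c < b" using c zb by (cases "c = b") auto
  have pos: "z x > 0" if "c < x" "x \<le> b" for x
  proof (rule ccontr)
    assume "\<not> z x > 0"
    hence "x \<in> S" using that c by (auto simp: S_def)
    hence "x \<le> c" unfolding c_def using \<open>bdd_above S\<close> by (rule cSup_upper)
    thus False using that by simp
  qed
  have "continuous_on {c..b} z" using assms(2) c by (auto intro: continuous_on_subset)
  hence "(z \<longlongrightarrow> z c) (at c within {c..b})" using c by (auto simp: continuous_on_def)
  hence "\<forall>\<^sub>F x in at c within {c..b}. z x < \<eta>" using c \<open>0 < \<eta>\<close> by (auto intro: order_tendstoD)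
  then obtain e where e: "e > 0" "\<And>x. x \<in> {c..b} \<Longrightarrow> x \<noteq> c \<Longrightarrow> dist x c < e \<Longrightarrow> z x < \<eta>"
    by (auto simp: eventually_at)
  define d where "d = min b (c + e/2)"
  have d: "c < d" "d \<le> b" using \<open>c < b\<close> e by (auto simp: d_def)
  have "\<exists>y. (z has_real_derivative y) (at x) \<and> y \<le> 0" if "c < x" "x < d" for x
  proof -
    have "z x < \<eta>" using that d e(1) by (intro e(2)) (auto simp: dist_real_def d_def)
    thus ?thesis using der[of x] z'[of x] pos[of x] that d c by (intro exI[of _ "z' x"]) auto
  qed
  moreover have "continuous_on {c..d} z" using assms(2) d c by (auto intro: continuous_on_subset)
  ultimately have "z d \<le> z c" using d by (intro DERIV_nonpos_imp_decreasing_open[of c d z]) auto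
  thus False using pos[of d] d c by auto
qed

lemma antiderivative_interval:
  fixes p :: "real \<Rightarrow> real"
  assumes "continuous_on {a..b} p"
  obtains P where "continuous_on {a..b} P" "\<And>x. a < x \<Longrightarrow> x < b \<Longrightarrow> (P has_real_derivative p x) (at x)"
proof -
  obtain P where P: "\<And>x. x \<in> {a..b} \<Longrightarrow> (P has_vector_derivative p x) (at x within {a..b})"
    using antiderivative_continuous[OF assms] by blast
  show ?thesis
  proof
    show "continuous_on {a..b} P"
      using P by (meson continuous_on_eq_continuous_within has_vector_derivative_continuous)
    fix x assume "a < x" "x < b"
    thus "(P has_real_derivative p x) (at x)"
      using P[of x] at_within_Icc_at[of a x b] by (simp add: has_real_derivative_iff_has_vector_derivative)
  qed
qed

text \<open>Gronwall with the integrating factor \<open>exp (- P)\<close>. The applications use it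
  only to transport signs, hence the unspecified positive factor \<open>c\<close>.\<close>

lemma linear_ode_le:
  fixes z p :: "real \<Rightarrow> real"
  assumes "a \<le> b" "continuous_on {a..b} z" "continuous_on {a..b} p"
    and der: "\<And>x. a < x \<Longrightarrow> x < b \<Longrightarrow> (z has_real_derivative z' x) (at x)"
    and le: "\<And>x. a < x \<Longrightarrow> x < b \<Longrightarrow> z' x \<le> p x * z x"
  obtains c where "0 < c" "z b \<le> c * z a"
proof -
  obtain P where P: "continuous_on {a..b} P" "\<And>x. a < x \<Longrightarrow> x < b \<Longrightarrow> (P has_real_derivative p x) (at x)"
    using antiderivative_interval[OF assms(3)] by blast
  have "(\<lambda>x. - (z x * exp (- P x))) a \<le> (\<lambda>x. - (z x * exp (- P x))) b"
  proof (rule DERIV_nonneg_imp_increasing_open[OF assms(1)])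
    fix x assume x: "a < x" "x < b"
    have "((\<lambda>x. - (z x * exp (- P x))) has_real_derivative (p x * z x - z' x) * exp (- P x)) (at x)"
      by (auto intro!: derivative_eq_intros der P(2) x simp: algebra_simps)
    moreover have "0 \<le> (p x * z x - z' x) * exp (- P x)" using le[OF x] by simp
    ultimately show "\<exists>y. ((\<lambda>x. - (z x * exp (- P x))) has_real_derivative y) (at x) \<and> 0 \<le> y" by blast
  qed (auto intro!: continuous_intros assms P)
  hence "z b * exp (- P b) * exp (P b) \<le> z a * exp (- P a) * exp (P b)" by (intro mult_right_mono) auto
  hence "z b \<le> exp (- P a) * exp (P b) * z a" by (simp add: exp_minus field_simps)
  thus ?thesis by (intro that[of "exp (- P a) * exp (P b)"]) auto
qed

lemma linear_ode_neg:
  fixes z p :: "real \<Rightarrow> real"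
  assumes "a \<le> b" "continuous_on {a..b} z" "continuous_on {a..b} p" "z a < 0"
    and "\<And>x. a < x \<Longrightarrow> x < b \<Longrightarrow> (z has_real_derivative z' x) (at x)"
    and "\<And>x. a < x \<Longrightarrow> x < b \<Longrightarrow> z' x \<le> p x * z x"
  shows "z b < 0"
proof -
  obtain c where "0 < c" "z b \<le> c * z a" by (rule linear_ode_le[OF assms(1-3,5,6)])
  thus ?thesis using mult_pos_neg[of c "z a"] assms(4) by linarith
qed

lemma linear_ode_nonpos:
  fixes z p :: "real \<Rightarrow> real"
  assumes "a \<le> b" "continuous_on {a..b} z" "continuous_on {a..b} p" "z a \<le> 0"
    and "\<And>x. a < x \<Longrightarrow> x < b \<Longrightarrow> (z has_real_derivative z' x) (at x)"
    and "\<And>x. a < x \<Longrightarrow> x < b \<Longrightarrow> z' x \<le> p x * z x"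
  shows "z b \<le> 0"
proof -
  obtain c where "0 < c" "z b \<le> c * z a" by (rule linear_ode_le[OF assms(1-3,5,6)])
  thus ?thesis using mult_nonneg_nonpos[of c "z a"] assms(4) by linarith
qed

section \<open>Antiderivatives on the half-line and improper integrals at the origin\<close>

lemma antiderivative_pos_reals:
  fixes f :: "real \<Rightarrow> real"
  assumes "continuous_on {0<..} f"
  obtains F where "F b = y" "\<And>x. 0 < x \<Longrightarrow> (F has_real_derivative f x) (at x)"
proof -
  have "isCont f x" if "0 < x" for x
    using assms that by (simp add: continuous_on_eq_continuous_at)
  hence "\<exists>F. \<forall>x. ereal 0 < ereal x \<longrightarrow> ereal x < \<infinity> \<longrightarrow> (F has_vector_derivative f x) (at x)"
    by (intro einterval_antiderivative) auto
  then obtain F where F: "\<And>x. 0 < x \<Longrightarrow> (F has_real_derivative f x) (at x)"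
    by (auto simp: has_real_derivative_iff_has_vector_derivative)
  show ?thesis
    by (rule that[of "\<lambda>x. F x - F b + y"]) (auto intro!: derivative_eq_intros F)
qed

lemma tendsto_at_right_0_mono:
  fixes H :: "real \<Rightarrow> real"
  assumes "0 < b" and mono: "\<And>x y. 0 < x \<Longrightarrow> x \<le> y \<Longrightarrow> y < b \<Longrightarrow> H x \<le> H y"
    and bdd: "\<And>x. 0 < x \<Longrightarrow> x < b \<Longrightarrow> C \<le> H x"
  obtains L where "(H \<longlongrightarrow> L) (at_right 0)"
proof
  define L where "L = (INF x\<in>{0<..<b}. H x)"
  have bb: "bdd_below (H ` {0<..<b})" using bdd by (auto intro!: bdd_belowI[of _ C])
  show "(H \<longlongrightarrow> L) (at_right 0)"
  proof (rule order_tendstoI)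
    fix y assume "y < L"
    have "L \<le> H x" if "0 < x" "x < b" for x
      unfolding L_def using that bb by (intro cINF_lower) auto
    with \<open>y < L\<close> show "\<forall>\<^sub>F x in at_right 0. y < H x"
      unfolding eventually_at_right_field using \<open>0 < b\<close> by (intro exI[of _ b]) (auto intro: less_le_trans)
  next
    fix y assume "L < y"
    then obtain x0 where x0: "x0 \<in> {0<..<b}" "H x0 < y"
      unfolding L_def using cINF_less_iff[OF _ bb] \<open>0 < b\<close> by auto
    show "\<forall>\<^sub>F x in at_right 0. H x < y"
      unfolding eventually_at_right_field
      using x0 mono[of _ x0] by (intro exI[of _ x0]) force
  qed
qed

text \<open>The improper integral of \<open>f\<close> from \<open>0\<close>, where \<open>f\<close>
  may be unbounded. Domination by \<open>g'\<close> makes \<open>F + g\<close> monotone and bounded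
  below near \<open>0\<close>, so it converges; as \<open>g\<close> converges, so does
  \<open>F\<close>.\<close>

lemma antiderivative_from_0:
  fixes f g :: "real \<Rightarrow> real"
  assumes f: "continuous_on {0<..} f" and "0 < b"
    and g: "\<And>x. 0 < x \<Longrightarrow> x < b \<Longrightarrow> (g has_real_derivative g' x) (at x)"
    and le: "\<And>x. 0 < x \<Longrightarrow> x < b \<Longrightarrow> \<bar>f x\<bar> \<le> g' x"
    and lim: "(g \<longlongrightarrow> l) (at_right 0)"
  obtains F where "F 0 = y" "continuous_on {0..} F" "\<And>x. 0 < x \<Longrightarrow> (F has_real_derivative f x) (at x)"
proof -
  obtain F where F: "F b = 0" "\<And>x. 0 < x \<Longrightarrow> (F has_real_derivative f x) (at x)"
    using antiderivative_pos_reals[OF f] by blast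
  have dom: "\<bar>F y - F x\<bar> \<le> g y - g x" if "0 < x" "x \<le> y" "y < b" for x y
  proof (rule deriv_dominated[where f'=f and g'=g'])
    show "continuous_on {x..y} F" by (rule continuous_on_DERIV[where f'=f]) (use that F in auto)
    show "continuous_on {x..y} g" by (rule continuous_on_DERIV[where f'=g']) (use that g in auto)
  qed (use that F g le in auto)
  have gm: "g x \<le> g y" if "0 < x" "x \<le> y" "y < b" for x y using dom[OF that] by linarith
  have lg: "l \<le> g x" if "0 < x" "x < b" for x
  proof (rule tendsto_upperbound[OF lim])
    show "\<forall>\<^sub>F i in at_right 0. g i \<le> g x"
      unfolding eventually_at_right_field using that gm[of _ x] by (intro exI[of _ x]) auto
  qed simp
  \<comment> \<open>The lower bound comes from \<open>F x \<ge> F (b/2) - g (b/2) + g x\<close>,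
    with \<open>g x \<ge> l\<close> used twice.\<close>
  obtain L where L: "((\<lambda>x. F x + g x) \<longlongrightarrow> L) (at_right 0)"
  proof (rule tendsto_at_right_0_mono[of "b/2" "\<lambda>x. F x + g x" "F (b/2) - g (b/2) + 2 * l"])
    show "F x + g x \<le> F y + g y" if "0 < x" "x \<le> y" "y < b/2" for x y
      using dom[of x y] that by (auto simp: abs_le_iff)
    show "F (b/2) - g (b/2) + 2 * l \<le> F x + g x" if "0 < x" "x < b/2" for x
      using dom[of x "b/2"] lg[of x] that \<open>0 < b\<close> by (auto simp: abs_le_iff)
  qed (use \<open>0 < b\<close> in auto)
  have lF: "(F \<longlongrightarrow> L - l) (at_right 0)" using tendsto_diff[OF L lim] by simp
  define G where "G = (\<lambda>x. if x = 0 then y else F x - (L - l) + y)"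
  have dG: "(G has_real_derivative f x) (at x)" if "0 < x" for x
  proof -
    have "((\<lambda>x. F x - (L - l) + y) has_real_derivative f x) (at x)"
      by (auto intro!: derivative_eq_intros F that)
    thus ?thesis
      by (rule has_field_derivative_transform_within_open[of _ _ _ "{0<..}"]) (use that in \<open>auto simp: G_def\<close>)
  qed
  have "(G \<longlongrightarrow> y) (at_right 0)"
  proof (rule Lim_transform_eventually)
    show "((\<lambda>x. F x - (L - l) + y) \<longlongrightarrow> y) (at_right 0)"
      by (rule tendsto_eq_intros lF refl)+ simp
    show "\<forall>\<^sub>F x in at_right 0. F x - (L - l) + y = G x"
      by (auto simp: G_def eventually_at_right_field intro!: exI[of _ 1])
  qed
  moreover have "at (0::real) within {0..} = at_right 0" by (rule at_within_Ici_at_right)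
  ultimately have "continuous_on {0..} G"
    unfolding continuous_on_eq_continuous_within
  proof (intro ballI)
    fix x :: real assume G0: "(G \<longlongrightarrow> y) (at_right 0)" and e: "at (0::real) within {0..} = at_right 0" and x: "x \<in> {0..}"
    show "continuous (at x within {0..}) G"
    proof (cases "x = 0")
      case True thus ?thesis using G0 e by (simp add: continuous_within G_def)
    next
      case False thus ?thesis using dG[of x] x DERIV_isCont continuous_at_imp_continuous_at_within by fastforce
    qed
  qed
  thus ?thesis using dG by (intro that[of G]) (auto simp: G_def)
qed

text \<open>Banach's theorem for the norm \<open>sup \<bar>g\<bar> / W\<close>. Only differences of
  iterates need to have finite norm, not the functions themselves, so the iterates are written as a
  telescoping series and summed by the M-test after division by \<open>W\<close>.\<close>

lemma contraction_fixpoint: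
  fixes T :: "(real \<Rightarrow> real) \<Rightarrow> real \<Rightarrow> real"
  assumes W: "\<And>x. x \<in> A \<Longrightarrow> 0 < W x" "continuous_on A W"
    and maps: "\<And>g. continuous_on A g \<Longrightarrow> continuous_on A (T g)"
    and contr: "\<And>g h d x. continuous_on A g \<Longrightarrow> continuous_on A h \<Longrightarrow> 0 \<le> d \<Longrightarrow>
                  (\<And>x. x \<in> A \<Longrightarrow> \<bar>g x - h x\<bar> \<le> d * W x) \<Longrightarrow> x \<in> A \<Longrightarrow> \<bar>T g x - T h x\<bar> \<le> d / 2 * W x"
    and init: "continuous_on A g0" "0 \<le> C" "\<And>x. x \<in> A \<Longrightarrow> \<bar>T g0 x - g0 x\<bar> \<le> C * W x"
  obtains g where "continuous_on A g" "\<And>x. x \<in> A \<Longrightarrow> T g x = g x"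
proof -
  define G where "G = (\<lambda>n. (T ^^ n) g0)"
  have G0: "G 0 = g0" and GS: "G (Suc n) = T (G n)" for n by (auto simp: G_def)
  have cG: "continuous_on A (G n)" for n by (induction n) (auto simp: G0 GS init maps)
  have step: "\<bar>G (Suc n) x - G n x\<bar> \<le> C / 2 ^ n * W x" if "x \<in> A" for n x
    using that
  proof (induction n arbitrary: x)
    case 0 thus ?case using init by (simp add: G0 GS)
  next
    case (Suc n)
    have "\<bar>T (G (Suc n)) x - T (G n) x\<bar> \<le> C / 2 ^ n / 2 * W x"
      by (rule contr) (use Suc cG init in auto)
    thus ?case by (simp add: GS mult.commute)
  qed
  define f where "f = (\<lambda>n x. (G (Suc n) x - G n x) / W x)"
  define S where "S = (\<lambda>x. \<Sum>n. f n x)"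
  have ul: "uniform_limit A (\<lambda>n x. \<Sum>i<n. f i x) S sequentially"
    unfolding S_def
  proof (rule Weierstrass_m_test)
    fix n x assume "x \<in> A"
    thus "norm (f n x) \<le> C * (1/2) ^ n"
      using step[of x n] W(1)[of x] by (simp add: f_def field_simps power_divide)
  qed (intro summable_mult summable_geometric, simp)
  have tel: "(\<Sum>i<n. f i x) = (G n x - g0 x) / W x" for n x
    using sum_lessThan_telescope[of "\<lambda>n. G n x" n] by (simp add: f_def G0 flip: sum_divide_distrib)
  define g where "g = (\<lambda>x. g0 x + W x * S x)"
  have "continuous_on A S"
    by (rule uniform_limit_theorem[OF _ ul])
       (auto simp: tel intro!: always_eventually continuous_intros cG init W dest: W(1))
  hence cg: "continuous_on A g" unfolding g_def by (intro continuous_intros init W)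
  have ev: "\<forall>\<^sub>F n in sequentially. \<forall>x\<in>A. \<bar>G n x - g x\<bar> \<le> e * W x" if "e > 0" for e
    using uniform_limitD[OF ul that]
  proof eventually_elim
    case (elim n)
    show ?case
    proof
      fix x assume x: "x \<in> A"
      have "\<bar>(G n x - g0 x) / W x - S x\<bar> < e" using elim x by (auto simp: tel dist_real_def)
      moreover have "(G n x - g0 x) / W x - S x = (G n x - g x) / W x"
        using W(1)[OF x] by (simp add: g_def field_simps)
      ultimately show "\<bar>G n x - g x\<bar> \<le> e * W x" using W(1)[OF x] by (simp add: field_simps)
    qed
  qed
  have "T g x = g x" if x: "x \<in> A" for x
  proof -
    have "\<bar>T g x - g x\<bar> \<le> 0 + e" if "e > 0" for e
    proof -
      define e' where "e' = e / (2 * W x)"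
      have e': "e' > 0" using that W(1)[OF x] by (simp add: e'_def)
      obtain N where N: "\<And>n x. N \<le> n \<Longrightarrow> x \<in> A \<Longrightarrow> \<bar>G n x - g x\<bar> \<le> e' * W x"
        using ev[OF e'] by (auto simp: eventually_sequentially)
      have "\<bar>T (G N) x - T g x\<bar> \<le> e' / 2 * W x" by (rule contr) (use N cG cg e' x in auto)
      moreover have "\<bar>T (G N) x - g x\<bar> \<le> e' * W x" using N[of "Suc N" x] x by (simp add: GS)
      moreover have "e' * W x = e / 2" using W(1)[OF x] by (simp add: e'_def)
      ultimately show ?thesis using that by linarith
    qed
    hence "\<bar>T g x - g x\<bar> \<le> 0" by (rule field_le_epsilon)
    thus ?thesis by simp
  qed
  thus ?thesis using cg by (intro that[of g])
qed

section \<open>The first-order system\<close>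

lemma DERIV_powr_pos [derivative_intros]:
  fixes r a :: real
  assumes "0 < r"
  shows "((\<lambda>r. r powr a) has_real_derivative a * r powr a / r) (at r)"
  using has_real_derivative_powr[OF assms, of a] assms by (simp add: powr_diff)

locale soliton =
  fixes \<alpha> lam c0 :: real
  assumes alpha_pos: "0 < \<alpha>" and lam_nonneg: "0 \<le> lam" and c0_pos: "0 < c0"
begin

text \<open>For \<open>\<alpha> = sqrt n - 1\<close> the three constants are \<open>n - 1\<close>,
  \<open>c2 + n - 1\<close> and \<open>c2\<close>. The sum \<open>\<beta>\<close> is the coefficient
  that drives \<open>K\<close>, while \<open>\<gamma>\<close> is the source term for
  \<open>V\<close>.\<close>

definition \<nu> :: real where "\<nu> = \<alpha> * (\<alpha> + 2)"
definition \<beta> :: real where "\<beta> = \<nu> * (\<alpha> + 1) / 2"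
definition \<gamma> :: real where "\<gamma> = \<nu> * (\<alpha> - 1) / 2"

lemma nu_pos: "0 < \<nu>" and beta_pos: "0 < \<beta>" and beta_gamma: "\<beta> = \<gamma> + \<nu>" and beta_nu: "2 * \<beta> = (\<alpha> + 1) * \<nu>"
proof -
  show nu: "0 < \<nu>" using alpha_pos by (simp add: \<nu>_def)
  show "0 < \<beta>" using nu alpha_pos by (simp add: \<beta>_def)
  show "\<beta> = \<gamma> + \<nu>" "2 * \<beta> = (\<alpha> + 1) * \<nu>" by (auto simp: \<beta>_def \<gamma>_def field_simps)
qed

definition V :: "(real \<Rightarrow> real) \<Rightarrow> (real \<Rightarrow> real) \<Rightarrow> real \<Rightarrow> real" where
  "V s K r = \<nu> / r + lam - 2 * s r * K r"

text \<open>Values at \<open>r \<le> 0\<close> are left free and nothing is asked of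
  \<open>K\<close> near \<open>0\<close>, where it blows up like \<open>1 / r\<close>. Equality of
  solutions therefore always means equality on \<open>r > 0\<close>.\<close>

definition sol :: "(real \<Rightarrow> real) \<Rightarrow> (real \<Rightarrow> real) \<Rightarrow> bool" where
  "sol s K \<longleftrightarrow>
     (\<forall>r>0. 0 < s r \<and> (s has_real_derivative r powr \<alpha> * V s K r / (2 * s r)) (at r)
        \<and> (K has_real_derivative - (\<beta> + \<alpha> * lam * r / 2) / (2 * r\<^sup>2 * s r)) (at r))
     \<and> (s \<longlongrightarrow> sqrt c0) (at_right 0)"

text \<open>A combination whose derivative consists of the two integrands of (iii) over
  \<open>[r, \<epsilon>]\<close>. The term with \<open>ln (s r)\<close> and \<open>ln c0\<close>
  stands for the integral of \<open>w' / w\<close> over \<open>[0, r]\<close>, which is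
  \<open>2 * ln (s r) - ln c0\<close>.\<close>

definition \<Phi> :: "(real \<Rightarrow> real) \<Rightarrow> (real \<Rightarrow> real) \<Rightarrow> real \<Rightarrow> real" where
  "\<Phi> s K r = V s K r + \<gamma> / r + lam * ln (s r) - lam / 2 * ln c0 - \<alpha> * lam / 2 * ln r"

definition N :: "(real \<Rightarrow> real) \<Rightarrow> (real \<Rightarrow> real) \<Rightarrow> real \<Rightarrow> real" where
  "N s K r = r * r powr \<alpha> * K r + (\<alpha> + 1) * s r"

lemma sol_pos: "sol s K \<Longrightarrow> 0 < r \<Longrightarrow> 0 < s r"
  and sol_DERIV_s: "sol s K \<Longrightarrow> 0 < r \<Longrightarrow> (s has_real_derivative r powr \<alpha> * V s K r / (2 * s r)) (at r)"
  and sol_DERIV_K: "sol s K \<Longrightarrow> 0 < r \<Longrightarrow>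
        (K has_real_derivative - (\<beta> + \<alpha> * lam * r / 2) / (2 * r\<^sup>2 * s r)) (at r)"
  and sol_lim: "sol s K \<Longrightarrow> (s \<longlongrightarrow> sqrt c0) (at_right 0)"
  by (auto simp: sol_def)

lemma sol_cont:
  assumes "sol s K" "S \<subseteq> {0<..}"
  shows "continuous_on S s" "continuous_on S K"
proof -
  show "continuous_on S s"
    by (rule continuous_on_DERIV, rule sol_DERIV_s[OF assms(1)]) (use assms(2) in auto)
  show "continuous_on S K"
    by (rule continuous_on_DERIV, rule sol_DERIV_K[OF assms(1)]) (use assms(2) in auto)
qed

lemma DERIV_sq:
  assumes "sol s K" "0 < r"
  shows "((\<lambda>r. (s r)\<^sup>2) has_real_derivative r powr \<alpha> * V s K r) (at r)"
  using sol_pos[OF assms]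
  by (auto intro!: derivative_eq_intros sol_DERIV_s assms simp: field_simps)

text \<open>This is the second-order equation again. The derivative is a multiple of
  \<open>V\<close> plus the source \<open>\<gamma> / r\<^sup>2 + \<alpha> * lam / (2 * r)\<close>,
  so a sign of \<open>V\<close> is preserved, forwards or backwards, as soon as the source has a
  sign.\<close>

lemma DERIV_V:
  assumes "sol s K" "0 < r"
  shows "(V s K has_real_derivative
    r powr \<alpha> * V s K r * (V s K r - \<nu> / r - lam) / (2 * (s r)\<^sup>2) + \<gamma> / r\<^sup>2 + \<alpha> * lam / (2 * r)) (at r)"
proof -
  have s: "0 < s r" using sol_pos[OF assms] .
  have "V s K = (\<lambda>r. \<nu> / r + lam - 2 * s r * K r)" by (auto simp: V_def)
  moreover have "((\<lambda>r. \<nu> / r + lam - 2 * s r * K r) has_real_derivative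
     - \<nu> / r\<^sup>2 - 2 * (r powr \<alpha> * V s K r / (2 * s r)) * K r - 2 * s r * (- (\<beta> + \<alpha> * lam * r / 2) / (2 * r\<^sup>2 * s r))) (at r)"
    using assms(2) by (auto intro!: derivative_eq_intros sol_DERIV_s sol_DERIV_K assms simp: power2_eq_square)
  moreover have "- \<nu> / r\<^sup>2 - 2 * (r powr \<alpha> * V s K r / (2 * s r)) * K r - 2 * s r * (- (\<beta> + \<alpha> * lam * r / 2) / (2 * r\<^sup>2 * s r))
     = r powr \<alpha> * V s K r * (V s K r - \<nu> / r - lam) / (2 * (s r)\<^sup>2) + \<gamma> / r\<^sup>2 + \<alpha> * lam / (2 * r)"
  proof -
    have K: "K r = - (V s K r - \<nu> / r - lam) / (2 * s r)" using s by (simp add: V_def)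
    have "- \<nu> / r\<^sup>2 - 2 * (p * v / (2 * \<sigma>)) * (- (v - \<nu> / r - lam) / (2 * \<sigma>))
        - 2 * \<sigma> * (- (\<beta> + \<alpha> * lam * r / 2) / (2 * r\<^sup>2 * \<sigma>))
        = p * v * (v - \<nu> / r - lam) / (2 * \<sigma>\<^sup>2) + \<gamma> / r\<^sup>2 + \<alpha> * lam / (2 * r)" if "0 < \<sigma>" for p v \<sigma>
      using that assms(2) by (simp add: beta_gamma divide_simps power2_eq_square) (simp add: algebra_simps)
    from this[OF s, of "r powr \<alpha>" "V s K r"] show ?thesis by (subst K)
  qed
  ultimately show ?thesis by simp
qed

lemma DERIV_Phi:
  assumes "sol s K" "0 < r"
  shows "(\<Phi> s K has_real_derivative r powr \<alpha> * V s K r * (V s K r - \<nu> / r) / (2 * (s r)\<^sup>2)) (at r)"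
proof -
  have s: "0 < s r" using sol_pos[OF assms] .
  have "\<Phi> s K = (\<lambda>r. V s K r + \<gamma> / r + lam * ln (s r) - lam / 2 * ln c0 - \<alpha> * lam / 2 * ln r)"
    by (auto simp: \<Phi>_def)
  moreover have "((\<lambda>r. V s K r + \<gamma> / r + lam * ln (s r) - lam / 2 * ln c0 - \<alpha> * lam / 2 * ln r)
      has_real_derivative
     (r powr \<alpha> * V s K r * (V s K r - \<nu> / r - lam) / (2 * (s r)\<^sup>2) + \<gamma> / r\<^sup>2 + \<alpha> * lam / (2 * r))
      - \<gamma> / r\<^sup>2 + lam * ((r powr \<alpha> * V s K r / (2 * s r)) / s r) - \<alpha> * lam / 2 * (1 / r)) (at r)"
    using assms(2) s
    by (auto intro!: derivative_eq_intros DERIV_V sol_DERIV_s assms simp: power2_eq_square)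
       (simp add: mult_ac)
  moreover have "(r powr \<alpha> * V s K r * (V s K r - \<nu> / r - lam) / (2 * (s r)\<^sup>2) + \<gamma> / r\<^sup>2 + \<alpha> * lam / (2 * r))
      - \<gamma> / r\<^sup>2 + lam * ((r powr \<alpha> * V s K r / (2 * s r)) / s r) - \<alpha> * lam / 2 * (1 / r)
     = r powr \<alpha> * V s K r * (V s K r - \<nu> / r) / (2 * (s r)\<^sup>2)"
    using s assms(2) by (simp add: divide_simps power2_eq_square) (simp add: algebra_simps)
  ultimately show ?thesis by simp
qed

text \<open>The term \<open>(\<alpha> + 1) * r powr \<alpha> * K\<close> produced by the product
  rule cancels against the \<open>K\<close> in \<open>(\<alpha> + 1) * s'\<close>; the weight
  \<open>\<alpha> + 1\<close> of \<open>s\<close> is chosen for this. The rest is positive because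
  \<open>(\<alpha> + 1) * \<nu> = 2 * \<beta>\<close>.\<close>

lemma DERIV_N:
  assumes "sol s K" "0 < r"
  shows "(N s K has_real_derivative r powr \<alpha> * (\<beta> + (\<alpha> / 2 + 1) * lam * r) / (2 * r * s r)) (at r)"
proof -
  have s: "0 < s r" using sol_pos[OF assms] .
  have "N s K = (\<lambda>r. r * r powr \<alpha> * K r + (\<alpha> + 1) * s r)" by (auto simp: N_def)
  moreover have "((\<lambda>r. r * r powr \<alpha> * K r + (\<alpha> + 1) * s r) has_real_derivative
     (\<alpha> + 1) * r powr \<alpha> * K r + r * r powr \<alpha> * (- (\<beta> + \<alpha> * lam * r / 2) / (2 * r\<^sup>2 * s r))
       + (\<alpha> + 1) * (r powr \<alpha> * V s K r / (2 * s r))) (at r)"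
    using assms(2) by (auto intro!: derivative_eq_intros sol_DERIV_s sol_DERIV_K assms simp: algebra_simps add_divide_distrib)
  moreover have "(\<alpha> + 1) * r powr \<alpha> * K r + r * r powr \<alpha> * (- (\<beta> + \<alpha> * lam * r / 2) / (2 * r\<^sup>2 * s r))
       + (\<alpha> + 1) * (r powr \<alpha> * V s K r / (2 * s r)) = r powr \<alpha> * (\<beta> + (\<alpha> / 2 + 1) * lam * r) / (2 * r * s r)"
    using s assms(2) by (simp add: V_def \<beta>_def field_simps power2_eq_square)
  ultimately show ?thesis by simp
qed

lemma tendsto_powr_alpha: "((\<lambda>r. r powr \<alpha>) \<longlongrightarrow> 0) (at_right 0)"
  using alpha_pos by real_asymp

text \<open>L'Hopital against \<open>1 / r\<close>, since \<open>r\<^sup>2 * K'\<close> depends on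
  \<open>s\<close> only and \<open>s\<close> converges. The limit is common to all
  solutions.\<close>

lemma rK_lim:
  assumes "sol s K"
  shows "((\<lambda>r. r * K r) \<longlongrightarrow> \<beta> / (2 * sqrt c0)) (at_right 0)"
proof -
  have "((\<lambda>r. K r / (1 / r)) \<longlongrightarrow> \<beta> / (2 * sqrt c0)) (at_right 0)"
  proof (rule lhopital_right_at_top)
    show "LIM x at_right (0::real). 1 / x :> at_top"
      using filterlim_inverse_at_top_right by (simp add: inverse_eq_divide)
    show "\<forall>\<^sub>F x in at_right 0. - 1 / x\<^sup>2 \<noteq> (0::real)"
      by (auto simp: eventually_at_right_field intro!: exI[of _ 1])
    show "\<forall>\<^sub>F x in at_right 0. ((\<lambda>x. 1 / x) has_real_derivative - 1 / x\<^sup>2) (at x)"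
      by (auto simp: eventually_at_right_field power2_eq_square intro!: exI[of _ 1] derivative_eq_intros)
    show "\<forall>\<^sub>F x in at_right 0. (K has_real_derivative - (\<beta> + \<alpha> * lam * x / 2) / (2 * x\<^sup>2 * s x)) (at x)"
      using sol_DERIV_K[OF assms] by (auto simp: eventually_at_right_field intro!: exI[of _ 1])
    have limq: "((\<lambda>x. (\<beta> + \<alpha> * lam * x / 2) / (2 * s x)) \<longlongrightarrow> (\<beta> + \<alpha> * lam * 0 / 2) / (2 * sqrt c0)) (at_right 0)"
      using c0_pos by (intro tendsto_intros sol_lim[OF assms]) auto
    have quot: "b / (2 * s x) = - b / (2 * x\<^sup>2 * s x) / (- 1 / x\<^sup>2)" if "0 < x" for x b
      using sol_pos[OF assms that] that by (simp add: divide_simps)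
    have "\<forall>\<^sub>F x in at_right 0. (\<beta> + \<alpha> * lam * x / 2) / (2 * s x)
        = - (\<beta> + \<alpha> * lam * x / 2) / (2 * x\<^sup>2 * s x) / (- 1 / x\<^sup>2)"
          unfolding eventually_at_right_field
      by (intro exI[of _ "1::real"] conjI allI impI) (rule zero_less_one, erule quot)
    with limq have "((\<lambda>x. - (\<beta> + \<alpha> * lam * x / 2) / (2 * x\<^sup>2 * s x) / (- 1 / x\<^sup>2)) \<longlongrightarrow> (\<beta> + \<alpha> * lam * 0 / 2) / (2 * sqrt c0)) (at_right 0)"
      by (rule Lim_transform_eventually)
    thus "((\<lambda>x. - (\<beta> + \<alpha> * lam * x / 2) / (2 * x\<^sup>2 * s x) / (- 1 / x\<^sup>2)) \<longlongrightarrow> \<beta> / (2 * sqrt c0)) (at_right 0)"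
      by (simp only: mult_zero_right div_0 add_0_right)
  qed
  thus ?thesis by (simp add: mult.commute)
qed

lemma N_lim:
  assumes "sol s K"
  shows "(N s K \<longlongrightarrow> (\<alpha> + 1) * sqrt c0) (at_right 0)"
proof -
  have "((\<lambda>r. r powr \<alpha> * (r * K r) + (\<alpha> + 1) * s r) \<longlongrightarrow>
      0 * (\<beta> / (2 * sqrt c0)) + (\<alpha> + 1) * sqrt c0) (at_right 0)"
    by (intro tendsto_intros tendsto_powr_alpha rK_lim[OF assms] sol_lim[OF assms])
  thus ?thesis by (simp add: N_def[abs_def] mult_ac)
qed

lemma eventually_s_bounds:
  assumes "sol s K"
  obtains b where "0 < b" "b \<le> 1" "\<And>r. 0 < r \<Longrightarrow> r \<le> b \<Longrightarrow> sqrt c0 / 2 < s r \<and> s r < 2 * sqrt c0"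
proof -
  have "\<forall>\<^sub>F r in at_right 0. sqrt c0 / 2 < s r" "\<forall>\<^sub>F r in at_right 0. s r < 2 * sqrt c0"
    using c0_pos by (intro order_tendstoD[OF sol_lim[OF assms]]; simp)+
  hence "\<forall>\<^sub>F r in at_right 0. sqrt c0 / 2 < s r \<and> s r < 2 * sqrt c0" by (rule eventually_conj)
  then obtain b where "0 < b" "\<And>r. 0 < r \<Longrightarrow> r < b \<Longrightarrow> sqrt c0 / 2 < s r \<and> s r < 2 * sqrt c0"
    by (auto simp: eventually_at_right_field)
  thus ?thesis by (intro that[of "min 1 (b/2)"]) auto
qed

end

section \<open>The difference of two solutions as a linear system\<close>

locale soliton_pair = soliton +
  fixes s1 K1 s2 K2 :: "real \<Rightarrow> real"
  assumes sol1: "sol s1 K1" and sol2: "sol s2 K2"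
begin

text \<open>The signs are such that \<open>D\<close>, \<open>\<kappa>\<close> and \<open>Q\<close>
  are all positive when the second solution is the larger one in \<open>s\<close>, hence the smaller
  one in \<open>K\<close>.\<close>

definition D :: "real \<Rightarrow> real" where "D r = s2 r - s1 r"
definition \<kappa> :: "real \<Rightarrow> real" where "\<kappa> r = K1 r - K2 r"
definition Q :: "real \<Rightarrow> real" where "Q r = N s1 K1 r - N s2 K2 r"

lemma Q_kappa: "Q r = r * r powr \<alpha> * \<kappa> r - (\<alpha> + 1) * D r"
  by (simp add: Q_def N_def D_def \<kappa>_def algebra_simps)

lemma DERIV_Q:
  assumes "0 < r"
  shows "(Q has_real_derivative r powr \<alpha> * (\<beta> + (\<alpha> / 2 + 1) * lam * r) / (2 * r * s1 r * s2 r) * D r) (at r)"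
proof -
  have "p / (2 * r * x) - p / (2 * r * y) = p / (2 * r * x * y) * (y - x)" if "0 < x" "0 < y" for p x y
    using that assms by (simp add: field_simps)
  with DERIV_diff[OF DERIV_N[OF sol1 assms] DERIV_N[OF sol2 assms]] sol_pos[OF sol1 assms] sol_pos[OF sol2 assms]
  show ?thesis by (simp only: Q_def[abs_def] D_def)
qed

lemma DERIV_kappa:
  assumes "0 < r"
  shows "(\<kappa> has_real_derivative - (\<beta> + \<alpha> * lam * r / 2) / (2 * r\<^sup>2 * s1 r * s2 r) * D r) (at r)"
proof -
  have "p / (2 * r\<^sup>2 * x) - p / (2 * r\<^sup>2 * y) = p / (2 * r\<^sup>2 * x * y) * (y - x)" if "0 < x" "0 < y" for p x y
    using that assms by (simp add: field_simps)
  with DERIV_diff[OF sol_DERIV_K[OF sol1 assms] sol_DERIV_K[OF sol2 assms]] sol_pos[OF sol1 assms] sol_pos[OF sol2 assms]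
  show ?thesis by (simp only: \<kappa>_def[abs_def] D_def)
qed

lemma DERIV_D_kappa:
  assumes "0 < r"
  shows "(D has_real_derivative
    r powr \<alpha> * \<kappa> r - r powr \<alpha> * (\<nu> + lam * r) / (2 * r * s1 r * s2 r) * D r) (at r)"
proof -
  have "p * (\<nu> / r + lam - 2 * y * k2) / (2 * y) - p * (\<nu> / r + lam - 2 * x * k1) / (2 * x)
      = p * (k1 - k2) - p * (\<nu> + lam * r) / (2 * r * x * y) * (y - x)" if "0 < x" "0 < y" for p x y k1 k2
    using that assms by (simp add: divide_simps) (simp add: algebra_simps)
  with DERIV_diff[OF sol_DERIV_s[OF sol2 assms] sol_DERIV_s[OF sol1 assms]] sol_pos[OF sol1 assms] sol_pos[OF sol2 assms]
  show ?thesis by (simp only: \<kappa>_def V_def D_def[abs_def])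
qed

lemma DERIV_D:
  assumes "0 < r"
  shows "(D has_real_derivative
    ((\<alpha> + 1) * D r + Q r) / r - r powr \<alpha> * (\<nu> + lam * r) / (2 * r * s1 r * s2 r) * D r) (at r)"
proof -
  have "((\<alpha> + 1) * D r + Q r) / r = r powr \<alpha> * \<kappa> r" using assms by (simp add: Q_kappa)
  thus ?thesis using DERIV_D_kappa[OF assms] by simp
qed

lemma D_lim: "(D \<longlongrightarrow> 0) (at_right 0)"
  using tendsto_diff[OF sol_lim[OF sol2] sol_lim[OF sol1]] by (simp add: D_def[abs_def])

lemma Q_lim: "(Q \<longlongrightarrow> 0) (at_right 0)"
  using tendsto_diff[OF N_lim[OF sol1] N_lim[OF sol2]] by (simp add: Q_def[abs_def])

lemma cont_D: "S \<subseteq> {0<..} \<Longrightarrow> continuous_on S D"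
  by (rule continuous_on_DERIV[OF DERIV_D]) auto
lemma cont_Q: "S \<subseteq> {0<..} \<Longrightarrow> continuous_on S Q"
  by (rule continuous_on_DERIV[OF DERIV_Q]) auto

end

section \<open>Ordering of solutions\<close>

context soliton_pair begin

lemma cont_quotient:
  assumes "S \<subseteq> {0<..}"
  shows "continuous_on S (\<lambda>y. y powr \<alpha> * (a + b * y) / (2 * y * s1 y * s2 y))"
proof -
  have "2 * y * s1 y * s2 y \<noteq> 0" "y \<noteq> 0" if "y \<in> S" for y
    using assms that sol_pos[OF sol1, of y] sol_pos[OF sol2, of y] by auto
  thus ?thesis by (intro continuous_intros sol_cont[OF sol1 assms] sol_cont[OF sol2 assms]) auto
qed

text \<open>A substitute for Gronwall at the singular point, where \<open>D\<close> and
  \<open>Q\<close> both tend to \<open>0\<close>. Integrating \<open>Q'\<close> from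
  \<open>0\<close> bounds \<open>\<bar>Q\<bar>\<close> by \<open>r powr \<alpha>\<close> times the
  supremum of \<open>\<bar>D\<bar>\<close>. Inserting this into the equation of \<open>D\<close>
  bounds \<open>\<bar>D \<rho>\<bar>\<close> by \<open>\<bar>D r\<bar>\<close> plus a small multiple
  of that supremum, which is absorbed. Hence a zero of \<open>D\<close> at a small radius makes
  \<open>D\<close> vanish at all smaller ones.\<close>

lemma D_dominated_near_0:
  obtains b where "0 < b" "\<And>\<rho> r. 0 < \<rho> \<Longrightarrow> \<rho> \<le> r \<Longrightarrow> r \<le> b \<Longrightarrow> \<bar>D \<rho>\<bar> \<le> 2 * \<bar>D r\<bar>"
proof -
  obtain b1 where b1: "0 < b1" "b1 \<le> 1" "\<And>r. 0 < r \<Longrightarrow> r \<le> b1 \<Longrightarrow> sqrt c0 / 2 < s1 r"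
    using eventually_s_bounds[OF sol1] by metis
  obtain b2 where b2: "0 < b2" "b2 \<le> 1" "\<And>r. 0 < r \<Longrightarrow> r \<le> b2 \<Longrightarrow> sqrt c0 / 2 < s2 r"
    using eventually_s_bounds[OF sol2] by metis
  define \<sigma> where "\<sigma> = sqrt c0 / 2"
  have \<sigma>: "0 < \<sigma>" using c0_pos by (simp add: \<sigma>_def)
  \<comment> \<open>\<open>C1\<close> and \<open>C2\<close> bound the coefficients of
    \<open>D\<close> in \<open>Q'\<close> and \<open>D'\<close> up to the factor
    \<open>r powr \<alpha> / r\<close>. Integrating this factor for \<open>Q\<close> costs
    \<open>1 / \<alpha>\<close>, which explains \<open>C3\<close>.\<close>
  define C1 where "C1 = (\<beta> + (\<alpha> / 2 + 1) * lam) / (2 * \<sigma>\<^sup>2)"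
  define C2 where "C2 = (\<nu> + lam) / (2 * \<sigma>\<^sup>2)"
  define C3 where "C3 = C1 / \<alpha> + C2"
  have C: "0 < C1" "0 < C2" "0 < C3"
  proof -
    show "0 < C1" unfolding C1_def using \<sigma> beta_pos lam_nonneg alpha_pos
      by (intro divide_pos_pos add_pos_nonneg mult_nonneg_nonneg) auto
    moreover show "0 < C2" unfolding C2_def using \<sigma> nu_pos lam_nonneg
      by (intro divide_pos_pos add_pos_nonneg) auto
    ultimately show "0 < C3" unfolding C3_def using alpha_pos by (intro add_pos_pos divide_pos_pos)
  qed
  have "\<forall>\<^sub>F r in at_right 0. r powr \<alpha> < 1 / (2 * C3)"
    by (rule order_tendstoD[OF tendsto_powr_alpha]) (use C in auto)
  then obtain b3 where b3: "0 < b3" "\<And>r. 0 < r \<Longrightarrow> r < b3 \<Longrightarrow> r powr \<alpha> < 1 / (2 * C3)"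
    by (auto simp: eventually_at_right_field)
  define b where "b = min (b3 / 2) (min b1 b2)"
  have b: "0 < b" "b \<le> 1" "\<And>r. 0 < r \<Longrightarrow> r \<le> b \<Longrightarrow> \<sigma> < s1 r \<and> \<sigma> < s2 r \<and> C3 * r powr \<alpha> < 1 / 2"
    using b1 b2 b3 C by (auto simp: b_def \<sigma>_def field_simps)
  have prod: "2 * r * \<sigma>\<^sup>2 \<le> 2 * r * s1 r * s2 r" if "0 < r" "r \<le> b" for r
    using b(3)[OF that] that \<sigma> by (simp add: power2_eq_square mult.assoc) (intro mult_mono; simp)
  have main: "\<bar>D \<rho>\<bar> \<le> \<bar>D r\<bar> + C3 * A * r powr \<alpha>"
    if r: "0 < \<rho>" "\<rho> \<le> r" "r \<le> b" and A: "\<And>x. 0 < x \<Longrightarrow> x \<le> r \<Longrightarrow> \<bar>D x\<bar> \<le> A" for \<rho> r A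
  proof -
    have A0: "0 \<le> A" using A[OF r(1,2)] by linarith
    have coeff: "k / (2 * x * s1 x * s2 x) \<le> k' / (2 * \<sigma>\<^sup>2) / x" if "0 < x" "x \<le> b" "0 \<le> k" "k \<le> k'" for x k k'
    proof -
      have "k / (2 * x * s1 x * s2 x) \<le> k' / (2 * x * \<sigma>\<^sup>2)"
        by (rule frac_le) (use that prod[OF that(1,2)] \<sigma> in auto)
      thus ?thesis by (simp add: field_simps)
    qed
    have Qb: "\<bar>Q x\<bar> \<le> C1 * A * x powr \<alpha> / \<alpha>" if x: "0 < x" "x \<le> r" for x
    proof -
      have incr: "\<bar>Q x - Q y\<bar> \<le> C1 * A * x powr \<alpha> / \<alpha> - C1 * A * y powr \<alpha> / \<alpha>" if y: "0 < y" "y \<le> x" for y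
      proof (rule deriv_dominated[where g = "\<lambda>x. C1 * A * x powr \<alpha> / \<alpha>"])
        show "continuous_on {y..x} Q" by (rule cont_Q) (use y in auto)
        show "continuous_on {y..x} (\<lambda>x. C1 * A * x powr \<alpha> / \<alpha>)" using y alpha_pos by (auto intro!: continuous_intros)
        fix u assume u: "y < u" "u < x"
        show "(Q has_real_derivative u powr \<alpha> * (\<beta> + (\<alpha> / 2 + 1) * lam * u) / (2 * u * s1 u * s2 u) * D u) (at u)"
          by (rule DERIV_Q) (use u y in auto)
        show "((\<lambda>x. C1 * A * x powr \<alpha> / \<alpha>) has_real_derivative u powr \<alpha> * (C1 / u) * A) (at u)"
          using u y alpha_pos by (auto intro!: derivative_eq_intros)
        have u': "0 < u" "u \<le> b" "u \<le> r" using u y x r by auto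
        have "(\<beta> + (\<alpha> / 2 + 1) * lam * u) / (2 * u * s1 u * s2 u) \<le> C1 / u"
          unfolding C1_def
        proof (rule coeff)
          show "0 \<le> \<beta> + (\<alpha> / 2 + 1) * lam * u"
            using u' beta_pos lam_nonneg alpha_pos by (intro add_nonneg_nonneg mult_nonneg_nonneg) auto
          show "\<beta> + (\<alpha> / 2 + 1) * lam * u \<le> \<beta> + (\<alpha> / 2 + 1) * lam"
            using u' b(2) lam_nonneg alpha_pos mult_left_mono[of u 1 "(\<alpha> / 2 + 1) * lam"] by simp
        qed (use u' in auto)
        moreover have "0 \<le> (\<beta> + (\<alpha> / 2 + 1) * lam * u) / (2 * u * s1 u * s2 u)"
          using u' sol_pos[OF sol1 u'(1)] sol_pos[OF sol2 u'(1)] beta_pos lam_nonneg alpha_pos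
          by (intro divide_nonneg_pos add_nonneg_nonneg mult_nonneg_nonneg mult_pos_pos) auto
        ultimately show "\<bar>u powr \<alpha> * (\<beta> + (\<alpha> / 2 + 1) * lam * u) / (2 * u * s1 u * s2 u) * D u\<bar> \<le> u powr \<alpha> * (C1 / u) * A"
          unfolding abs_mult times_divide_eq_right[symmetric] using A[OF u'(1,3)] C(1,2) u'(1)
          by (intro mult_mono) auto
      qed (use y in auto)
      have "\<bar>Q x - Q y\<bar> \<le> C1 * A * x powr \<alpha> / \<alpha>" if "0 < y" "y \<le> x" for y
      proof -
        have "C1 * A * y powr \<alpha> / \<alpha> \<ge> 0" using C A0 alpha_pos by auto
        thus ?thesis using incr[OF that] by linarith
      qed
      hence "\<forall>\<^sub>F y in at_right 0. \<bar>Q x - Q y\<bar> \<le> C1 * A * x powr \<alpha> / \<alpha>"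
        using x by (auto simp: eventually_at_right_field intro!: exI[of _ x])
      moreover have "((\<lambda>y. \<bar>Q x - Q y\<bar>) \<longlongrightarrow> \<bar>Q x - 0\<bar>) (at_right 0)"
        by (intro tendsto_intros Q_lim)
      ultimately show ?thesis by (auto dest: tendsto_upperbound)
    qed
    \<comment> \<open>\<open>r * r powr \<alpha>\<close> solves
      \<open>u' = (\<alpha> + 1) * u / r\<close>; dividing by it removes the dominant term of
      \<open>D'\<close>.\<close>
    define y where "y = (\<lambda>x. D x / (x * x powr \<alpha>))"
    have yd: "(y has_real_derivative (Q x / x - x powr \<alpha> * (\<nu> + lam * x) / (2 * x * s1 x * s2 x) * D x) / (x * x powr \<alpha>)) (at x)"
      if "0 < x" for x
    proof -
      have p: "0 < x powr \<alpha>" using that by simp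
      have "(y has_real_derivative ((((\<alpha> + 1) * D x + Q x) / x - x powr \<alpha> * (\<nu> + lam * x) / (2 * x * s1 x * s2 x) * D x) * (x * x powr \<alpha>)
             - D x * ((\<alpha> + 1) * x powr \<alpha>)) / (x * x powr \<alpha>)\<^sup>2) (at x)"
        unfolding y_def using that p
        by (auto intro!: derivative_eq_intros DERIV_D simp: power2_eq_square distrib_right)
      moreover have "((((\<alpha> + 1) * d + q) / x - e) * (x * p) - d * ((\<alpha> + 1) * p)) / (x * p)\<^sup>2 = (q / x - e) / (x * p)"
        if "p > 0" for d q e p using that \<open>0 < x\<close> by (simp add: divide_simps power2_eq_square) (simp add: algebra_simps)
      ultimately show ?thesis using p by metis
    qed
    have "\<bar>y r - y \<rho>\<bar> \<le> - (C3 * A) / r - - (C3 * A) / \<rho>"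
    proof (rule deriv_dominated[where g = "\<lambda>x. - (C3 * A) / x"])
      show "continuous_on {\<rho>..r} y" by (rule continuous_on_DERIV[OF yd]) (use r in auto)
      show "continuous_on {\<rho>..r} (\<lambda>x. - (C3 * A) / x)" using r by (auto intro!: continuous_intros)
      fix u assume u: "\<rho> < u" "u < r"
      have u': "0 < u" "u \<le> b" "u \<le> r" using u r by auto
      show "(y has_real_derivative (Q u / u - u powr \<alpha> * (\<nu> + lam * u) / (2 * u * s1 u * s2 u) * D u) / (u * u powr \<alpha>)) (at u)"
        by (rule yd) (use u' in auto)
      show "((\<lambda>x. - (C3 * A) / x) has_real_derivative C3 * A / u\<^sup>2) (at u)"
        using u' by (auto intro!: derivative_eq_intros simp: power2_eq_square)
      have p: "0 < u powr \<alpha>" using u' by simp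
      have "(\<nu> + lam * u) / (2 * u * s1 u * s2 u) \<le> C2 / u"
        unfolding C2_def
      proof (rule coeff)
        show "0 \<le> \<nu> + lam * u" using u' nu_pos lam_nonneg by (intro add_nonneg_nonneg mult_nonneg_nonneg) auto
        show "\<nu> + lam * u \<le> \<nu> + lam" using u' b(2) lam_nonneg mult_left_mono[of u 1 lam] by simp
      qed (use u' in auto)
      moreover have "0 \<le> (\<nu> + lam * u) / (2 * u * s1 u * s2 u)"
        using u' sol_pos[OF sol1 u'(1)] sol_pos[OF sol2 u'(1)] nu_pos lam_nonneg
        by (intro divide_nonneg_pos add_nonneg_nonneg mult_nonneg_nonneg mult_pos_pos) auto
      ultimately have "\<bar>u powr \<alpha> * (\<nu> + lam * u) / (2 * u * s1 u * s2 u) * D u\<bar> \<le> u powr \<alpha> * (C2 / u) * A"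
        unfolding abs_mult times_divide_eq_right[symmetric] using A[OF u'(1,3)] C(1,2) u'(1)
          by (intro mult_mono) auto
      moreover have "\<bar>Q u / u\<bar> \<le> (C1 * A * u powr \<alpha> / \<alpha>) / u"
        using divide_right_mono[OF Qb[OF u'(1,3)], of u] u'(1) by (simp only: abs_divide abs_of_pos less_imp_le)
      ultimately have "\<bar>Q u / u - u powr \<alpha> * (\<nu> + lam * u) / (2 * u * s1 u * s2 u) * D u\<bar>
          \<le> (C1 * A * u powr \<alpha> / \<alpha>) / u + u powr \<alpha> * (C2 / u) * A" by linarith
      also have "\<dots> = C3 * A * u powr \<alpha> / u"
        using u' alpha_pos by (simp add: C3_def field_simps)
      finally have "\<bar>Q u / u - u powr \<alpha> * (\<nu> + lam * u) / (2 * u * s1 u * s2 u) * D u\<bar> / (u * u powr \<alpha>)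
          \<le> C3 * A * u powr \<alpha> / u / (u * u powr \<alpha>)"
        using p u' by (intro divide_right_mono) auto
      thus "\<bar>(Q u / u - u powr \<alpha> * (\<nu> + lam * u) / (2 * u * s1 u * s2 u) * D u) / (u * u powr \<alpha>)\<bar> \<le> C3 * A / u\<^sup>2"
        using p u' by (simp add: abs_mult power2_eq_square)
    qed (use r in auto)
    moreover have "0 \<le> C3 * A / r" using C A0 r by auto
    ultimately have "\<bar>y \<rho>\<bar> \<le> \<bar>y r\<bar> + C3 * A / \<rho>" by (auto simp: abs_le_iff)
    hence "\<bar>y \<rho>\<bar> * (\<rho> * \<rho> powr \<alpha>) \<le> (\<bar>y r\<bar> + C3 * A / \<rho>) * (\<rho> * \<rho> powr \<alpha>)"
      using r by (intro mult_right_mono) auto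
    also have "\<dots> = \<bar>y r\<bar> * (\<rho> * \<rho> powr \<alpha>) + C3 * A * \<rho> powr \<alpha>" using r by (simp add: field_simps)
    also have "\<dots> \<le> \<bar>y r\<bar> * (r * r powr \<alpha>) + C3 * A * r powr \<alpha>"
      using r C A0 alpha_pos by (intro add_mono mult_left_mono mult_mono powr_mono2) auto
    also have "\<bar>y r\<bar> * (r * r powr \<alpha>) = \<bar>D r\<bar>" using r by (simp add: y_def abs_mult)
    also have "\<bar>y \<rho>\<bar> * (\<rho> * \<rho> powr \<alpha>) = \<bar>D \<rho>\<bar>" using r by (simp add: y_def abs_mult)
    finally show ?thesis .
  qed
  show ?thesis
  proof (rule that[OF b(1)])
    fix \<rho> r :: real assume r: "0 < \<rho>" "\<rho> \<le> r" "r \<le> b"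
    \<comment> \<open>With the value \<open>0\<close> at the origin \<open>\<bar>D\<bar>\<close>
      becomes continuous on a compact interval, so its supremum is finite and attained at some
      \<open>m\<close>. Only then can a multiple of it be absorbed.\<close>
    define E where "E = (\<lambda>x. if x = 0 then 0 else \<bar>D x\<bar>)"
    have "continuous_on {0..r} E"
      unfolding continuous_on_eq_continuous_within
    proof
      fix x assume x: "x \<in> {0..r}"
      show "continuous (at x within {0..r}) E"
      proof (cases "x = 0")
        case True
        have "((\<lambda>x. \<bar>D x\<bar>) \<longlongrightarrow> 0) (at_right 0)" using tendsto_rabs[OF D_lim] by simp
        hence "(E \<longlongrightarrow> 0) (at_right 0)"
          by (rule Lim_transform_eventually) (auto simp: E_def eventually_at_right_field intro!: exI[of _ 1])
        moreover have "at (0::real) within {0..r} = at_right 0" using r by (intro at_within_Icc_at_right) auto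
        ultimately show ?thesis using True by (simp add: continuous_within E_def)
      next
        case False
        hence x0: "0 < x" using x by simp
        have "isCont (\<lambda>x. \<bar>D x\<bar>) x" using DERIV_isCont[OF DERIV_D[OF x0]] by (intro continuous_intros)
        moreover have "\<forall>\<^sub>F y in nhds x. \<bar>D y\<bar> = E y"
          by (rule eventually_mono[OF eventually_nhds_in_open[of "{0<..}" x]]) (use x0 in \<open>auto simp: E_def\<close>)
        ultimately have "isCont E x" by (simp add: isCont_cong)
        thus ?thesis by (rule continuous_at_imp_continuous_at_within)
      qed
    qed
    then obtain m where m: "m \<in> {0..r}" "\<And>x. x \<in> {0..r} \<Longrightarrow> E x \<le> E m"
      using continuous_attains_sup[of "{0..r}" E] r by auto
    have bd: "\<bar>D x\<bar> \<le> E m" if "0 < x" "x \<le> r" for x using m(2)[of x] that by (auto simp: E_def)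
    have "E m \<le> \<bar>D r\<bar> + C3 * E m * r powr \<alpha>"
    proof (cases "m = 0")
      case True thus ?thesis by (simp add: E_def)
    next
      case False
      thus ?thesis using main[of m r "E m"] bd m(1) r by (auto simp: E_def split: if_splits)
    qed
    moreover have "0 \<le> E m" using bd[OF r(1,2)] by linarith
    hence "C3 * E m * r powr \<alpha> \<le> E m / 2"
      using b(3)[of r] r mult_right_mono[of "C3 * r powr \<alpha>" "1/2" "E m"] by (simp add: mult_ac)
    ultimately have "E m \<le> 2 * \<bar>D r\<bar>" by linarith
    thus "\<bar>D \<rho>\<bar> \<le> 2 * \<bar>D r\<bar>" using bd[OF r(1,2)] by linarith
  qed
qed

text \<open>Up to a first zero of \<open>D\<close> the function \<open>Q\<close> is nondecreasing,
  hence positive. Then \<open>D'\<close> is at least a continuous multiple of \<open>D\<close>, so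
  that \<open>D\<close> is still positive at this zero, a contradiction.\<close>

lemma DQ_pos_propagate:
  assumes "0 < r0" "0 < D r0" "0 < Q r0" "r0 \<le> r"
  shows "0 < D r \<and> 0 < Q r"
proof -
  have Qmono: "Q r0 \<le> Q x" if x: "r0 \<le> x" and pos: "\<And>y. r0 < y \<Longrightarrow> y < x \<Longrightarrow> 0 \<le> D y" for x
  proof (rule DERIV_nonneg_imp_increasing_open[OF x])
    fix y assume y: "r0 < y" "y < x"
    have "0 \<le> y powr \<alpha> * (\<beta> + (\<alpha> / 2 + 1) * lam * y) / (2 * y * s1 y * s2 y) * D y"
      using y assms(1) pos[OF y] sol_pos[OF sol1, of y] sol_pos[OF sol2, of y] beta_pos lam_nonneg alpha_pos
      by (intro mult_nonneg_nonneg divide_nonneg_nonneg add_nonneg_nonneg) auto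
    thus "\<exists>d. (Q has_real_derivative d) (at y) \<and> 0 \<le> d" using DERIV_Q[of y] y assms(1) by auto
  qed (use assms in \<open>auto intro!: cont_Q\<close>)
  define p where "p = (\<lambda>y. (\<alpha> + 1) / y - y powr \<alpha> * (\<nu> + lam * y) / (2 * y * s1 y * s2 y))"
  have cp: "continuous_on {r0..x} p" for x
    unfolding p_def using assms(1) by (intro continuous_intros cont_quotient) auto
  have "0 < D x" if x: "r0 \<le> x" for x
  proof (rule ccontr)
    assume neg: "\<not> 0 < D x"
    define S where "S = {y \<in> {r0..x}. D y \<le> 0}"
    have "S = {r0..x} \<inter> D -` {..0}" by (auto simp: S_def)
    hence "closed S" using continuous_closed_preimage[OF cont_D[of "{r0..x}"], of "{..0}"] assms(1) by fastforce
    moreover have "S \<noteq> {}" "bdd_below S" using neg x by (auto simp: S_def)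
    ultimately have cS: "Inf S \<in> S" by (intro closed_contains_Inf)
    define c where "c = Inf S"
    have c: "r0 \<le> c" "D c \<le> 0" using cS by (auto simp: S_def c_def)
    have pos: "0 < D y" if "r0 \<le> y" "y < c" for y
    proof (rule ccontr)
      assume "\<not> 0 < D y"
      hence "y \<in> S" using that cS by (auto simp: S_def c_def)
      hence "c \<le> y" unfolding c_def using \<open>bdd_below S\<close> by (rule cInf_lower)
      thus False using that by simp
    qed
    have "- D c < 0"
    proof (rule linear_ode_neg[OF c(1) _ cp, where z = "\<lambda>y. - D y"])
      show "continuous_on {r0..c} (\<lambda>y. - D y)" using assms(1) by (intro continuous_intros cont_D) auto
      show "- D r0 < 0" using assms by simp
      fix y assume y: "r0 < y" "y < c"
      hence y0: "0 < y" using assms(1) by simp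
      show "((\<lambda>y. - D y) has_real_derivative - (((\<alpha> + 1) * D y + Q y) / y - y powr \<alpha> * (\<nu> + lam * y) / (2 * y * s1 y * s2 y) * D y)) (at y)"
        using DERIV_minus[OF DERIV_D[OF y0]] .
      have "Q r0 \<le> Q y" by (rule Qmono) (use pos y in \<open>auto intro: less_imp_le\<close>)
      hence "0 < Q y" using assms(3) by linarith
      thus "- (((\<alpha> + 1) * D y + Q y) / y - y powr \<alpha> * (\<nu> + lam * y) / (2 * y * s1 y * s2 y) * D y) \<le> p y * - D y"
        using y0 by (simp add: p_def algebra_simps add_divide_distrib)
    qed
    thus False using c by simp
  qed
  moreover from this have "Q r0 \<le> Q r" by (intro Qmono) (use assms(4) in \<open>auto intro: less_imp_le\<close>)
  ultimately show ?thesis using assms(3,4) by auto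
qed

text \<open>Away from \<open>0\<close> the coefficients are continuous, so Gronwall for
  \<open>D\<^sup>2 + Q\<^sup>2\<close> applies.\<close>

lemma DQ_zero_propagate:
  assumes "0 < r0" "D r0 = 0" "Q r0 = 0" "r0 \<le> r"
  shows "D r = 0 \<and> Q r = 0"
proof -
  define a where "a = (\<lambda>y. (\<alpha> + 1) / y - y powr \<alpha> * (\<nu> + lam * y) / (2 * y * s1 y * s2 y))"
  define c where "c = (\<lambda>y. y powr \<alpha> * (\<beta> + (\<alpha> / 2 + 1) * lam * y) / (2 * y * s1 y * s2 y))"
  define p where "p = (\<lambda>y. 2 * \<bar>a y\<bar> + 1 / y + \<bar>c y\<bar>)"
  have cont: "continuous_on {r0..r} p"
  proof -
    have "continuous_on {r0..r} c" unfolding c_def by (rule cont_quotient) (use assms(1) in auto)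
    moreover have "continuous_on {r0..r} (\<lambda>y. (\<alpha> + 1) / y)" using assms(1) by (intro continuous_intros) auto
    hence "continuous_on {r0..r} a" unfolding a_def
      by (rule continuous_on_diff) (rule cont_quotient, use assms(1) in auto)
    ultimately show ?thesis unfolding p_def using assms(1) by (intro continuous_intros) auto
  qed
  have "(D r)\<^sup>2 + (Q r)\<^sup>2 \<le> 0"
  proof (rule linear_ode_nonpos[OF assms(4) _ cont, where z = "\<lambda>y. (D y)\<^sup>2 + (Q y)\<^sup>2"])
    show "continuous_on {r0..r} (\<lambda>y. (D y)\<^sup>2 + (Q y)\<^sup>2)"
      using assms(1) by (intro continuous_intros cont_D cont_Q) auto
    fix y assume y: "r0 < y" "y < r"
    hence y0: "0 < y" using assms(1) by simp
    have dD: "(D has_real_derivative a y * D y + Q y / y) (at y)"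
      using DERIV_D[OF y0] by (simp add: a_def algebra_simps add_divide_distrib)
    have dQ: "(Q has_real_derivative c y * D y) (at y)" using DERIV_Q[OF y0] by (simp add: c_def)
    show "((\<lambda>y. (D y)\<^sup>2 + (Q y)\<^sup>2) has_real_derivative 2 * D y * (a y * D y + Q y / y) + 2 * Q y * (c y * D y)) (at y)"
      by (auto intro!: derivative_eq_intros dD dQ)
    have DQ: "2 * \<bar>D y * Q y\<bar> \<le> (D y)\<^sup>2 + (Q y)\<^sup>2"
      using sum_squares_bound[of "\<bar>D y\<bar>" "\<bar>Q y\<bar>"] by (simp add: abs_mult)
    have "2 * D y * (a y * D y + Q y / y) + 2 * Q y * (c y * D y) = 2 * a y * (D y)\<^sup>2 + (1 / y + c y) * (2 * (D y * Q y))"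
      by (simp add: algebra_simps power2_eq_square)
    also have "2 * a y * (D y)\<^sup>2 \<le> 2 * \<bar>a y\<bar> * ((D y)\<^sup>2 + (Q y)\<^sup>2)"
      by (rule order_trans[OF mult_right_mono[of "2 * a y" "2 * \<bar>a y\<bar>"] mult_left_mono]) auto
    also have "(1 / y + c y) * (2 * (D y * Q y)) \<le> (1 / y + \<bar>c y\<bar>) * ((D y)\<^sup>2 + (Q y)\<^sup>2)"
    proof -
      have "(1 / y + c y) * (2 * (D y * Q y)) \<le> \<bar>1 / y + c y\<bar> * \<bar>2 * (D y * Q y)\<bar>" by (metis abs_ge_self abs_mult)
      also have "\<dots> \<le> (1 / y + \<bar>c y\<bar>) * ((D y)\<^sup>2 + (Q y)\<^sup>2)" using DQ y0 abs_triangle_ineq[of "1 / y" "c y"] by (intro mult_mono) (auto simp: abs_mult)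
      finally show ?thesis .
    qed
    finally show "2 * D y * (a y * D y + Q y / y) + 2 * Q y * (c y * D y) \<le> p y * ((D y)\<^sup>2 + (Q y)\<^sup>2)"
      by (simp add: p_def algebra_simps)
  qed (use assms in auto)
  thus ?thesis using sum_power2_le_zero_iff by blast
qed

lemma DQ_pos_of_near_0:
  assumes "0 < b" "\<And>x. 0 < x \<Longrightarrow> x \<le> b \<Longrightarrow> 0 < D x"
  shows "\<forall>r>0. 0 < D r \<and> 0 < Q r"
proof (intro allI impI)
  have Qpos: "0 < Q x" if x: "0 < x" "x \<le> b" for x
  proof -
    have incr: "Q u < Q v" if "0 < u" "u < v" "v \<le> b" for u v
    proof (rule DERIV_pos_imp_increasing[OF that(2)])
      fix y assume y: "u \<le> y" "y \<le> v"
      have "0 < y powr \<alpha> * (\<beta> + (\<alpha> / 2 + 1) * lam * y) / (2 * y * s1 y * s2 y) * D y"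
        using y that assms(2)[of y] sol_pos[OF sol1, of y] sol_pos[OF sol2, of y] beta_pos lam_nonneg alpha_pos
        by (intro divide_pos_pos mult_pos_pos add_pos_nonneg mult_nonneg_nonneg) auto
      thus "\<exists>d. (Q has_real_derivative d) (at y) \<and> 0 < d" using DERIV_Q[of y] y that(1) by auto
    qed
    have "0 \<le> Q (x/2)"
    proof (rule tendsto_upperbound[OF Q_lim])
      show "\<forall>\<^sub>F i in at_right 0. Q i \<le> Q (x/2)"
        unfolding eventually_at_right_field using x incr[of _ "x/2"] by (intro exI[of _ "x/2"]) (auto intro: less_imp_le)
    qed simp
    also have "Q (x/2) < Q x" using x by (intro incr) auto
    finally show ?thesis .
  qed
  fix r :: real assume r: "0 < r"
  show "0 < D r \<and> 0 < Q r"
  proof (cases "r \<le> b")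
    case True thus ?thesis using r assms Qpos by auto
  next
    case False thus ?thesis using DQ_pos_propagate[of b r] assms Qpos[of b] by auto
  qed
qed

end

context soliton begin

lemma soliton_pairI: "sol s1 K1 \<Longrightarrow> sol s2 K2 \<Longrightarrow> soliton_pair \<alpha> lam c0 s1 K1 s2 K2"
  by unfold_locales

end

context soliton_pair begin

text \<open>By \<open>D_dominated_near_0\<close> there are two cases near \<open>0\<close>. Either
  \<open>D\<close> vanishes on an initial interval, and then \<open>Q\<close> is constant there and
  equal to its limit \<open>0\<close>; or \<open>D\<close> has no zero near \<open>0\<close> and
  keeps one sign, which \<open>Q\<close> inherits on leaving \<open>0\<close>. Either behaviour is
  then propagated to all radii.\<close>

lemma DQ_trichotomy:
  "(\<forall>r>0. 0 < D r \<and> 0 < Q r) \<or> (\<forall>r>0. D r < 0 \<and> Q r < 0) \<or> (\<forall>r>0. D r = 0 \<and> Q r = 0)"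
proof -
  interpret sw: soliton_pair \<alpha> lam c0 s2 K2 s1 K1 by (rule soliton_pairI[OF sol2 sol1])
  have sw: "sw.D r = - D r" "sw.Q r = - Q r" for r
    by (auto simp: D_def sw.D_def Q_def sw.Q_def)
  obtain b where b: "0 < b" "\<And>\<rho> r. 0 < \<rho> \<Longrightarrow> \<rho> \<le> r \<Longrightarrow> r \<le> b \<Longrightarrow> \<bar>D \<rho>\<bar> \<le> 2 * \<bar>D r\<bar>"
    using D_dominated_near_0 by blast
  show ?thesis
  proof (cases "\<exists>r0. 0 < r0 \<and> r0 \<le> b \<and> D r0 = 0")
    case True
    then obtain r0 where r0: "0 < r0" "r0 \<le> b" "D r0 = 0" by blast
    have D0: "D x = 0" if "0 < x" "x \<le> r0" for x using b(2)[OF that r0(2)] r0(3) by simp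
    have Q0: "Q x = 0" if x: "0 < x" "x \<le> r0" for x
    proof -
      have "Q y = Q x" if "0 < y" "y < x" for y
      proof -
        have "\<exists>d. (Q has_real_derivative d) (at u) \<and> 0 \<le> d" "\<exists>d. (Q has_real_derivative d) (at u) \<and> d \<le> 0"
          if "y \<le> u" "u \<le> x" for u
          using DERIV_Q[of u] D0[of u] that x \<open>0 < y\<close> by auto
        thus ?thesis using DERIV_nonneg_imp_nondecreasing[of y x Q] DERIV_nonpos_imp_nonincreasing[of y x Q] that by fastforce
      qed
      hence "\<forall>\<^sub>F y in at_right 0. Q y = Q x" using x by (auto simp: eventually_at_right_field)
      hence "(Q \<longlongrightarrow> Q x) (at_right 0)" by (rule tendsto_eventually)
      thus ?thesis using tendsto_unique[OF _ _ Q_lim] by simp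
    qed
    have "D r = 0 \<and> Q r = 0" if "0 < r" for r
    proof (cases "r \<le> r0")
      case True thus ?thesis using D0 Q0 that by simp
    next
      case False thus ?thesis using DQ_zero_propagate[of r0 r] r0 D0 Q0 by simp
    qed
    thus ?thesis by blast
  next
    case False
    hence nz: "D x \<noteq> 0" if "0 < x" "x \<le> b" for x using that by blast
    have same: "0 < D x \<longleftrightarrow> 0 < D b" if x: "0 < x" "x \<le> b" for x
    proof (rule ccontr)
      assume "\<not> ?thesis"
      hence "(D x \<le> 0 \<and> 0 \<le> D b) \<or> (0 \<le> D x \<and> D b \<le> 0)" by auto
      moreover have "continuous_on {x..b} D" by (rule cont_D) (use x in auto)
      ultimately have "\<exists>y. x \<le> y \<and> y \<le> b \<and> D y = 0" using IVT'[of D x 0 b] IVT2'[of D b 0 x] x by blast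
      thus False using nz x by force
    qed
    show ?thesis
    proof (cases "0 < D b")
      case True
      thus ?thesis using DQ_pos_of_near_0[OF b(1)] same by blast
    next
      case neg: False
      have "0 < sw.D x" if "0 < x" "x \<le> b" for x using same[OF that] nz[OF that] neg sw by simp
      thus ?thesis using sw.DQ_pos_of_near_0[OF b(1)] sw by auto
    qed
  qed
qed

end

text \<open>A strict inequality at one radius, in either component, orders the pair at all radii.
  Indeed \<open>r * r powr \<alpha> * \<kappa> r = Q r + (\<alpha> + 1) * D r\<close>, so each
  alternative excludes that \<open>D\<close> and \<open>Q\<close> are both nonpositive, and the
  trichotomy leaves one case.\<close>

locale soliton_ordered = soliton_pair +
  assumes lt: "\<exists>r>0. s1 r < s2 r \<or> K2 r < K1 r"
begin

lemma D_pos: "0 < r \<Longrightarrow> 0 < D r" and Q_pos: "0 < r \<Longrightarrow> 0 < Q r"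
proof -
  obtain r0 where r0: "0 < r0" "0 < D r0 \<or> 0 < \<kappa> r0" using lt by (auto simp: D_def \<kappa>_def)
  have "r0 * r0 powr \<alpha> * \<kappa> r0 = Q r0 + (\<alpha> + 1) * D r0" by (simp add: Q_kappa)
  moreover have "0 < r0 * r0 powr \<alpha>" using r0 by simp
  moreover have "(\<alpha> + 1) * D r0 \<le> 0" if "D r0 \<le> 0" using that alpha_pos by (simp add: mult_nonneg_nonpos)
  ultimately have "\<not> (D r0 \<le> 0 \<and> Q r0 \<le> 0)"
    using r0 mult_pos_pos[of "r0 * r0 powr \<alpha>" "\<kappa> r0"] by linarith
  hence "\<forall>r>0. 0 < D r \<and> 0 < Q r" using DQ_trichotomy r0(1) by fastforce
  thus "0 < r \<Longrightarrow> 0 < D r" "0 < r \<Longrightarrow> 0 < Q r" by auto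
qed

lemma D_less_kappa: "0 < r \<Longrightarrow> (\<alpha> + 1) * D r < r * r powr \<alpha> * \<kappa> r"
  using Q_pos[of r] by (simp add: Q_kappa)

lemma kappa_pos:
  assumes "0 < r"
  shows "0 < \<kappa> r"
proof -
  have "0 < (\<alpha> + 1) * D r" using D_pos[OF assms] alpha_pos by simp
  with D_less_kappa[OF assms] have "0 < r * r powr \<alpha> * \<kappa> r" by linarith
  thus ?thesis using assms zero_less_mult_pos[of "r * r powr \<alpha>" "\<kappa> r"] by simp
qed

lemma s_less: "0 < r \<Longrightarrow> s1 r < s2 r" and K_less: "0 < r \<Longrightarrow> K2 r < K1 r"
  using D_pos[of r] kappa_pos[of r] by (auto simp: D_def \<kappa>_def)

end

context soliton begin

lemma soliton_orderedI: "sol s1 K1 \<Longrightarrow> sol s2 K2 \<Longrightarrow> 0 < r \<Longrightarrow> s1 r < s2 r \<or> K2 r < K1 r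
    \<Longrightarrow> soliton_ordered \<alpha> lam c0 s1 K1 s2 K2"
  by unfold_locales auto

lemma sol_eqI:
  assumes "sol s1 K1" "sol s2 K2" "\<not> soliton_ordered \<alpha> lam c0 s1 K1 s2 K2" "\<not> soliton_ordered \<alpha> lam c0 s2 K2 s1 K1" "0 < r"
  shows "s1 r = s2 r" "K1 r = K2 r"
proof -
  have "\<not> (s1 r < s2 r \<or> K2 r < K1 r)" "\<not> (s2 r < s1 r \<or> K1 r < K2 r)"
    using soliton_orderedI[OF assms(1,2,5)] soliton_orderedI[OF assms(2,1,5)] assms(3,4) by blast+
  thus "s1 r = s2 r" "K1 r = K2 r" by linarith+
qed

end

section \<open>Existence of solutions\<close>

lemma inverse_diff_bound:
  fixes a b m :: real
  assumes "0 < m" "m \<le> a" "m \<le> b"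
  shows "\<bar>1 / a - 1 / b\<bar> \<le> \<bar>a - b\<bar> / m\<^sup>2"
proof -
  have "1 / a - 1 / b = (b - a) / (a * b)" using assms by (simp add: field_simps)
  hence "\<bar>1 / a - 1 / b\<bar> = \<bar>a - b\<bar> / (a * b)" using assms by (simp add: abs_mult)
  also have "\<dots> \<le> \<bar>a - b\<bar> / m\<^sup>2"
    using assms by (intro divide_left_mono) (auto simp: power2_eq_square intro!: mult_mono mult_pos_pos)
  finally show ?thesis .
qed

context soliton begin

text \<open>Shooting from both ends: \<open>s\<close> is integrated from \<open>0\<close>, where
  \<open>s = sqrt c0\<close>, and \<open>K\<close> from \<open>R\<close>, where
  \<open>K = x\<close>. A Picard iteration for \<open>s\<close> alone remains, because
  \<open>K'\<close> depends on \<open>s\<close> only. The denominators \<open>s\<close> are cut off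
  from below by \<open>m\<close>, which makes the iteration global, and the cutoff turns out to be
  inactive. \<open>R0\<close> depends on \<open>B\<close> but not on \<open>x\<close>, so that all
  values of \<open>K R\<close> up to \<open>B / R\<close> are reached.\<close>

lemma sol_exists:
  assumes "0 \<le> B"
  obtains R0 where "0 < R0" "R0 \<le> 1"
    "\<And>R x. 0 < R \<Longrightarrow> R \<le> R0 \<Longrightarrow> R * \<bar>x\<bar> \<le> B \<Longrightarrow> \<exists>s K. sol s K \<and> K R = x \<and> sqrt c0 / 2 \<le> s R"
proof -
  \<comment> \<open>A lower bound of the cutoff \<open>m\<close> on \<open>(0, R]\<close> that is
    uniform in \<open>R\<close> and \<open>x\<close>.\<close>
  define m0 where "m0 = min (sqrt c0 / 2) (\<nu> / (2 * (B + 1)))"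
  have m0: "0 < m0" using c0_pos nu_pos assms by (simp add: m0_def)
  define e1 where "e1 = (\<beta> + \<alpha> * lam) / 2"
  define e2 where "e2 = (\<nu> + lam) / 2"
  have e: "0 < e1" "0 < e2" using beta_pos nu_pos lam_nonneg alpha_pos
    by (auto simp: e1_def e2_def intro!: add_pos_nonneg)
  define C0 where "C0 = e2 / m0 + B + e1 / m0"
  define C12 where "C12 = (e1 + e2) / m0\<^sup>2"
  have C: "0 < C0" "0 < C12"
  proof -
    have "0 < e2 / m0" "0 < e1 / m0" using e m0 by auto
    thus "0 < C0" using assms by (simp add: C0_def)
    show "0 < C12" using e m0 by (simp add: C12_def)
  qed
  have "\<forall>\<^sub>F r in at_right 0. r powr \<alpha> < min (\<alpha> / (4 * C12)) (\<alpha> * sqrt c0 / (2 * C0))"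
    by (rule order_tendstoD[OF tendsto_powr_alpha]) (use C alpha_pos c0_pos in auto)
  then obtain b where b: "0 < b" "\<And>r. 0 < r \<Longrightarrow> r < b \<Longrightarrow> r powr \<alpha> < min (\<alpha> / (4 * C12)) (\<alpha> * sqrt c0 / (2 * C0))"
    by (auto simp: eventually_at_right_field)
  define R0 where "R0 = min 1 (b / 2)"
  have R0: "0 < R0" "R0 \<le> 1" using b(1) by (auto simp: R0_def)
  \<comment> \<open>The first bound gives the contraction factor \<open>1 / 4\<close> on
    \<open>[0, R]\<close>, the second keeps \<open>s\<close> within \<open>sqrt c0 / 2\<close> of
    its initial value there.\<close>
  have small: "C12 * r powr \<alpha> / \<alpha> \<le> 1 / 4" "C0 * r powr \<alpha> / \<alpha> \<le> sqrt c0 / 2" if "0 < r" "r \<le> R0" for r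
    using b(2)[of r] that b(1) C alpha_pos by (auto simp: R0_def field_simps)
  show ?thesis
  proof (rule that[OF R0])
    fix R x :: real assume R: "0 < R" "R \<le> R0" and x: "R * \<bar>x\<bar> \<le> B"
    have R1: "R \<le> 1" using R R0 by simp
    \<comment> \<open>Beyond \<open>R\<close> one has \<open>K \<le> \<bar>x\<bar> + 1\<close>. The
      second entry is the value of \<open>s\<close> below which the positive part of
      \<open>s'\<close> outweighs such a \<open>K\<close>. On \<open>(0, R]\<close>, where
      \<open>K\<close> may be large, \<open>m\<close> is constant and \<open>s\<close> stays near
      \<open>sqrt c0\<close>.\<close>
    define m where "m = (\<lambda>r. min (sqrt c0 / 2) (\<nu> / (2 * max r R * (\<bar>x\<bar> + 1))))"
    have m_pos: "0 < m r" for r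
      unfolding m_def using c0_pos nu_pos R by (auto intro!: divide_pos_pos mult_pos_pos)
    have m_mono: "m v \<le> m u" if "u \<le> v" for u v
      unfolding m_def using that nu_pos R
      by (intro min.mono order_refl divide_left_mono mult_right_mono mult_left_mono mult_pos_pos) auto
    have m_ge: "m0 \<le> m r" if "r \<le> R" for r
    proof -
      have "R * (\<bar>x\<bar> + 1) \<le> B + 1" using x R1 by (simp add: distrib_left)
      hence "\<nu> / (2 * (B + 1)) \<le> \<nu> / (2 * (R * (\<bar>x\<bar> + 1)))"
        using nu_pos R assms by (intro divide_left_mono mult_left_mono mult_pos_pos) auto
      moreover have "max r R = R" using that by simp
      ultimately show ?thesis unfolding m_def m0_def by (intro min.mono) (auto simp: mult.assoc)
    qed
    have m_cont: "continuous_on S m" for S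
    proof -
      have "2 * max r R * (\<bar>x\<bar> + 1) \<noteq> 0" for r using R by auto
      thus ?thesis unfolding m_def by (intro continuous_intros) auto
    qed
    have m_le: "r * (\<bar>x\<bar> + 1) \<le> \<nu> / (2 * m r)" if "R \<le> r" for r
    proof -
      have "m r \<le> \<nu> / (2 * r * (\<bar>x\<bar> + 1))" using that by (simp add: m_def max_absorb1)
      hence "m r * (2 * r * (\<bar>x\<bar> + 1)) \<le> \<nu>" using that R by (simp add: pos_le_divide_eq)
      thus ?thesis using m_pos[of r] by (simp add: pos_le_divide_eq mult_ac)
    qed
    define M where "M = (\<lambda>g r. max (g r) (m r))"
    have Mm: "m r \<le> M g r" for g r by (simp add: M_def)
    have M_pos: "0 < M g r" for g r using m_pos[of r] Mm[of r g] by linarith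
    have M_cont: "continuous_on S (M g)" if "continuous_on S g" for S g
      unfolding M_def by (intro continuous_on_max that m_cont)
    have invM: "1 / M g r \<le> 1 / m r" for g r using m_pos[of r] Mm[of r g] by (intro divide_left_mono mult_pos_pos M_pos) auto
    have invMd: "\<bar>1 / M g r - 1 / M h r\<bar> \<le> \<bar>g r - h r\<bar> / (m r)\<^sup>2" for g h r
    proof -
      have "\<bar>1 / M g r - 1 / M h r\<bar> \<le> \<bar>M g r - M h r\<bar> / (m r)\<^sup>2" by (rule inverse_diff_bound[OF m_pos Mm Mm])
      also have "\<dots> \<le> \<bar>g r - h r\<bar> / (m r)\<^sup>2" by (intro divide_right_mono) (auto simp: M_def)
      finally show ?thesis .
    qed
    define k1 where "k1 = (\<lambda>r. (\<beta> + \<alpha> * lam * r / 2) / (2 * r\<^sup>2))"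
    define k2 where "k2 = (\<lambda>r. (\<nu> + lam * r) / 2)"
    have k_pos: "0 < k1 r" "0 < k2 r" if "0 < r" for r
      unfolding k1_def k2_def using that beta_pos nu_pos lam_nonneg alpha_pos
      by (auto intro!: divide_pos_pos add_pos_nonneg)
    have k_cont: "continuous_on {0<..} k1" "continuous_on {0<..} k2"
      unfolding k1_def k2_def by (auto intro!: continuous_intros)
    have k_le: "k1 r \<le> e1 / r\<^sup>2" "k2 r \<le> e2" if "0 < r" "r \<le> R" for r
    proof -
      have "lam * r \<le> lam * 1" using that R1 lam_nonneg by (intro mult_left_mono) auto
      thus "k2 r \<le> e2" by (simp add: k2_def e2_def)
      have "\<alpha> * lam * r / 2 \<le> \<alpha> * lam"
        using that R1 lam_nonneg alpha_pos mult_left_mono[of r 2 "\<alpha> * lam"] by simp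
      hence "k1 r \<le> (\<beta> + \<alpha> * lam) / (2 * r\<^sup>2)" unfolding k1_def by (intro divide_right_mono) auto
      thus "k1 r \<le> e1 / r\<^sup>2" by (simp add: e1_def)
    qed
    have "\<forall>g. \<exists>K. continuous_on {0..} g \<longrightarrow> K R = x \<and> (\<forall>r>0. (K has_real_derivative - (k1 r * (1 / M g r))) (at r))"
    proof
      fix g :: "real \<Rightarrow> real"
      show "\<exists>K. continuous_on {0..} g \<longrightarrow> K R = x \<and> (\<forall>r>0. (K has_real_derivative - (k1 r * (1 / M g r))) (at r))"
      proof (cases "continuous_on {0..} g")
        case True
        have "continuous_on {0<..} (M g)" by (rule M_cont) (rule continuous_on_subset[OF True], auto)
        moreover have "\<forall>r\<in>{0<..}. M g r \<noteq> 0" using M_pos[of g] by (metis less_irrefl)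
        ultimately have "continuous_on {0<..} (\<lambda>r. - (k1 r * (1 / M g r)))"
          by (intro continuous_intros k_cont)
        then obtain K where "K R = x" "\<And>r. 0 < r \<Longrightarrow> (K has_real_derivative - (k1 r * (1 / M g r))) (at r)"
          using antiderivative_pos_reals by blast
        thus ?thesis by blast
      qed auto
    qed
    from choice[OF this] obtain Kop where Kop': "\<forall>g. continuous_on {0..} g \<longrightarrow>
        Kop g R = x \<and> (\<forall>r>0. (Kop g has_real_derivative - (k1 r * (1 / M g r))) (at r))" ..
    have Kop: "Kop g R = x" "0 < r \<Longrightarrow> (Kop g has_real_derivative - (k1 r * (1 / M g r))) (at r)"
      if "continuous_on {0..} g" for g r
      using Kop' that by blast+
    have Kcont: "continuous_on S (Kop g)" if "continuous_on {0..} g" "S \<subseteq> {0<..}" for S g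
      by (rule continuous_on_DERIV[OF Kop(2)[OF that(1)]]) (use that(2) in auto)
    have K_near: "r * \<bar>Kop g r\<bar> \<le> B + e1 / m0" if g: "continuous_on {0..} g" and r: "0 < r" "r \<le> R" for g r
    proof -
      have "\<bar>Kop g R - Kop g r\<bar> \<le> - (e1 / m0) / R - - (e1 / m0) / r"
      proof (rule deriv_dominated[where g = "\<lambda>r. - (e1 / m0) / r"])
        show "continuous_on {r..R} (Kop g)" by (rule Kcont[OF g]) (use r in auto)
        show "continuous_on {r..R} (\<lambda>r. - (e1 / m0) / r)" using r by (intro continuous_intros) auto
        fix u assume u: "r < u" "u < R"
        have u0: "0 < u" using u r by simp
        show "(Kop g has_real_derivative - (k1 u * (1 / M g u))) (at u)" by (rule Kop(2)[OF g u0])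
        show "((\<lambda>r. - (e1 / m0) / r) has_real_derivative e1 / u\<^sup>2 * (1 / m0)) (at u)"
          using u0 m0 by (auto intro!: derivative_eq_intros simp: power2_eq_square)
        have "1 / M g u \<le> 1 / m0"
          using m0 m_ge[of u] Mm[of u g] u by (intro divide_left_mono mult_pos_pos M_pos) auto
        hence "k1 u * (1 / M g u) \<le> e1 / u\<^sup>2 * (1 / m0)"
          using k_le[OF u0] k_pos[OF u0] u M_pos[of g u] m0 e by (intro mult_mono) auto
        thus "\<bar>- (k1 u * (1 / M g u))\<bar> \<le> e1 / u\<^sup>2 * (1 / m0)" using k_pos[OF u0] M_pos[of g u] by simp
      qed (use r in auto)
      also have "\<dots> \<le> e1 / m0 / r" using R e m0 by simp
      finally have "\<bar>Kop g r\<bar> \<le> \<bar>x\<bar> + e1 / m0 / r" using Kop(1)[OF g] by linarith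
      hence "r * \<bar>Kop g r\<bar> \<le> r * (\<bar>x\<bar> + e1 / m0 / r)" using r by (intro mult_left_mono) auto
      also have "\<dots> = r * \<bar>x\<bar> + e1 / m0" using r by (simp add: distrib_left)
      also have "r * \<bar>x\<bar> \<le> R * \<bar>x\<bar>"
        using r by (intro mult_right_mono) auto
      finally show ?thesis using x by linarith
    qed
    \<comment> \<open>The right-hand side \<open>r powr \<alpha> * V / (2 * s)\<close> with the
      cutoff, arranged in terms of \<open>r * K\<close>, which stays bounded at
      \<open>0\<close>.\<close>
    define \<phi> where "\<phi> = (\<lambda>g r. r powr \<alpha> / r * (k2 r * (1 / M g r) - r * Kop g r))"
    have phi_near: "\<bar>\<phi> g r\<bar> \<le> C0 * r powr \<alpha> / r" if g: "continuous_on {0..} g" and r: "0 < r" "r \<le> R" for g r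
    proof -
      have "1 / M g r \<le> 1 / m0"
        using m0 m_ge[of r] Mm[of r g] r by (intro divide_left_mono mult_pos_pos M_pos) auto
      hence "k2 r * (1 / M g r) \<le> e2 * (1 / m0)"
        using k_le[OF r] k_pos[OF r(1)] M_pos[of g r] m0 e by (intro mult_mono) auto
      moreover have "0 \<le> k2 r * (1 / M g r)" using k_pos[OF r(1)] M_pos[of g r] by simp
      moreover have "\<bar>r * Kop g r\<bar> \<le> B + e1 / m0" using K_near[OF g r] r by (simp add: abs_mult)
      ultimately have "\<bar>k2 r * (1 / M g r) - r * Kop g r\<bar> \<le> C0" by (simp add: C0_def abs_le_iff)
      hence "r powr \<alpha> / r * \<bar>k2 r * (1 / M g r) - r * Kop g r\<bar> \<le> r powr \<alpha> / r * C0"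
        using r by (intro mult_left_mono) auto
      moreover have "\<bar>\<phi> g r\<bar> = r powr \<alpha> / r * \<bar>k2 r * (1 / M g r) - r * Kop g r\<bar>"
        using r by (simp add: \<phi>_def abs_mult)
      ultimately show ?thesis by (simp add: mult.commute)
    qed
    have "\<forall>g. \<exists>F. continuous_on {0..} g \<longrightarrow> F 0 = sqrt c0 \<and> continuous_on {0..} F \<and> (\<forall>r>0. (F has_real_derivative \<phi> g r) (at r))"
    proof
      fix g :: "real \<Rightarrow> real"
      show "\<exists>F. continuous_on {0..} g \<longrightarrow> F 0 = sqrt c0 \<and> continuous_on {0..} F \<and> (\<forall>r>0. (F has_real_derivative \<phi> g r) (at r))"
      proof (cases "continuous_on {0..} g")
        case True
        have cM: "continuous_on {0<..} (M g)" by (rule M_cont) (rule continuous_on_subset[OF True], auto)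
        have nz: "\<forall>r\<in>{0<..}. M g r \<noteq> 0" using M_pos[of g] by (metis less_irrefl)
        have "continuous_on {0<..} (\<lambda>r. k2 r * (1 / M g r) - r * Kop g r)"
          by (intro continuous_on_diff continuous_on_mult continuous_on_divide continuous_on_const continuous_on_id
                k_cont Kcont[OF True] cM nz) auto
        moreover have "continuous_on {0<..} (\<lambda>r. r powr \<alpha> / r)" by (intro continuous_intros) auto
        ultimately have cont: "continuous_on {0<..} (\<phi> g)" unfolding \<phi>_def by (rule continuous_on_mult[rotated])
        have lim: "((\<lambda>r. C0 * r powr \<alpha> / \<alpha>) \<longlongrightarrow> C0 * 0 / \<alpha>) (at_right 0)"
          by (intro tendsto_intros tendsto_powr_alpha) (use alpha_pos in auto)
        have dg: "((\<lambda>r. C0 * r powr \<alpha> / \<alpha>) has_real_derivative C0 * r powr \<alpha> / r) (at r)" if "0 < r" "r < R" for r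
          using that alpha_pos by (auto intro!: derivative_eq_intros)
        have le: "\<bar>\<phi> g r\<bar> \<le> C0 * r powr \<alpha> / r" if "0 < r" "r < R" for r using phi_near[OF True] that by simp
        obtain F where "F 0 = sqrt c0" "continuous_on {0..} F" "\<And>r. 0 < r \<Longrightarrow> (F has_real_derivative \<phi> g r) (at r)"
          using antiderivative_from_0[OF cont R(1) dg le lim] by blast
        thus ?thesis by blast
      qed auto
    qed
    from choice[OF this] obtain T where T': "\<forall>g. continuous_on {0..} g \<longrightarrow>
        T g 0 = sqrt c0 \<and> continuous_on {0..} (T g) \<and> (\<forall>r>0. (T g has_real_derivative \<phi> g r) (at r))" ..
    have T: "T g 0 = sqrt c0" "continuous_on {0..} (T g)"
        "0 < r \<Longrightarrow> (T g has_real_derivative \<phi> g r) (at r)" if "continuous_on {0..} g" for g r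
      using T' that by simp_all
    have T_near: "\<bar>T g r - sqrt c0\<bar> \<le> sqrt c0 / 2" if g: "continuous_on {0..} g" and r: "0 \<le> r" "r \<le> R" for g r
    proof -
      have "\<bar>T g r - T g 0\<bar> \<le> C0 * r powr \<alpha> / \<alpha> - C0 * 0 powr \<alpha> / \<alpha>"
      proof (rule deriv_dominated[OF r(1), where f' = "\<phi> g" and g = "\<lambda>r. C0 * r powr \<alpha> / \<alpha>"])
        show "continuous_on {0..r} (T g)" by (rule continuous_on_subset[OF T(2)[OF g]]) auto
        show "continuous_on {0..r} (\<lambda>r. C0 * r powr \<alpha> / \<alpha>)" using alpha_pos by (intro continuous_on_powr' continuous_intros) auto
        fix u assume u: "0 < u" "u < r"
        show "(T g has_real_derivative \<phi> g u) (at u)" by (rule T(3)[OF g u(1)])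
        show "((\<lambda>r. C0 * r powr \<alpha> / \<alpha>) has_real_derivative C0 * u powr \<alpha> / u) (at u)"
          using u alpha_pos by (auto intro!: derivative_eq_intros)
        show "\<bar>\<phi> g u\<bar> \<le> C0 * u powr \<alpha> / u" using phi_near[OF g, of u] u r by simp
      qed
      moreover have "C0 * r powr \<alpha> / \<alpha> \<le> sqrt c0 / 2"
      proof (cases "r = 0")
        case True thus ?thesis using c0_pos by simp
      next
        case False thus ?thesis using small(2)[of r] r R by simp
      qed
      moreover have "C0 * 0 powr \<alpha> / \<alpha> = 0" by simp
      ultimately show ?thesis using T(1)[OF g] by linarith
    qed
    \<comment> \<open>The rate of an exponential weight. The first summand controls the difference
      of two \<open>Kop\<close>, the second that of two \<open>T\<close>, where the factor
      \<open>4\<close> becomes the contraction factor \<open>1 / 4\<close>; the last one controls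
      the distance from \<open>g0\<close> to \<open>T g0\<close>.\<close>
    define q where "q = (\<lambda>r. k1 r / (m r)\<^sup>2 + 4 * (r powr \<alpha> / r * (k2 r / (m r)\<^sup>2) + r powr \<alpha>)
                          + (k1 r / m r + r powr \<alpha> / r * (k2 r / m r)))"
    have q_parts: "0 \<le> k1 r / (m r)\<^sup>2" "0 \<le> r powr \<alpha> / r * (k2 r / (m r)\<^sup>2)" "0 \<le> r powr \<alpha>"
        "0 \<le> k1 r / m r" "0 \<le> r powr \<alpha> / r * (k2 r / m r)" if "0 < r" for r
      using that k_pos[OF that] m_pos[of r] by auto
    have q_ge: "k1 r / (m r)\<^sup>2 \<le> q r" "4 * (r powr \<alpha> / r * (k2 r / (m r)\<^sup>2) + r powr \<alpha>) \<le> q r"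
        "k1 r / m r \<le> q r" "r powr \<alpha> / r * (k2 r / m r) + r powr \<alpha> \<le> q r" "r powr \<alpha> \<le> q r" "0 \<le> q r" if "0 < r" for r
    proof -
      have *: "a \<le> a + 4 * (b + c) + (d + e) \<and> 4 * (b + c) \<le> a + 4 * (b + c) + (d + e) \<and> d \<le> a + 4 * (b + c) + (d + e)
          \<and> e + c \<le> a + 4 * (b + c) + (d + e) \<and> c \<le> a + 4 * (b + c) + (d + e) \<and> 0 \<le> a + 4 * (b + c) + (d + e)"
        if "0 \<le> a" "0 \<le> b" "0 \<le> c" "0 \<le> d" "0 \<le> e" for a b c d e :: real using that by auto
      show "k1 r / (m r)\<^sup>2 \<le> q r" "4 * (r powr \<alpha> / r * (k2 r / (m r)\<^sup>2) + r powr \<alpha>) \<le> q r"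
        "k1 r / m r \<le> q r" "r powr \<alpha> / r * (k2 r / m r) + r powr \<alpha> \<le> q r" "r powr \<alpha> \<le> q r" "0 \<le> q r"
        using *[OF q_parts[OF that]] unfolding q_def by blast+
    qed
    have "continuous_on {0<..} q"
    proof -
      have "\<forall>r\<in>{0<..}. m r \<noteq> 0" using m_pos by (metis less_irrefl)
      moreover from this have "\<forall>r\<in>{0<..}. (m r)\<^sup>2 \<noteq> 0" by simp
      moreover have "continuous_on {0<..} (\<lambda>r. r powr \<alpha> / r)" by (intro continuous_intros) auto
      moreover have "continuous_on {0<..} (\<lambda>r. r powr \<alpha>)" by (intro continuous_intros) auto
      ultimately show ?thesis unfolding q_def
        by (intro continuous_on_add continuous_on_mult continuous_on_const k_cont m_cont continuous_on_power
              continuous_on_divide[of _ k1] continuous_on_divide[of _ k2])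
    qed
    then obtain \<Lambda> where \<Lambda>: "\<Lambda> R = 0" "\<And>r. 0 < r \<Longrightarrow> (\<Lambda> has_real_derivative q r) (at r)"
      using antiderivative_pos_reals by blast
    \<comment> \<open>\<open>q\<close> grows like \<open>1 / r\<^sup>2\<close> at \<open>0\<close>,
      so the weight cannot start there. It is kept equal to \<open>1\<close> on
      \<open>[0, R]\<close>, where the smallness of \<open>R\<close> takes its place.\<close>
    define W where "W = (\<lambda>r. exp (\<Lambda> (max r R)))"
    have W_near: "W r = 1" if "r \<le> R" for r using that \<Lambda>(1) by (simp add: W_def)
    have W_cont: "continuous_on S W" for S
    proof -
      have "continuous_on {0<..} \<Lambda>" by (rule continuous_on_DERIV[OF \<Lambda>(2)]) auto
      moreover have "continuous_on S (\<lambda>r. max r R)" by (intro continuous_on_max continuous_on_id continuous_on_const)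
      ultimately have "continuous_on S (\<lambda>r. \<Lambda> (max r R))"
        by (rule continuous_on_compose2) (use R in auto)
      thus ?thesis unfolding W_def by (rule continuous_on_exp)
    qed
    have W_pos: "0 < W r" for r by (simp add: W_def)
    have W_der: "(W has_real_derivative q r * W r) (at r)" if "R < r" for r
    proof -
      have "((\<lambda>r. exp (\<Lambda> r)) has_real_derivative q r * exp (\<Lambda> r)) (at r)"
        using that R by (auto intro!: derivative_eq_intros \<Lambda>(2))
      hence "((\<lambda>r. exp (\<Lambda> r)) has_real_derivative q r * W r) (at r)"
        using that by (simp add: W_def max_absorb1)
      thus ?thesis
        by (rule has_field_derivative_transform_within_open[of _ _ _ "{R<..}"])
           (use that in \<open>auto simp: W_def max_absorb1\<close>)
    qed
    have W_ge1: "1 \<le> W r" for r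
    proof (cases "r \<le> R")
      case False
      have "\<exists>y. (\<Lambda> has_real_derivative y) (at u) \<and> 0 \<le> y" if "R \<le> u" for u
        using \<Lambda>(2)[of u] q_ge(6)[of u] that R by auto
      hence "\<Lambda> R \<le> \<Lambda> r" using False by (intro DERIV_nonneg_imp_nondecreasing[of R r \<Lambda>]) auto
      thus ?thesis using False \<Lambda>(1) by (simp add: W_def max_absorb1)
    qed (simp add: W_near)
    have contr: "\<bar>T g r - T h r\<bar> \<le> d / 2 * W r"
      if gh: "continuous_on {0..} g" "continuous_on {0..} h" and d: "0 \<le> d"
        and le: "\<And>r. r \<in> {0..} \<Longrightarrow> \<bar>g r - h r\<bar> \<le> d * W r" and r: "r \<in> {0..}" for g h d r
    proof -
      have Kd: "((\<lambda>r. Kop g r - Kop h r) has_real_derivative - (k1 r * (1 / M g r - 1 / M h r))) (at r)" if "0 < r" for r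
        by (rule DERIV_cong[OF DERIV_diff[OF Kop(2)[OF gh(1) that] Kop(2)[OF gh(2) that]]]) (simp add: algebra_simps)
      have Td: "((\<lambda>r. T g r - T h r) has_real_derivative
          r powr \<alpha> / r * (k2 r * (1 / M g r - 1 / M h r) - r * (Kop g r - Kop h r))) (at r)" if "0 < r" for r
        by (rule DERIV_cong[OF DERIV_diff[OF T(3)[OF gh(1) that] T(3)[OF gh(2) that]]]) (simp add: \<phi>_def algebra_simps)
      have Kc: "continuous_on S (\<lambda>r. Kop g r - Kop h r)" if "S \<subseteq> {0<..}" for S
        using Kcont[OF gh(1) that] Kcont[OF gh(2) that] by (intro continuous_intros)
      have Tc: "continuous_on S (\<lambda>r. T g r - T h r)" if "S \<subseteq> {0..}" for S
        using T(2)[OF gh(1)] T(2)[OF gh(2)] that by (intro continuous_intros) (auto intro: continuous_on_subset)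
      have Tbound: "\<bar>r powr \<alpha> / r * (k2 r * (1 / M g r - 1 / M h r) - r * (Kop g r - Kop h r))\<bar>
          \<le> r powr \<alpha> / r * (k2 r * a + r * c)"
        if "0 < r" "\<bar>1 / M g r - 1 / M h r\<bar> \<le> a" "\<bar>Kop g r - Kop h r\<bar> \<le> c" for r a c
      proof -
        have "\<bar>k2 r * (1 / M g r - 1 / M h r)\<bar> \<le> k2 r * a"
          using that k_pos[OF that(1)] by (simp add: abs_mult)
        moreover have "\<bar>r * (Kop g r - Kop h r)\<bar> \<le> r * c" using that by (simp add: abs_mult)
        ultimately have "\<bar>k2 r * (1 / M g r - 1 / M h r) - r * (Kop g r - Kop h r)\<bar> \<le> k2 r * a + r * c" by linarith
        thus ?thesis unfolding abs_mult using that by (intro mult_mono) auto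
      qed
      have Mnear: "\<bar>1 / M g u - 1 / M h u\<bar> \<le> d / m0\<^sup>2" if "0 < u" "u \<le> R" for u
      proof -
        have "\<bar>1 / M g u - 1 / M h u\<bar> \<le> \<bar>g u - h u\<bar> / (m u)\<^sup>2" by (rule invMd)
        also have "\<dots> \<le> d / m0\<^sup>2"
          using le[of u] W_near[of u] that m0 m_ge[of u] d by (intro frac_le power_mono) auto
        finally show ?thesis .
      qed
      have Knear: "\<bar>Kop g u - Kop h u\<bar> \<le> e1 * d / m0\<^sup>2 / u" if u: "0 < u" "u \<le> R" for u
      proof -
        have "\<bar>(Kop g R - Kop h R) - (Kop g u - Kop h u)\<bar> \<le> - (e1 * d / m0\<^sup>2) / R - - (e1 * d / m0\<^sup>2) / u"
        proof (rule deriv_dominated[OF u(2), where f = "\<lambda>r. Kop g r - Kop h r" and g = "\<lambda>r. - (e1 * d / m0\<^sup>2) / r"])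
          show "continuous_on {u..R} (\<lambda>r. Kop g r - Kop h r)" by (rule Kc) (use u in auto)
          show "continuous_on {u..R} (\<lambda>r. - (e1 * d / m0\<^sup>2) / r)" using u by (intro continuous_intros) auto
          fix v assume v: "u < v" "v < R"
          have v0: "0 < v" using v u by simp
          show "((\<lambda>r. Kop g r - Kop h r) has_real_derivative - (k1 v * (1 / M g v - 1 / M h v))) (at v)" by (rule Kd[OF v0])
          show "((\<lambda>r. - (e1 * d / m0\<^sup>2) / r) has_real_derivative e1 / v\<^sup>2 * (d / m0\<^sup>2)) (at v)"
            using v0 m0 by (auto intro!: derivative_eq_intros simp: power2_eq_square)
          have "k1 v * \<bar>1 / M g v - 1 / M h v\<bar> \<le> e1 / v\<^sup>2 * (d / m0\<^sup>2)"
            using k_le[OF v0] k_pos[OF v0] v Mnear[OF v0] e by (intro mult_mono) auto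
          thus "\<bar>- (k1 v * (1 / M g v - 1 / M h v))\<bar> \<le> e1 / v\<^sup>2 * (d / m0\<^sup>2)" using k_pos[OF v0] by (simp add: abs_mult)
        qed
        moreover have "0 \<le> e1 * d / m0\<^sup>2 / R" using R e m0 d by simp
        ultimately show ?thesis using Kop(1)[OF gh(1)] Kop(1)[OF gh(2)] by simp
      qed
      have near: "\<bar>T g u - T h u\<bar> \<le> d / 4" if u: "0 \<le> u" "u \<le> R" for u
      proof -
        have "\<bar>(T g u - T h u) - (T g 0 - T h 0)\<bar> \<le> C12 * d * u powr \<alpha> / \<alpha> - C12 * d * 0 powr \<alpha> / \<alpha>"
        proof (rule deriv_dominated[OF u(1), where f = "\<lambda>r. T g r - T h r" and g = "\<lambda>r. C12 * d * r powr \<alpha> / \<alpha>"])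
          show "continuous_on {0..u} (\<lambda>r. T g r - T h r)" by (rule Tc) auto
          show "continuous_on {0..u} (\<lambda>r. C12 * d * r powr \<alpha> / \<alpha>)" using alpha_pos by (intro continuous_on_powr' continuous_intros) auto
          fix v assume v: "0 < v" "v < u"
          show "((\<lambda>r. T g r - T h r) has_real_derivative
             v powr \<alpha> / v * (k2 v * (1 / M g v - 1 / M h v) - v * (Kop g v - Kop h v))) (at v)" by (rule Td[OF v(1)])
          show "((\<lambda>r. C12 * d * r powr \<alpha> / \<alpha>) has_real_derivative v powr \<alpha> / v * (C12 * d)) (at v)"
            using v alpha_pos by (auto intro!: derivative_eq_intros)
          have vR: "v \<le> R" using v u by simp
          have "\<bar>v powr \<alpha> / v * (k2 v * (1 / M g v - 1 / M h v) - v * (Kop g v - Kop h v))\<bar>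
             \<le> v powr \<alpha> / v * (k2 v * (d / m0\<^sup>2) + v * (e1 * d / m0\<^sup>2 / v))"
            by (rule Tbound[OF v(1) Mnear[OF v(1) vR] Knear[OF v(1) vR]])
          also have "\<dots> \<le> v powr \<alpha> / v * (C12 * d)"
          proof (intro mult_left_mono)
            have "k2 v * (d / m0\<^sup>2) \<le> e2 * (d / m0\<^sup>2)" using k_le[OF v(1) vR] d by (intro mult_right_mono) auto
            thus "k2 v * (d / m0\<^sup>2) + v * (e1 * d / m0\<^sup>2 / v) \<le> C12 * d"
              using v by (simp add: C12_def add_divide_distrib algebra_simps)
          qed (use v in auto)
          finally show "\<bar>v powr \<alpha> / v * (k2 v * (1 / M g v - 1 / M h v) - v * (Kop g v - Kop h v))\<bar> \<le> v powr \<alpha> / v * (C12 * d)" .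
        qed
        moreover have "C12 * u powr \<alpha> / \<alpha> \<le> 1 / 4"
        proof (cases "u = 0")
          case False thus ?thesis using small(1)[of u] u R by simp
        qed simp
        hence "C12 * u powr \<alpha> / \<alpha> * d \<le> 1 / 4 * d" using d by (rule mult_right_mono)
        moreover have "C12 * d * u powr \<alpha> / \<alpha> = C12 * u powr \<alpha> / \<alpha> * d" "C12 * d * 0 powr \<alpha> / \<alpha> = 0" by simp_all
        ultimately show ?thesis using T(1)[OF gh(1)] T(1)[OF gh(2)] by linarith
      qed
      show ?thesis
      proof (cases "r \<le> R")
        case True
        thus ?thesis using near[of r] r d W_near[of r] by simp
      next
        case False
        hence r': "R \<le> r" by simp
        have dW: "((\<lambda>r. d * W r) has_real_derivative q u * (d * W u)) (at u)" if "R < u" for u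
          using DERIV_cmult[OF W_der[OF that], of d] by (simp add: mult_ac)
        have Mfar: "\<bar>1 / M g u - 1 / M h u\<bar> \<le> d * W u / (m u)\<^sup>2" if "R < u" for u
        proof -
          have "\<bar>1 / M g u - 1 / M h u\<bar> \<le> \<bar>g u - h u\<bar> / (m u)\<^sup>2" by (rule invMd)
          also have "\<dots> \<le> d * W u / (m u)\<^sup>2" using le[of u] that R by (intro divide_right_mono) auto
          finally show ?thesis .
        qed
        have Kfar: "\<bar>Kop g u - Kop h u\<bar> \<le> d * W u" if u: "R < u" for u
        proof -
          have "\<bar>(Kop g u - Kop h u) - (Kop g R - Kop h R)\<bar> \<le> d * W u - d * W R"
          proof (rule deriv_dominated[where f = "\<lambda>r. Kop g r - Kop h r" and g = "\<lambda>r. d * W r"])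
            show "continuous_on {R..u} (\<lambda>r. Kop g r - Kop h r)" by (rule Kc) (use R in auto)
            show "continuous_on {R..u} (\<lambda>r. d * W r)" by (intro continuous_intros W_cont)
            fix v assume v: "R < v" "v < u"
            have v0: "0 < v" using v R by simp
            show "((\<lambda>r. Kop g r - Kop h r) has_real_derivative - (k1 v * (1 / M g v - 1 / M h v))) (at v)" by (rule Kd[OF v0])
            show "((\<lambda>r. d * W r) has_real_derivative q v * (d * W v)) (at v)" by (rule dW[OF v(1)])
            have "k1 v * \<bar>1 / M g v - 1 / M h v\<bar> \<le> k1 v * (d * W v / (m v)\<^sup>2)"
              using k_pos[OF v0] Mfar[OF v(1)] by (intro mult_left_mono) auto
            also have "\<dots> = k1 v / (m v)\<^sup>2 * (d * W v)" by simp
            also have "\<dots> \<le> q v * (d * W v)" using q_ge(1)[OF v0] d W_pos[of v] by (intro mult_right_mono) auto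
            finally show "\<bar>- (k1 v * (1 / M g v - 1 / M h v))\<bar> \<le> q v * (d * W v)" using k_pos[OF v0] by (simp add: abs_mult)
          qed (use u in auto)
          moreover have "0 \<le> d * W R" using d W_pos[of R] by simp
          ultimately show ?thesis using Kop(1)[OF gh(1)] Kop(1)[OF gh(2)] by simp
        qed
        have "\<bar>(T g r - T h r) - (T g R - T h R)\<bar> \<le> d / 4 * W r - d / 4 * W R"
        proof (rule deriv_dominated[OF r', where f = "\<lambda>r. T g r - T h r" and g = "\<lambda>r. d / 4 * W r"])
          show "continuous_on {R..r} (\<lambda>r. T g r - T h r)" by (rule Tc) (use R in auto)
          show "continuous_on {R..r} (\<lambda>r. d / 4 * W r)" by (intro continuous_intros W_cont)
          fix v assume v: "R < v" "v < r"
          have v0: "0 < v" using v R by simp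
          show "((\<lambda>r. T g r - T h r) has_real_derivative
             v powr \<alpha> / v * (k2 v * (1 / M g v - 1 / M h v) - v * (Kop g v - Kop h v))) (at v)" by (rule Td[OF v0])
          show "((\<lambda>r. d / 4 * W r) has_real_derivative q v / 4 * (d * W v)) (at v)"
            using DERIV_cmult[OF W_der[OF v(1)], of "d / 4"] by (simp add: mult_ac)
          have "\<bar>v powr \<alpha> / v * (k2 v * (1 / M g v - 1 / M h v) - v * (Kop g v - Kop h v))\<bar>
             \<le> v powr \<alpha> / v * (k2 v * (d * W v / (m v)\<^sup>2) + v * (d * W v))"
            by (rule Tbound[OF v0 Mfar[OF v(1)] Kfar[OF v(1)]])
          also have "\<dots> = (v powr \<alpha> / v * (k2 v / (m v)\<^sup>2) + v powr \<alpha>) * (d * W v)"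
            using v0 by (simp add: algebra_simps)
          also have "\<dots> \<le> q v / 4 * (d * W v)"
          proof (rule mult_right_mono)
            show "v powr \<alpha> / v * (k2 v / (m v)\<^sup>2) + v powr \<alpha> \<le> q v / 4" 
            proof -
              have "a \<le> b / 4" if "4 * a \<le> b" for a b :: real using that by simp
              from this[OF q_ge(2)[OF v0]] show ?thesis .
            qed
            show "0 \<le> d * W v" using d W_pos[of v] by simp
          qed
          finally show "\<bar>v powr \<alpha> / v * (k2 v * (1 / M g v - 1 / M h v) - v * (Kop g v - Kop h v))\<bar> \<le> q v / 4 * (d * W v)" .
        qed
        moreover have "\<bar>T g R - T h R\<bar> \<le> d / 4" using near[of R] R by simp
        moreover have "0 \<le> d * W r" using d W_pos[of r] by simp
        moreover have "d / 4 * W R = d / 4" using W_near[of R] by simp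
        moreover have "d / 4 * W r = d * W r / 4" "d / 2 * W r = d * W r / 2" by simp_all
        ultimately show ?thesis by linarith
      qed
    qed
    define g0 :: "real \<Rightarrow> real" where "g0 = (\<lambda>_. sqrt c0)"
    have g0: "continuous_on {0..} g0" by (simp add: g0_def)
    have init: "\<bar>T g0 r - g0 r\<bar> \<le> (sqrt c0 / 2 + \<bar>x\<bar> + 2) * W r" if r: "r \<in> {0..}" for r
    proof (cases "r \<le> R")
      case True
      have "\<bar>T g0 r - g0 r\<bar> \<le> sqrt c0 / 2 + \<bar>x\<bar> + 2"
        using T_near[OF g0, of r] r True abs_ge_zero[of x] unfolding g0_def atLeast_iff by linarith
      thus ?thesis using W_near[OF True] by simp
    next
      case False
      hence r': "R \<le> r" by simp
      have Kfar: "\<bar>Kop g0 u\<bar> \<le> \<bar>x\<bar> + W u" if u: "R < u" for u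
      proof -
        have "\<bar>Kop g0 u - Kop g0 R\<bar> \<le> W u - W R"
        proof (rule deriv_dominated[where f = "Kop g0" and g = W])
          show "continuous_on {R..u} (Kop g0)" by (rule Kcont[OF g0]) (use R in auto)
          fix v assume v: "R < v" "v < u"
          have v0: "0 < v" using v R by simp
          show "(Kop g0 has_real_derivative - (k1 v * (1 / M g0 v))) (at v)" by (rule Kop(2)[OF g0 v0])
          show "(W has_real_derivative q v * W v) (at v)" by (rule W_der[OF v(1)])
          have "k1 v * (1 / M g0 v) \<le> k1 v * (1 / m v)" using invM k_pos[OF v0] by (intro mult_left_mono) auto
          also have "\<dots> \<le> q v * 1" using q_ge(3)[OF v0] by simp
          also have "\<dots> \<le> q v * W v" using q_ge(6)[OF v0] W_ge1 by (intro mult_left_mono)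
          finally show "\<bar>- (k1 v * (1 / M g0 v))\<bar> \<le> q v * W v" using k_pos[OF v0] M_pos[of g0 v] by simp
        qed (use u W_cont in auto)
        thus ?thesis using Kop(1)[OF g0] W_near[of R] by simp
      qed
      have "\<bar>T g0 r - T g0 R\<bar> \<le> (\<bar>x\<bar> + 2) * W r - (\<bar>x\<bar> + 2) * W R"
      proof (rule deriv_dominated[OF r', where f = "T g0" and g = "\<lambda>r. (\<bar>x\<bar> + 2) * W r"])
        show "continuous_on {R..r} (T g0)" by (rule continuous_on_subset[OF T(2)[OF g0]]) (use R in auto)
        show "continuous_on {R..r} (\<lambda>r. (\<bar>x\<bar> + 2) * W r)" by (intro continuous_intros W_cont)
        fix v assume v: "R < v" "v < r"
        have v0: "0 < v" using v R by simp
        show "(T g0 has_real_derivative \<phi> g0 v) (at v)" by (rule T(3)[OF g0 v0])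
        show "((\<lambda>r. (\<bar>x\<bar> + 2) * W r) has_real_derivative (\<bar>x\<bar> + 2) * (q v * W v)) (at v)"
          using DERIV_cmult[OF W_der[OF v(1)]] .
        have W1: "1 \<le> W v" by (rule W_ge1)
        have "k2 v * (1 / M g0 v) \<le> k2 v * (1 / m v)" using invM k_pos[OF v0] by (intro mult_left_mono) auto
        hence "\<bar>k2 v * (1 / M g0 v)\<bar> \<le> k2 v / m v" using k_pos[OF v0] M_pos[of g0 v] by simp
        moreover have "\<bar>v * Kop g0 v\<bar> \<le> v * (\<bar>x\<bar> + W v)" using Kfar[OF v(1)] v0 by (simp add: abs_mult)
        ultimately have "\<bar>k2 v * (1 / M g0 v) - v * Kop g0 v\<bar> \<le> k2 v / m v + v * (\<bar>x\<bar> + W v)" by linarith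
        hence "\<bar>\<phi> g0 v\<bar> \<le> v powr \<alpha> / v * (k2 v / m v + v * (\<bar>x\<bar> + W v))"
          unfolding \<phi>_def abs_mult using v0 by (intro mult_mono) auto
        also have "\<dots> = v powr \<alpha> / v * (k2 v / m v) + v powr \<alpha> + v powr \<alpha> * (\<bar>x\<bar> + W v - 1)"
          using v0 by (simp add: algebra_simps)
        also have "\<dots> \<le> q v + q v * (\<bar>x\<bar> + W v - 1)"
          using q_ge(4)[OF v0] q_ge(5)[OF v0] W1 by (intro add_mono mult_right_mono) auto
        also have "\<dots> = q v * (\<bar>x\<bar> + W v)" by (simp add: algebra_simps)
        also have "\<dots> \<le> q v * ((\<bar>x\<bar> + 2) * W v)"
        proof (intro mult_left_mono q_ge(6)[OF v0])
          have "\<bar>x\<bar> * 1 \<le> \<bar>x\<bar> * W v" using W1 by (intro mult_left_mono) auto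
          thus "\<bar>x\<bar> + W v \<le> (\<bar>x\<bar> + 2) * W v" using W1 by (simp add: distrib_right)
        qed
        finally show "\<bar>\<phi> g0 v\<bar> \<le> (\<bar>x\<bar> + 2) * (q v * W v)" by (simp add: mult_ac)
      qed
      moreover have "\<bar>T g0 R - sqrt c0\<bar> \<le> sqrt c0 / 2" using T_near[OF g0, of R] R by simp
      moreover have "sqrt c0 / 2 * 1 \<le> sqrt c0 / 2 * W r" using W_ge1 c0_pos by (intro mult_left_mono) auto
      moreover have "(\<bar>x\<bar> + 2) * W R = \<bar>x\<bar> + 2" using W_near[of R] by simp
      moreover have "(sqrt c0 / 2 + \<bar>x\<bar> + 2) * W r = sqrt c0 / 2 * W r + (\<bar>x\<bar> + 2) * W r"
        by (simp add: distrib_right)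
      ultimately show ?thesis unfolding g0_def by linarith
    qed
    obtain s where s: "continuous_on {0..} s" "\<And>r. r \<in> {0..} \<Longrightarrow> T s r = s r"
      by (rule contraction_fixpoint[of "{0..}" W T g0 "sqrt c0 / 2 + \<bar>x\<bar> + 2"])
         (use W_pos W_cont T(2) contr g0 init c0_pos in auto)
    define K where "K = Kop s"
    have ds: "(s has_real_derivative \<phi> s r) (at r)" if "0 < r" for r
      by (rule has_field_derivative_transform_within_open[OF T(3)[OF s(1) that], of "{0<..}"]) (use that s(2) in auto)
    have s_near: "sqrt c0 / 2 \<le> s r" if "0 \<le> r" "r \<le> R" for r
      using T_near[OF s(1) that] s(2)[of r] that unfolding atLeast_iff abs_le_iff by linarith
    \<comment> \<open>If \<open>s u\<close> falls below \<open>m r\<close>, it is below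
      \<open>m u\<close>, so the cutoff is active at \<open>u\<close> and
      \<open>K u \<le> \<bar>x\<bar> + 1\<close> gives \<open>s' \<ge> 0\<close>. Hence
      \<open>s\<close> cannot cross the barrier, and the fixed point solves the original
      system.\<close>
    have s_m: "m r \<le> s r" if r: "0 < r" for r
    proof (cases "r \<le> R")
      case True
      have "m r \<le> sqrt c0 / 2" unfolding m_def by (rule min.cobounded1)
      thus ?thesis using s_near[of r] True r by simp
    next
      case False
      have "m r - s r \<le> 0"
      proof (rule barrier_nonpos[where z = "\<lambda>u. m r - s u" and a = R and \<eta> = 1 and z' = "\<lambda>u. - \<phi> s u"])
        show "continuous_on {R..r} (\<lambda>u. m r - s u)"
          by (intro continuous_intros continuous_on_subset[OF s(1)]) (use R in auto)
        have "m r \<le> sqrt c0 / 2" unfolding m_def by (rule min.cobounded1)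
        thus "m r - s R \<le> 0" using s_near[of R] R by simp
        fix u assume u: "R < u" "u < r"
        have u0: "0 < u" using u R by simp
        show "((\<lambda>u. m r - s u) has_real_derivative - \<phi> s u) (at u)"
          using DERIV_diff[OF DERIV_const ds[OF u0], of "m r"] by simp
        assume "0 < m r - s u"
        hence "s u < m u" using m_mono[of u r] u by simp
        hence Mu: "M s u = m u" by (simp add: M_def)
        have "K u \<le> K R"
        proof (rule DERIV_nonpos_imp_nonincreasing[of R u K])
          show "R \<le> u" using u by simp
          fix v assume "R \<le> v" "v \<le> u"
          hence v0: "0 < v" using R by simp
          show "\<exists>y. (K has_real_derivative y) (at v) \<and> y \<le> 0"
            unfolding K_def using Kop(2)[OF s(1) v0] k_pos[OF v0] M_pos[of s v] by (intro exI[of _ "- (k1 v * (1 / M s v))"]) auto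
        qed
        hence "K u \<le> \<bar>x\<bar> + 1" using Kop(1)[OF s(1)] by (simp add: K_def)
        hence "u * K u \<le> u * (\<bar>x\<bar> + 1)" using u0 by (intro mult_left_mono) auto
        also have "\<dots> \<le> \<nu> / (2 * m u)" by (rule m_le) (use u in simp)
        also have "\<dots> \<le> k2 u * (1 / M s u)"
        proof -
          have "\<nu> / 2 * (1 / m u) \<le> k2 u * (1 / m u)" 
            unfolding k2_def using u0 lam_nonneg m_pos[of u] by (intro mult_right_mono) auto
          thus ?thesis by (simp add: Mu)
        qed
        finally have "0 \<le> \<phi> s u" unfolding \<phi>_def K_def using u0 by (intro mult_nonneg_nonneg) auto
        thus "- \<phi> s u \<le> 0" by simp
      qed (use False in auto)
      thus ?thesis by simp
    qed
    have Ms: "M s r = s r" if "0 < r" for r using s_m[OF that] by (simp add: M_def)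
    have s_pos: "0 < s r" if "0 < r" for r using s_m[OF that] m_pos[of r] by linarith
    have "sol s K"
      unfolding sol_def
    proof (intro conjI allI impI)
      fix r :: real assume r: "0 < r"
      show "0 < s r" by (rule s_pos[OF r])
      have "\<phi> s r = r powr \<alpha> * V s K r / (2 * s r)"
        using r s_pos[OF r] by (simp add: \<phi>_def Ms[OF r] V_def K_def k2_def field_simps)
      thus "(s has_real_derivative r powr \<alpha> * V s K r / (2 * s r)) (at r)" using ds[OF r] by simp
      show "(K has_real_derivative - (\<beta> + \<alpha> * lam * r / 2) / (2 * r\<^sup>2 * s r)) (at r)"
        using Kop(2)[OF s(1) r] unfolding K_def Ms[OF r] k1_def
        by (simp only: times_divide_eq_right mult_1_right divide_divide_eq_left minus_divide_left)
    next
      have "at (0::real) within {0..} = at_right 0" by (rule at_within_Ici_at_right)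
      moreover have "s 0 = sqrt c0" using T(1)[OF s(1)] s(2)[of 0] by simp
      ultimately show "(s \<longlongrightarrow> sqrt c0) (at_right 0)"
        using s(1) unfolding continuous_on_def by (metis atLeast_iff order_refl)
    qed
    moreover have "K R = x" using Kop(1)[OF s(1)] by (simp add: K_def)
    ultimately show "\<exists>s K. sol s K \<and> K R = x \<and> sqrt c0 / 2 \<le> s R" using s_near[of R] R by force
  qed
qed

end

section \<open>The family of solutions\<close>

context soliton begin

lemma N_mono:
  assumes "sol s K" "0 < u" "u \<le> r"
  shows "N s K u \<le> N s K r"
proof (rule DERIV_nonneg_imp_nondecreasing[OF assms(3)])
  fix x assume "u \<le> x" "x \<le> r"
  hence x: "0 < x" using assms by simp
  have "0 \<le> x powr \<alpha> * (\<beta> + (\<alpha> / 2 + 1) * lam * x) / (2 * x * s x)"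
    using x sol_pos[OF assms(1) x] beta_pos alpha_pos lam_nonneg
    by (intro divide_nonneg_nonneg mult_nonneg_nonneg add_nonneg_nonneg) auto
  thus "\<exists>y. (N s K has_real_derivative y) (at x) \<and> 0 \<le> y" using DERIV_N[OF assms(1) x] by blast
qed

lemma N_ge:
  assumes "sol s K" "0 < r"
  shows "(\<alpha> + 1) * sqrt c0 \<le> N s K r"
proof (rule tendsto_upperbound[OF N_lim[OF assms(1)]])
  show "\<forall>\<^sub>F u in at_right 0. N s K u \<le> N s K r"
    unfolding eventually_at_right_field using assms N_mono by (intro exI[of _ r]) auto
qed simp

lemma sol_lower_bound:
  assumes "sol s K"
  obtains m where "0 < m" "\<And>u. 0 < u \<Longrightarrow> u \<le> r \<Longrightarrow> m \<le> s u"
proof -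
  obtain b where b: "0 < b" "\<And>r. 0 < r \<Longrightarrow> r \<le> b \<Longrightarrow> sqrt c0 / 2 < s r"
    using eventually_s_bounds[OF assms] by metis
  have "continuous_on {b..max b r} s" by (rule sol_cont(1)[OF assms]) (use b in auto)
  then obtain v where v: "v \<in> {b..max b r}" "\<And>u. u \<in> {b..max b r} \<Longrightarrow> s v \<le> s u"
    using continuous_attains_inf[of "{b..max b r}" s] by auto
  show ?thesis
  proof (rule that[of "min (sqrt c0 / 2) (s v)"])
    show "0 < min (sqrt c0 / 2) (s v)" using c0_pos v b sol_pos[OF assms, of v] by simp
    fix u :: real assume u: "0 < u" "u \<le> r"
    show "min (sqrt c0 / 2) (s v) \<le> s u"
    proof (cases "u \<le> b")
      case True thus ?thesis using b(2)[of u] u by (intro min.coboundedI1) simp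
    next
      case False thus ?thesis using v(2)[of u] u by (intro min.coboundedI2) simp
    qed
  qed
qed

text \<open>Since the limit of \<open>r * K r\<close> is universal, one \<open>B\<close> suffices
  for all solutions: each of them belongs to the family \<open>R * \<bar>x\<bar> \<le> B\<close>
  once \<open>R\<close> is small enough for it.\<close>

lemma rK_bound:
  assumes "sol s K"
  obtains b where "0 < b" "\<And>r. 0 < r \<Longrightarrow> r < b \<Longrightarrow> r * \<bar>K r\<bar> \<le> \<beta> / (2 * sqrt c0) + 1"
proof -
  have pos: "0 < \<beta> / (2 * sqrt c0)" using beta_pos c0_pos by simp
  have "\<forall>\<^sub>F r in at_right 0. r * K r < \<beta> / (2 * sqrt c0) + 1" "\<forall>\<^sub>F r in at_right 0. 0 < r * K r"
    using pos by (intro order_tendstoD[OF rK_lim[OF assms]]; simp)+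
  hence "\<forall>\<^sub>F r in at_right 0. r * K r < \<beta> / (2 * sqrt c0) + 1 \<and> 0 < r * K r" by (rule eventually_conj)
  then obtain b where b: "0 < b" "\<And>r. 0 < r \<Longrightarrow> r < b \<Longrightarrow> r * K r < \<beta> / (2 * sqrt c0) + 1 \<and> 0 < r * K r"
    unfolding eventually_at_right_field by blast
  show ?thesis
  proof (rule that[OF b(1)])
    fix r :: real assume r: "0 < r" "r < b"
    have "r * \<bar>K r\<bar> = \<bar>r * K r\<bar>" using r by (simp add: abs_mult)
    thus "r * \<bar>K r\<bar> \<le> \<beta> / (2 * sqrt c0) + 1" using b(2)[OF r] by linarith
  qed
qed

end

section \<open>Solutions with an arbitrarily large deviation at a given radius\<close>

context soliton_ordered begin

text \<open>\<open>\<kappa>\<close> decreases at a rate proportional to \<open>D\<close>, and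
  \<open>D\<close> is below \<open>r * r powr \<alpha> * \<kappa> / (\<alpha> + 1)\<close>. The
  resulting relative rate of decrease is at most the derivative of
  \<open>N s1 K1 / ((\<alpha> + 1) * m)\<close>, so \<open>N\<close> of the smaller solution serves
  as the exponent of an integrating factor.\<close>

lemma kappa_le:
  assumes R: "0 < R" "R \<le> r" and m: "0 < m" "\<And>u. R \<le> u \<Longrightarrow> u \<le> r \<Longrightarrow> m \<le> s2 u"
  shows "\<kappa> R \<le> \<kappa> r * exp (N s1 K1 r / ((\<alpha> + 1) * m))"
proof -
  define n where "n = (\<lambda>u. N s1 K1 u / ((\<alpha> + 1) * m))"
  have "\<kappa> R * exp (n R) \<le> \<kappa> r * exp (n r)"
  proof (rule DERIV_nonneg_imp_nondecreasing[OF R(2), of "\<lambda>u. \<kappa> u * exp (n u)"])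
    fix u assume u: "R \<le> u" "u \<le> r"
    have u0: "0 < u" using u R by simp
    have s: "0 < s1 u" "0 < s2 u" using sol_pos sol1 sol2 u0 by auto
    define e where "e = \<beta> + \<alpha> * lam * u / 2"
    define e' where "e' = \<beta> + (\<alpha> / 2 + 1) * lam * u"
    have ee: "0 < e" "e \<le> e'" using beta_pos alpha_pos lam_nonneg u0
      by (auto simp: e_def e'_def algebra_simps intro!: add_pos_nonneg)
    have dn: "(n has_real_derivative u powr \<alpha> * e' / (2 * u * s1 u) / ((\<alpha> + 1) * m)) (at u)"
      unfolding n_def e'_def by (rule DERIV_cdivide[OF DERIV_N[OF sol1 u0]])
    have dk: "(\<kappa> has_real_derivative - e / (2 * u\<^sup>2 * s1 u * s2 u) * D u) (at u)"
      using DERIV_kappa[OF u0] by (simp add: e_def)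
    have "e / (2 * u\<^sup>2 * s1 u * s2 u) * D u \<le> e' / (2 * u\<^sup>2 * s1 u * m) * D u"
      using ee m(2)[OF u] m(1) s u0 D_pos[OF u0] by (intro mult_right_mono frac_le mult_left_mono) auto
    also have "\<dots> = e' / (2 * u\<^sup>2 * s1 u * m * (\<alpha> + 1)) * ((\<alpha> + 1) * D u)" using alpha_pos by simp
    also have "\<dots> \<le> e' / (2 * u\<^sup>2 * s1 u * m * (\<alpha> + 1)) * (u * u powr \<alpha> * \<kappa> u)"
      using D_less_kappa[OF u0] ee m(1) s alpha_pos by (intro mult_left_mono divide_nonneg_nonneg mult_nonneg_nonneg) auto
    also have "\<dots> = u powr \<alpha> * e' / (2 * u * s1 u) / ((\<alpha> + 1) * m) * \<kappa> u"
      using u0 by (simp add: power2_eq_square mult_ac)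
    finally have "0 \<le> (- e / (2 * u\<^sup>2 * s1 u * s2 u) * D u + u powr \<alpha> * e' / (2 * u * s1 u) / ((\<alpha> + 1) * m) * \<kappa> u) * exp (n u)"
      by (intro mult_nonneg_nonneg) auto
    moreover have "((\<lambda>u. \<kappa> u * exp (n u)) has_real_derivative
        (- e / (2 * u\<^sup>2 * s1 u * s2 u) * D u + u powr \<alpha> * e' / (2 * u * s1 u) / ((\<alpha> + 1) * m) * \<kappa> u) * exp (n u)) (at u)"
      by (rule DERIV_cong[OF DERIV_mult[OF dk DERIV_fun_exp[OF dn]]]) (simp only: algebra_simps)
    ultimately show "\<exists>y. ((\<lambda>u. \<kappa> u * exp (n u)) has_real_derivative y) (at u) \<and> 0 \<le> y" by blast
  qed
  moreover have "0 < (\<alpha> + 1) * sqrt c0" using alpha_pos c0_pos by simp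
  hence "0 < N s1 K1 R" using N_ge[OF sol1 R(1)] by linarith
  hence "0 < n R" using m alpha_pos by (simp add: n_def)
  hence "\<kappa> R * 1 \<le> \<kappa> R * exp (n R)" using kappa_pos[OF R(1)] by (intro mult_left_mono) auto
  ultimately show ?thesis by (simp add: n_def)
qed

end

context soliton begin

text \<open>\<open>K\<close> is lowered by \<open>1 / R\<close> at a tiny radius \<open>R\<close>.
  By \<open>kappa_le\<close> the gap survives up to \<open>r\<close> except for a factor
  \<open>E\<close> that depends on the fixed solution only, so a small \<open>R\<close> produces any
  prescribed gap.\<close>

lemma sol_growth:
  assumes "sol s0 K0" "0 < r"
  obtains s K where "sol s K" "\<And>u. 0 < u \<Longrightarrow> s0 u < s u" "K r \<le> - M"
proof -
  obtain m where m: "0 < m" "\<And>u. 0 < u \<Longrightarrow> u \<le> r \<Longrightarrow> m \<le> s0 u" using sol_lower_bound[OF assms(1)] by blast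
  obtain b where b: "0 < b" "\<And>u. 0 < u \<Longrightarrow> u < b \<Longrightarrow> u * \<bar>K0 u\<bar> \<le> \<beta> / (2 * sqrt c0) + 1" using rK_bound[OF assms(1)] by blast
  have B: "0 \<le> \<beta> / (2 * sqrt c0) + 2" using beta_pos c0_pos by (intro add_nonneg_nonneg) auto
  obtain R0 where R0: "0 < R0" "R0 \<le> 1"
    "\<And>R x. 0 < R \<Longrightarrow> R \<le> R0 \<Longrightarrow> R * \<bar>x\<bar> \<le> \<beta> / (2 * sqrt c0) + 2 \<Longrightarrow> \<exists>s K. sol s K \<and> K R = x \<and> sqrt c0 / 2 \<le> s R"
    using sol_exists[OF B] by blast
  define E where "E = exp (N s0 K0 r / ((\<alpha> + 1) * m))"
  define R where "R = min (min R0 (b / 2)) (min r (1 / ((\<bar>K0 r + M\<bar> + 1) * E)))"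
  have "0 < (\<bar>K0 r + M\<bar> + 1) * E" by (simp add: E_def add_nonneg_pos)
  hence R: "0 < R" "R \<le> R0" "R < b" "R \<le> r" "R \<le> 1 / ((\<bar>K0 r + M\<bar> + 1) * E)"
    using R0(1) b(1) assms(2) by (auto simp: R_def)
  define x where "x = K0 R - 1 / R"
  have "R * \<bar>x\<bar> \<le> R * (\<bar>K0 R\<bar> + \<bar>1 / R\<bar>)"
    unfolding x_def using R(1)
    by (intro mult_left_mono abs_triangle_ineq4) auto
  also have "\<dots> = R * \<bar>K0 R\<bar> + 1" using R(1) by (simp add: distrib_left)
  also have "\<dots> \<le> \<beta> / (2 * sqrt c0) + 2" using b(2)[OF R(1,3)] by simp
  finally obtain s K where s: "sol s K" "K R = x" using R0(3)[OF R(1,2)] by blast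
  interpret soliton_ordered \<alpha> lam c0 s0 K0 s K
    by (rule soliton_orderedI[OF assms(1) s(1) R(1)]) (use R(1) in \<open>simp add: s(2) x_def\<close>)
  have "\<kappa> R \<le> \<kappa> r * E" unfolding E_def
  proof (rule kappa_le)
    show "m \<le> s u" if "R \<le> u" "u \<le> r" for u using m(2)[of u] s_less[of u] R(1) that by simp
  qed (use R m in auto)
  hence "1 / R \<le> \<kappa> r * E" by (simp add: \<kappa>_def s(2) x_def)
  moreover have "(\<bar>K0 r + M\<bar> + 1) * E \<le> 1 / R"
    using R(1,5) \<open>0 < (\<bar>K0 r + M\<bar> + 1) * E\<close> by (simp add: field_simps)
  ultimately have "(\<bar>K0 r + M\<bar> + 1) * E \<le> \<kappa> r * E" by linarith
  hence "\<bar>K0 r + M\<bar> + 1 \<le> \<kappa> r" by (simp add: E_def)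
  hence "K r \<le> - M" by (simp add: \<kappa>_def)
  thus ?thesis using that s(1) s_less by blast
qed

text \<open>Here \<open>K\<close> is raised by \<open>1 / R\<close>, and the factor in
  \<open>kappa_le\<close> contains \<open>N\<close> of the new solution, which has no a priori
  bound. This is harmless: if \<open>N\<close> were below \<open>M\<close> at \<open>r\<close>, the
  factor would be bounded, and the gap at \<open>r\<close> would exceed \<open>C\<close>, which
  forces \<open>N\<close> above \<open>M\<close>.\<close>

lemma sol_crash:
  assumes "sol s0 K0" "0 < r"
  obtains s K where "sol s K" "\<And>u. 0 < u \<Longrightarrow> s u < s0 u" "M \<le> N s K r"
proof -
  obtain m where m: "0 < m" "\<And>u. 0 < u \<Longrightarrow> u \<le> r \<Longrightarrow> m \<le> s0 u" using sol_lower_bound[OF assms(1)] by blast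
  obtain b where b: "0 < b" "\<And>u. 0 < u \<Longrightarrow> u < b \<Longrightarrow> u * \<bar>K0 u\<bar> \<le> \<beta> / (2 * sqrt c0) + 1" using rK_bound[OF assms(1)] by blast
  have B: "0 \<le> \<beta> / (2 * sqrt c0) + 2" using beta_pos c0_pos by (intro add_nonneg_nonneg) auto
  obtain R0 where R0: "0 < R0" "R0 \<le> 1"
    "\<And>R x. 0 < R \<Longrightarrow> R \<le> R0 \<Longrightarrow> R * \<bar>x\<bar> \<le> \<beta> / (2 * sqrt c0) + 2 \<Longrightarrow> \<exists>s K. sol s K \<and> K R = x \<and> sqrt c0 / 2 \<le> s R"
    using sol_exists[OF B] by blast
  define E where "E = exp (M / ((\<alpha> + 1) * m))"
  define C where "C = (\<bar>M\<bar> + (\<alpha> + 1) * s0 r) / (r * r powr \<alpha>)"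
  have C: "0 < C" using sol_pos[OF assms] assms(2) alpha_pos by (auto simp: C_def intro!: divide_pos_pos add_nonneg_pos)
  define R where "R = min (min R0 (b / 2)) (min r (1 / (C * E)))"
  have CE: "0 < C * E" using C by (simp add: E_def)
  hence R: "0 < R" "R \<le> R0" "R < b" "R \<le> r" "R \<le> 1 / (C * E)"
    using R0(1) b(1) assms(2) by (auto simp: R_def)
  define x where "x = K0 R + 1 / R"
  have "R * \<bar>x\<bar> \<le> R * (\<bar>K0 R\<bar> + \<bar>1 / R\<bar>)"
    unfolding x_def using R(1)
    by (intro mult_left_mono abs_triangle_ineq) auto
  also have "\<dots> = R * \<bar>K0 R\<bar> + 1" using R(1) by (simp add: distrib_left)
  also have "\<dots> \<le> \<beta> / (2 * sqrt c0) + 2" using b(2)[OF R(1,3)] by simp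
  finally obtain s K where s: "sol s K" "K R = x" using R0(3)[OF R(1,2)] by blast
  interpret soliton_ordered \<alpha> lam c0 s K s0 K0
    by (rule soliton_orderedI[OF s(1) assms(1) R(1)]) (use R(1) in \<open>simp add: s(2) x_def\<close>)
  have "M \<le> N s K r"
  proof (rule ccontr)
    assume neg: "\<not> M \<le> N s K r"
    have "\<kappa> R \<le> \<kappa> r * exp (N s K r / ((\<alpha> + 1) * m))"
      using m R(1,4) by (intro kappa_le) auto
    also have "\<dots> < \<kappa> r * E"
      unfolding E_def using neg kappa_pos[OF assms(2)] m(1) alpha_pos
      by (intro mult_strict_left_mono) (auto intro!: divide_strict_right_mono)
    finally have "1 / R < \<kappa> r * E" by (simp add: \<kappa>_def s(2) x_def)
    moreover have "C * E \<le> 1 / R" using R(1,5) CE by (simp add: field_simps)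
    ultimately have "C * E < \<kappa> r * E" by linarith
    hence "C < \<kappa> r" by (simp add: E_def)
    hence "C * (r * r powr \<alpha>) < \<kappa> r * (r * r powr \<alpha>)" using assms(2) by simp
    hence "\<bar>M\<bar> + (\<alpha> + 1) * s0 r < r * r powr \<alpha> * \<kappa> r" using assms(2) by (simp add: C_def mult_ac)
    also have "\<dots> = Q r + (\<alpha> + 1) * D r" by (simp add: Q_kappa)
    also have "\<dots> = N s K r - N s0 K0 r + (\<alpha> + 1) * s0 r - (\<alpha> + 1) * s r" by (simp add: Q_def D_def algebra_simps)
    finally have "\<bar>M\<bar> < N s K r - N s0 K0 r - (\<alpha> + 1) * s r" by linarith
    moreover have "0 \<le> (\<alpha> + 1) * sqrt c0" "0 \<le> (\<alpha> + 1) * s r"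
      using alpha_pos c0_pos sol_pos[OF s(1) assms(2)] by auto
    ultimately show False using neg N_ge[OF assms] by linarith
  qed
  thus ?thesis using that s(1) s_less by blast
qed

text \<open>Lipschitz dependence on \<open>x = K R\<close>. For two members \<open>D\<close> and
  \<open>Q\<close> are positive, so \<open>D + Q\<close> obeys a scalar Gronwall inequality from
  \<open>R\<close> on, where it is at most \<open>R * R powr \<alpha>\<close> times the difference
  of the parameters. The uniform lower bound of \<open>s\<close> is taken from the lowest member,
  the one with the largest parameter \<open>B / R\<close>.\<close>

lemma sol_family:
  assumes "0 \<le> B"
  obtains R0 where "0 < R0" "R0 \<le> 1"
    "\<And>R. 0 < R \<Longrightarrow> R \<le> R0 \<Longrightarrow> \<exists>\<sigma> k. (\<forall>x\<in>{-(B/R)..B/R}. sol (\<sigma> x) (k x) \<and> k x R = x \<and> sqrt c0 / 2 \<le> \<sigma> x R) \<and>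
       (\<forall>r\<ge>R. continuous_on {-(B/R)..B/R} (\<lambda>x. \<sigma> x r) \<and> continuous_on {-(B/R)..B/R} (\<lambda>x. k x r))"
proof -
  obtain R0 where R0: "0 < R0" "R0 \<le> 1"
    "\<And>R x. 0 < R \<Longrightarrow> R \<le> R0 \<Longrightarrow> R * \<bar>x\<bar> \<le> B \<Longrightarrow> \<exists>s K. sol s K \<and> K R = x \<and> sqrt c0 / 2 \<le> s R"
    using sol_exists[OF assms] by blast
  show ?thesis
  proof (rule that[OF R0(1,2)])
    fix R :: real assume R: "0 < R" "R \<le> R0"
    define X where "X = {-(B/R)..B/R}"
    have "\<forall>x\<in>X. \<exists>p. sol (fst p) (snd p) \<and> snd p R = x \<and> sqrt c0 / 2 \<le> fst p R"
    proof
      fix x assume "x \<in> X"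
      hence "\<bar>x\<bar> \<le> B / R" by (auto simp: X_def)
      hence "R * \<bar>x\<bar> \<le> B" using R by (simp add: field_simps)
      thus "\<exists>p. sol (fst p) (snd p) \<and> snd p R = x \<and> sqrt c0 / 2 \<le> fst p R"
        using R0(3)[OF R] by (metis fst_conv snd_conv)
    qed
    then obtain p where p: "\<forall>x\<in>X. sol (fst (p x)) (snd (p x)) \<and> snd (p x) R = x \<and> sqrt c0 / 2 \<le> fst (p x) R"
      by (rule bchoice[THEN exE])
    define \<sigma> where "\<sigma> = (\<lambda>x. fst (p x))"
    define k where "k = (\<lambda>x. snd (p x))"
    have sk: "sol (\<sigma> x) (k x)" "k x R = x" "sqrt c0 / 2 \<le> \<sigma> x R" if "x \<in> X" for x
      using p that by (auto simp: \<sigma>_def k_def)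
    have lip: "\<exists>L\<ge>0. \<forall>x\<in>X. \<forall>y\<in>X. \<bar>\<sigma> x r - \<sigma> y r\<bar> \<le> L * \<bar>x - y\<bar> \<and> \<bar>k x r - k y r\<bar> \<le> L * \<bar>x - y\<bar>" if r: "R \<le> r" for r
    proof -
      have BX: "B / R \<in> X" using assms R by (simp add: X_def)
      obtain m where m: "0 < m" "\<And>u. 0 < u \<Longrightarrow> u \<le> r \<Longrightarrow> m \<le> \<sigma> (B/R) u"
        using sol_lower_bound[OF sk(1)[OF BX]] by blast
      have low: "m \<le> \<sigma> x u" if x: "x \<in> X" and u: "0 < u" "u \<le> r" for x u
      proof (cases "x = B / R")
        case False
        interpret soliton_ordered \<alpha> lam c0 "\<sigma> (B/R)" "k (B/R)" "\<sigma> x" "k x"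
          by (rule soliton_orderedI[OF sk(1)[OF BX] sk(1)[OF x] R(1)]) (use x False in \<open>auto simp: sk(2)[OF BX] sk(2)[OF x] X_def\<close>)
        show ?thesis using m(2)[OF u] s_less[OF u(1)] by simp
      qed (use m u in simp)
      define C where "C = (\<alpha> + 1) / R + r powr \<alpha> * (\<beta> + (\<alpha> / 2 + 1) * lam * r) / (2 * R * m * m)"
      define L where "L = R * R powr \<alpha> * exp (C * (r - R))"
      \<comment> \<open>The second entry serves \<open>\<kappa>\<close>, through \<open>r * r powr
        \<alpha> * \<kappa> = Q + (\<alpha> + 1) * D \<le> (\<alpha> + 1) * (D + Q)\<close>.\<close>
      define L' where "L' = max L ((\<alpha> + 1) * L / (r * r powr \<alpha>))"
      have L: "0 < L" using R by (simp add: L_def)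
      have main: "\<bar>\<sigma> x r - \<sigma> y r\<bar> \<le> L' * \<bar>x - y\<bar> \<and> \<bar>k x r - k y r\<bar> \<le> L' * \<bar>x - y\<bar>"
        if xy: "x \<in> X" "y \<in> X" "x < y" for x y
      proof -
        interpret soliton_ordered \<alpha> lam c0 "\<sigma> y" "k y" "\<sigma> x" "k x"
          by (rule soliton_orderedI[OF sk(1)[OF xy(2)] sk(1)[OF xy(1)] R(1)]) (use xy sk(2) in simp)
        define E where "E = D R + Q R"
        have "D r + Q r - E * exp (C * (r - R)) \<le> 0"
        proof (rule linear_ode_nonpos[OF r, where z = "\<lambda>u. D u + Q u - E * exp (C * (u - R))" and p = "\<lambda>_. C"])
          show "continuous_on {R..r} (\<lambda>u. D u + Q u - E * exp (C * (u - R)))"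
            using R by (intro continuous_intros cont_D cont_Q) auto
          fix u assume u: "R < u" "u < r"
          have u0: "0 < u" using u R by simp
          define a where "a = u powr \<alpha> * (\<nu> + lam * u) / (2 * u * \<sigma> y u * \<sigma> x u)"
          define c where "c = u powr \<alpha> * (\<beta> + (\<alpha> / 2 + 1) * lam * u) / (2 * u * \<sigma> y u * \<sigma> x u)"
          show "((\<lambda>u. D u + Q u - E * exp (C * (u - R))) has_real_derivative
             (((\<alpha> + 1) * D u + Q u) / u - a * D u) + c * D u - E * (C * exp (C * (u - R)))) (at u)"
            unfolding a_def c_def
            by (auto intro!: derivative_eq_intros DERIV_D[OF u0] DERIV_Q[OF u0])
          have s: "m \<le> \<sigma> y u" "m \<le> \<sigma> x u" using low xy u0 u by auto
          have D: "0 < D u" "0 < Q u" using D_pos[OF u0] Q_pos[OF u0] by auto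
          have "0 \<le> a" unfolding a_def using u0 s m(1) nu_pos lam_nonneg
            by (intro divide_nonneg_nonneg mult_nonneg_nonneg add_nonneg_nonneg) auto
          have "c \<le> r powr \<alpha> * (\<beta> + (\<alpha> / 2 + 1) * lam * r) / (2 * R * m * m)"
            unfolding c_def
          proof (rule frac_le)
            show "u powr \<alpha> * (\<beta> + (\<alpha> / 2 + 1) * lam * u) \<le> r powr \<alpha> * (\<beta> + (\<alpha> / 2 + 1) * lam * r)"
              using u u0 alpha_pos beta_pos lam_nonneg
              by (intro mult_mono powr_mono2 add_left_mono mult_left_mono add_nonneg_nonneg mult_nonneg_nonneg) auto
            show "0 \<le> r powr \<alpha> * (\<beta> + (\<alpha> / 2 + 1) * lam * r)"
              using u u0 alpha_pos beta_pos lam_nonneg by (intro mult_nonneg_nonneg add_nonneg_nonneg) auto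
            show "0 < 2 * R * m * m" using R m by simp
            show "2 * R * m * m \<le> 2 * u * \<sigma> y u * \<sigma> x u"
              using s m(1) u R by (intro mult_mono mult_nonneg_nonneg) auto
          qed
          moreover have "(\<alpha> + 1) / u \<le> (\<alpha> + 1) / R" using u R alpha_pos by (intro divide_left_mono) auto
          ultimately have "(\<alpha> + 1) / u + c \<le> C" by (simp add: C_def)
          hence "((\<alpha> + 1) / u + c) * D u \<le> C * D u" using D by (intro mult_right_mono) auto
          moreover have "Q u / u \<le> C * Q u"
          proof -
            have "1 / u \<le> (\<alpha> + 1) / u" using u0 alpha_pos by (intro divide_right_mono) auto
            moreover have "0 \<le> c" unfolding c_def using u0 s m(1) beta_pos alpha_pos lam_nonneg
              by (intro divide_nonneg_nonneg mult_nonneg_nonneg add_nonneg_nonneg) auto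
            ultimately have "1 / u \<le> C" using \<open>(\<alpha> + 1) / u + c \<le> C\<close> by linarith
            hence "1 / u * Q u \<le> C * Q u" using D by (intro mult_right_mono) auto
            thus ?thesis by simp
          qed
          moreover have "0 \<le> a * D u" using \<open>0 \<le> a\<close> D by simp
          ultimately show "(((\<alpha> + 1) * D u + Q u) / u - a * D u) + c * D u - E * (C * exp (C * (u - R)))
             \<le> C * (D u + Q u - E * exp (C * (u - R)))"
            by (simp add: algebra_simps add_divide_distrib)
        qed (simp_all add: E_def)
        moreover have "E \<le> R * R powr \<alpha> * (y - x)"
        proof -
          have "R * R powr \<alpha> * \<kappa> R = Q R + (\<alpha> + 1) * D R" by (simp add: Q_kappa)
          moreover have "D R \<le> (\<alpha> + 1) * D R" using D_pos[OF R(1)] alpha_pos by simp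
          moreover have "\<kappa> R = y - x" using sk(2) xy by (simp add: \<kappa>_def)
          ultimately show ?thesis by (simp add: E_def)
        qed
        hence "E * exp (C * (r - R)) \<le> R * R powr \<alpha> * (y - x) * exp (C * (r - R))" by (intro mult_right_mono) auto
        moreover have "R * R powr \<alpha> * (y - x) * exp (C * (r - R)) = L * (y - x)" by (simp add: L_def)
        ultimately have DQ: "D r + Q r \<le> L * (y - x)" by linarith
        have r0: "0 < r" using R r by simp
        have p: "0 < r * r powr \<alpha>" using r0 by simp
        have "D r \<le> L * (y - x)" using DQ Q_pos[OF r0] by simp
        also have "\<dots> \<le> L' * (y - x)" using xy by (intro mult_right_mono) (auto simp: L'_def)
        finally have 1: "D r \<le> L' * (y - x)" .
        have "r * r powr \<alpha> * \<kappa> r = Q r + (\<alpha> + 1) * D r" by (simp add: Q_kappa)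
        also have "\<dots> \<le> (\<alpha> + 1) * (D r + Q r)" using Q_pos[OF r0] alpha_pos by (simp add: algebra_simps)
        also have "\<dots> \<le> (\<alpha> + 1) * (L * (y - x))" using DQ alpha_pos by (intro mult_left_mono) auto
        finally have "\<kappa> r \<le> (\<alpha> + 1) * L / (r * r powr \<alpha>) * (y - x)" using p by (simp add: field_simps)
        also have "\<dots> \<le> L' * (y - x)" using xy by (intro mult_right_mono) (auto simp: L'_def)
        finally have 2: "\<kappa> r \<le> L' * (y - x)" .
        show ?thesis using 1 2 D_pos[OF r0] kappa_pos[OF r0] xy(3) by (auto simp: D_def \<kappa>_def)
      qed
      have "\<bar>\<sigma> x r - \<sigma> y r\<bar> \<le> L' * \<bar>x - y\<bar> \<and> \<bar>k x r - k y r\<bar> \<le> L' * \<bar>x - y\<bar>" if "x \<in> X" "y \<in> X" for x y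
        using main[of x y] main[of y x] that by (cases x y rule: linorder_cases) (auto simp: abs_minus_commute)
      moreover have "0 \<le> L'" using L by (simp add: L'_def)
      ultimately show ?thesis by blast
    qed
    have "continuous_on X (\<lambda>x. \<sigma> x r) \<and> continuous_on X (\<lambda>x. k x r)" if Rr: "R \<le> r" for r
    proof -
      obtain L where "L \<ge> 0" "\<forall>x\<in>X. \<forall>y\<in>X. \<bar>\<sigma> x r - \<sigma> y r\<bar> \<le> L * \<bar>x - y\<bar> \<and> \<bar>k x r - k y r\<bar> \<le> L * \<bar>x - y\<bar>"
        using lip[OF Rr] by blast
      hence "L-lipschitz_on X (\<lambda>x. \<sigma> x r)" "L-lipschitz_on X (\<lambda>x. k x r)"
        by (auto intro!: lipschitz_onI simp: dist_real_def)
      thus ?thesis using lipschitz_on_continuous_on by blast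
    qed
    thus "\<exists>\<sigma> k. (\<forall>x\<in>{-(B/R)..B/R}. sol (\<sigma> x) (k x) \<and> k x R = x \<and> sqrt c0 / 2 \<le> \<sigma> x R) \<and>
       (\<forall>r\<ge>R. continuous_on {-(B/R)..B/R} (\<lambda>x. \<sigma> x r) \<and> continuous_on {-(B/R)..B/R} (\<lambda>x. k x r))"
      using sk unfolding X_def by blast
  qed
qed

lemma sol_eq_of_K_eq:
  assumes "sol s1 K1" "sol s2 K2" "0 < R" "K1 R = K2 R" "0 < r"
  shows "s1 r = s2 r" "K1 r = K2 r"
proof -
  have "\<not> soliton_ordered \<alpha> lam c0 s1 K1 s2 K2" "\<not> soliton_ordered \<alpha> lam c0 s2 K2 s1 K1"
    using soliton_ordered.K_less[OF _ assms(3)] assms(4) by (metis less_irrefl)+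
  thus "s1 r = s2 r" "K1 r = K2 r" using sol_eqI assms(1,2,5) by blast+
qed

text \<open>\<open>R\<close> is taken so small that both given solutions are members of the same
  continuous family, each identified by its value \<open>K R\<close>. The claim is the intermediate
  value theorem on the parameter interval.\<close>

lemma sol_intermediate:
  fixes F :: "real \<Rightarrow> real \<Rightarrow> real"
  assumes sols: "sol sa Ka" "sol sb Kb" and r: "0 < r"
    and cont: "\<And>f g (X :: real set). continuous_on X f \<Longrightarrow> continuous_on X g \<Longrightarrow> (\<And>x. x \<in> X \<Longrightarrow> 0 < f x) \<Longrightarrow> continuous_on X (\<lambda>x. F (f x) (g x))"
    and y: "F (sa r) (Ka r) \<le> y" "y \<le> F (sb r) (Kb r)"
  obtains s K where "sol s K" "F (s r) (K r) = y"
proof -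
  define B where "B = \<beta> / (2 * sqrt c0) + 1"
  have B: "0 \<le> B" using beta_pos c0_pos by (auto simp: B_def intro!: add_nonneg_nonneg)
  obtain R0 where R0: "0 < R0" "R0 \<le> 1"
    "\<And>R. 0 < R \<Longrightarrow> R \<le> R0 \<Longrightarrow> \<exists>\<sigma> k. (\<forall>x\<in>{-(B/R)..B/R}. sol (\<sigma> x) (k x) \<and> k x R = x \<and> sqrt c0 / 2 \<le> \<sigma> x R) \<and>
       (\<forall>r\<ge>R. continuous_on {-(B/R)..B/R} (\<lambda>x. \<sigma> x r) \<and> continuous_on {-(B/R)..B/R} (\<lambda>x. k x r))"
    using sol_family[OF B] by blast
  obtain ba where ba: "0 < ba" "\<And>r. 0 < r \<Longrightarrow> r < ba \<Longrightarrow> r * \<bar>Ka r\<bar> \<le> B" using rK_bound[OF sols(1)] B_def by metis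
  obtain bb where bb: "0 < bb" "\<And>r. 0 < r \<Longrightarrow> r < bb \<Longrightarrow> r * \<bar>Kb r\<bar> \<le> B" using rK_bound[OF sols(2)] B_def by metis
  define R where "R = min (min R0 r) (min (ba/2) (bb/2))"
  have R: "0 < R" "R \<le> R0" "R \<le> r" "R < ba" "R < bb" using R0(1) r ba(1) bb(1) by (auto simp: R_def)
  obtain \<sigma> k where sk: "\<And>x. x \<in> {-(B/R)..B/R} \<Longrightarrow> sol (\<sigma> x) (k x)" "\<And>x. x \<in> {-(B/R)..B/R} \<Longrightarrow> k x R = x"
      "continuous_on {-(B/R)..B/R} (\<lambda>x. \<sigma> x r)" "continuous_on {-(B/R)..B/R} (\<lambda>x. k x r)"
    using R0(3)[OF R(1,2)] R(3) by blast
  define G where "G = (\<lambda>x. F (\<sigma> x r) (k x r))"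
  have cG: "continuous_on {-(B/R)..B/R} G"
    unfolding G_def by (rule cont[OF sk(3,4)]) (use sk(1) sol_pos r in blast)
  have mem: "G (K' R) = F (s' r) (K' r)" "K' R \<in> {-(B/R)..B/R}" if "sol s' K'" "R * \<bar>K' R\<bar> \<le> B" for s' K'
  proof -
    have "\<bar>K' R\<bar> \<le> B / R" using that(2) R(1) by (simp add: field_simps)
    thus x: "K' R \<in> {-(B/R)..B/R}" by auto
    show "G (K' R) = F (s' r) (K' r)"
      using sol_eq_of_K_eq[OF sk(1)[OF x] that(1) R(1) sk(2)[OF x] r] by (simp add: G_def)
  qed
  have "connected (G ` {-(B/R)..B/R})" by (rule connected_continuous_image[OF cG]) simp
  moreover have "F (sa r) (Ka r) \<in> G ` {-(B/R)..B/R}" "F (sb r) (Kb r) \<in> G ` {-(B/R)..B/R}"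
    using mem[OF sols(1) ba(2)[OF R(1,4)]] mem[OF sols(2) bb(2)[OF R(1,5)]] by (metis image_eqI)+
  ultimately have "y \<in> G ` {-(B/R)..B/R}" using y by (rule connectedD_interval)
  then obtain x where "x \<in> {-(B/R)..B/R}" "G x = y" by auto
  thus ?thesis using that sk(1) by (auto simp: G_def)
qed

end

section \<open>Steady solitons away from the fold\<close>

context soliton begin

text \<open>Distinct solutions are expressed by \<open>soliton_ordered\<close>: two solutions that
  are ordered in neither direction coincide on \<open>r > 0\<close>, while equality as functions
  would also concern the free values at \<open>r \<le> 0\<close>.\<close>

definition well_posed :: "real \<Rightarrow> real \<Rightarrow> bool" where
  "well_posed c1 \<epsilon> \<longleftrightarrow> (\<exists>s K. sol s K \<and> \<Phi> s K \<epsilon> = c1) \<and>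
     (\<forall>s1 K1 s2 K2. soliton_ordered \<alpha> lam c0 s1 K1 s2 K2 \<longrightarrow> \<Phi> s1 K1 \<epsilon> = c1 \<longrightarrow> \<Phi> s2 K2 \<epsilon> \<noteq> c1)"

lemma Phi_eq: "\<Phi> s K r = \<beta> / r + lam - 2 * s r * K r + lam * ln (s r) - lam / 2 * ln c0 - \<alpha> * lam / 2 * ln r"
  by (simp add: \<Phi>_def V_def beta_gamma add_divide_distrib)

lemma Phi_intermediate:
  assumes "sol sa Ka" "sol sb Kb" "0 < r" "\<Phi> sa Ka r \<le> y" "y \<le> \<Phi> sb Kb r"
  shows "\<exists>s K. sol s K \<and> \<Phi> s K r = y"
proof -
  define F where "F = (\<lambda>s K. \<beta> / r + lam - 2 * s * K + lam * ln s - lam / 2 * ln c0 - \<alpha> * lam / 2 * ln r)"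
  have F: "\<Phi> s K r = F (s r) (K r)" for s K by (simp add: F_def Phi_eq)
  obtain s K where "sol s K" "F (s r) (K r) = y"
  proof (rule sol_intermediate[OF assms(1-3), of F y])
    fix f g :: "real \<Rightarrow> real" and X assume fg: "continuous_on X f" "continuous_on X g" "\<And>x. x \<in> X \<Longrightarrow> 0 < f x"
    have "\<forall>x\<in>X. f x \<noteq> 0" using fg(3) by force
    thus "continuous_on X (\<lambda>x. F (f x) (g x))" unfolding F_def by (intro continuous_intros fg)
  qed (use assms F in auto)
  thus ?thesis using F by blast
qed

lemma ex_sol: obtains s K where "sol s K"
proof -
  obtain R0 where R0: "0 < R0" "\<And>R x. 0 < R \<Longrightarrow> R \<le> R0 \<Longrightarrow> R * \<bar>x\<bar> \<le> 0 \<Longrightarrow> \<exists>s K. sol s K \<and> K R = x \<and> sqrt c0 / 2 \<le> s R"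
    using sol_exists[of 0] by (metis order_refl)
  show ?thesis using R0(2)[of R0 0] R0(1) that by auto
qed

lemma V_cont: "sol s K \<Longrightarrow> S \<subseteq> {0<..} \<Longrightarrow> continuous_on S (V s K)"
  by (rule continuous_on_DERIV[OF DERIV_V]) auto

lemma V_coeff_cont:
  assumes "sol s K" "S \<subseteq> {0<..}"
  shows "continuous_on S (\<lambda>r. r powr \<alpha> * (V s K r - \<nu> / r - c) / (2 * (s r)\<^sup>2))"
proof -
  have "2 * (s y)\<^sup>2 \<noteq> 0" "y \<noteq> 0" if "y \<in> S" for y using assms that sol_pos[OF assms(1), of y] by auto
  thus ?thesis by (intro continuous_intros sol_cont[OF assms] V_cont[OF assms]) auto
qed

end

context soliton_ordered begin

lemma Phi_diff: "\<Phi> s2 K2 r - \<Phi> s1 K1 r = 2 * s1 r * \<kappa> r - 2 * D r * K2 r + lam * (ln (s2 r) - ln (s1 r))"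
  by (simp add: Phi_eq D_def \<kappa>_def algebra_simps)

end

context soliton begin

lemma well_posed_steady_pos:
  assumes "lam = 0" "0 < c1"
  shows "\<exists>\<epsilon>>0. well_posed c1 \<epsilon>"
proof -
  define \<epsilon> where "\<epsilon> = \<beta> / c1"
  have \<epsilon>: "0 < \<epsilon>" "\<beta> / \<epsilon> = c1" using assms(2) beta_pos by (auto simp: \<epsilon>_def)
  have Phi: "\<Phi> s K \<epsilon> = c1 - 2 * s \<epsilon> * K \<epsilon>" for s K unfolding Phi_eq using \<epsilon> assms(1) by simp
  obtain s0 K0 where ref: "sol s0 K0" by (rule ex_sol)
  obtain sb Kb where b: "sol sb Kb" "Kb \<epsilon> \<le> - 0" using sol_growth[OF ref \<epsilon>(1)] by blast
  \<comment> \<open>A value of \<open>N\<close> of at least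
    \<open>(\<alpha> + 1) * s0 \<epsilon>\<close> together with
    \<open>sa \<epsilon> < s0 \<epsilon>\<close> leaves a positive contribution of
    \<open>K\<close>.\<close>
  obtain sa Ka where a: "sol sa Ka" "\<And>u. 0 < u \<Longrightarrow> sa u < s0 u" "(\<alpha> + 1) * s0 \<epsilon> \<le> N sa Ka \<epsilon>"
    using sol_crash[OF ref \<epsilon>(1)] by blast
  have "(\<alpha> + 1) * sa \<epsilon> < (\<alpha> + 1) * s0 \<epsilon>" using a(2)[OF \<epsilon>(1)] alpha_pos by simp
  hence "0 < \<epsilon> * \<epsilon> powr \<alpha> * Ka \<epsilon>" using a(3) by (simp add: N_def)
  hence "0 < Ka \<epsilon>" using zero_less_mult_pos[of "\<epsilon> * \<epsilon> powr \<alpha>" "Ka \<epsilon>"] \<epsilon>(1) by simp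
  hence "\<Phi> sa Ka \<epsilon> \<le> c1" using sol_pos[OF a(1) \<epsilon>(1)] by (simp add: Phi)
  moreover have "c1 \<le> \<Phi> sb Kb \<epsilon>" using b sol_pos[OF b(1) \<epsilon>(1)] by (simp add: Phi mult_nonneg_nonpos)
  ultimately have "\<exists>s K. sol s K \<and> \<Phi> s K \<epsilon> = c1" by (intro Phi_intermediate[OF a(1) b(1) \<epsilon>(1)])
  moreover have "\<Phi> s2 K2 \<epsilon> \<noteq> c1" if ord: "soliton_ordered \<alpha> lam c0 s1 K1 s2 K2" and "\<Phi> s1 K1 \<epsilon> = c1" for s1 K1 s2 K2
  proof
    interpret soliton_ordered \<alpha> lam c0 s1 K1 s2 K2 by (rule ord)
    assume "\<Phi> s2 K2 \<epsilon> = c1"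
    hence "K1 \<epsilon> = 0" "K2 \<epsilon> = 0" using that(2) sol_pos[OF sol1 \<epsilon>(1)] sol_pos[OF sol2 \<epsilon>(1)] by (auto simp: Phi)
    thus False using K_less[OF \<epsilon>(1)] by simp
  qed
  ultimately show ?thesis using \<epsilon>(1) unfolding well_posed_def by blast
qed

text \<open>The source term of \<open>V'\<close> is nonpositive here, so a negative \<open>V\<close>
  would remain negative up to \<open>\<epsilon>\<close>.\<close>

lemma V_nonneg_backward:
  assumes sol: "sol s K" and "lam = 0" "\<gamma> \<le> 0" "0 < r" "r \<le> \<epsilon>" "0 \<le> V s K \<epsilon>"
  shows "0 \<le> V s K r"
proof (rule ccontr)
  assume neg: "\<not> 0 \<le> V s K r"
  have "V s K \<epsilon> < 0"
  proof (rule linear_ode_neg[OF assms(5), where z = "V s K" and p = "\<lambda>r. r powr \<alpha> * (V s K r - \<nu> / r - lam) / (2 * (s r)\<^sup>2)"])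
    show "continuous_on {r..\<epsilon>} (V s K)" by (rule V_cont[OF sol]) (use assms in auto)
    show "continuous_on {r..\<epsilon>} (\<lambda>r. r powr \<alpha> * (V s K r - \<nu> / r - lam) / (2 * (s r)\<^sup>2))"
      by (rule V_coeff_cont[OF sol]) (use assms in auto)
    fix u assume "r < u" "u < \<epsilon>"
    hence u: "0 < u" using assms by simp
    show "(V s K has_real_derivative u powr \<alpha> * V s K u * (V s K u - \<nu> / u - lam) / (2 * (s u)\<^sup>2) + \<gamma> / u\<^sup>2 + \<alpha> * lam / (2 * u)) (at u)"
      by (rule DERIV_V[OF sol u])
    have "\<gamma> / u\<^sup>2 \<le> 0" using assms(3) by (simp add: divide_nonpos_nonneg)
    thus "u powr \<alpha> * V s K u * (V s K u - \<nu> / u - lam) / (2 * (s u)\<^sup>2) + \<gamma> / u\<^sup>2 + \<alpha> * lam / (2 * u)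
       \<le> u powr \<alpha> * (V s K u - \<nu> / u - lam) / (2 * (s u)\<^sup>2) * V s K u"
      using assms(2) by (simp add: mult_ac)
  qed (use neg in auto)
  thus False using assms(6) by simp
qed

text \<open>With \<open>\<gamma> / \<epsilon> \<le> c1\<close> the level condition forces
  \<open>V \<ge> 0\<close> at \<open>\<epsilon>\<close>, hence on all of
  \<open>(0, \<epsilon>]\<close>, so \<open>s\<close> has increased from \<open>sqrt c0\<close>. For
  two such solutions equality of \<open>\<Phi>\<close> gives
  \<open>2 * c0 * \<kappa> \<le> D * \<nu> / \<epsilon>\<close>, which contradicts \<open>(\<alpha>
  + 1) * D < \<epsilon> * \<epsilon> powr \<alpha> * \<kappa>\<close> for small
  \<open>\<epsilon>\<close>.\<close>

lemma well_posed_small: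
  assumes lam0: "lam = 0" and c1: "c1 \<le> 0" and \<alpha>: "\<alpha> < 1 \<or> \<alpha> = 1 \<and> c1 = 0"
  shows "\<exists>\<epsilon>>0. well_posed c1 \<epsilon>"
proof -
  \<comment> \<open>For \<open>K \<epsilon> = B / \<epsilon>\<close> and
    \<open>s \<epsilon> \<ge> sqrt c0 / 2\<close> the product \<open>2 * s * K\<close> is at least
    \<open>(\<beta> + \<bar>c1\<bar>) / \<epsilon>\<close>, which brings \<open>\<Phi>\<close> down
    to the level \<open>c1\<close> when \<open>\<epsilon> \<le> 1\<close>.\<close>
  define B where "B = (\<beta> + \<bar>c1\<bar>) / sqrt c0"
  have B: "0 \<le> B" using beta_pos c0_pos by (simp add: B_def)
  obtain R0 where R0: "0 < R0" "R0 \<le> 1"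
    "\<And>R x. 0 < R \<Longrightarrow> R \<le> R0 \<Longrightarrow> R * \<bar>x\<bar> \<le> B \<Longrightarrow> \<exists>s K. sol s K \<and> K R = x \<and> sqrt c0 / 2 \<le> s R"
    using sol_exists[OF B] by blast
  have \<gamma>: "\<gamma> \<le> 0" "\<gamma> < 0 \<or> c1 = 0"
    using \<alpha> nu_pos by (auto simp: \<gamma>_def mult_nonneg_nonpos mult_pos_neg)
  have "\<forall>\<^sub>F r in at_right 0. r powr \<alpha> < 2 * c0 * (\<alpha> + 1) / \<nu>"
    by (rule order_tendstoD[OF tendsto_powr_alpha]) (use c0_pos alpha_pos nu_pos in auto)
  then obtain b where b: "0 < b" "\<And>r. 0 < r \<Longrightarrow> r < b \<Longrightarrow> r powr \<alpha> < 2 * c0 * (\<alpha> + 1) / \<nu>"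
    by (auto simp: eventually_at_right_field)
  \<comment> \<open>For \<open>c1 < 0\<close> also \<open>\<gamma> < 0\<close>, and
    \<open>\<epsilon> \<le> \<gamma> / c1\<close> is the condition
    \<open>\<gamma> / \<epsilon> \<le> c1\<close>.\<close>
  define \<epsilon> where "\<epsilon> = min (min R0 (b / 2)) (if c1 = 0 then 1 else \<gamma> / c1)"
  have \<epsilon>: "0 < \<epsilon>" "\<epsilon> \<le> R0" "\<epsilon> < b" "\<gamma> / \<epsilon> \<le> c1"
  proof -
    have g: "c1 = 0 \<or> 0 < \<gamma> / c1" using \<gamma> c1 by (auto intro: divide_neg_neg)
    show 0: "0 < \<epsilon>" "\<epsilon> \<le> R0" "\<epsilon> < b" using R0 b g by (auto simp: \<epsilon>_def)
    show "\<gamma> / \<epsilon> \<le> c1"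
    proof (cases "c1 = 0")
      case True thus ?thesis using \<gamma> 0 by (simp add: divide_nonpos_pos)
    next
      case False
      hence "\<epsilon> \<le> \<gamma> / c1" by (simp add: \<epsilon>_def)
      hence "\<gamma> \<le> c1 * \<epsilon>" using False c1 by (simp add: neg_le_divide_eq mult.commute)
      thus ?thesis using 0 by (simp add: pos_divide_le_eq)
    qed
  qed
  have \<epsilon>1: "\<epsilon> \<le> 1" using \<epsilon> R0 by simp
  have Phi: "\<Phi> s K \<epsilon> = \<beta> / \<epsilon> - 2 * s \<epsilon> * K \<epsilon>" for s K unfolding Phi_eq using lam0 by simp
  obtain sb Kb where sb: "sol sb Kb" "Kb \<epsilon> = 0" using R0(3)[OF \<epsilon>(1,2), of 0] B by auto
  obtain sa Ka where sa: "sol sa Ka" "Ka \<epsilon> = B / \<epsilon>" "sqrt c0 / 2 \<le> sa \<epsilon>"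
    using R0(3)[OF \<epsilon>(1,2), of "B / \<epsilon>"] B \<epsilon>(1) by auto
  have "c1 \<le> \<Phi> sb Kb \<epsilon>" using sb c1 beta_pos \<epsilon>(1) by (simp add: Phi order_trans[of c1 0])
  moreover have "\<Phi> sa Ka \<epsilon> \<le> c1"
  proof -
    have "sqrt c0 / 2 * (B / \<epsilon>) \<le> sa \<epsilon> * (B / \<epsilon>)" using sa(3) B \<epsilon>(1) by (intro mult_right_mono) auto
    hence "\<Phi> sa Ka \<epsilon> \<le> \<beta> / \<epsilon> - 2 * (sqrt c0 / 2 * (B / \<epsilon>))" unfolding Phi sa(2) mult.assoc by linarith
    also have "\<dots> = - (\<bar>c1\<bar> / \<epsilon>)" using c0_pos \<epsilon>(1) by (simp add: B_def field_simps)
    also have "\<bar>c1\<bar> \<le> \<bar>c1\<bar> / \<epsilon>" using \<epsilon>(1) \<epsilon>1 by (simp add: pos_le_divide_eq mult_left_le)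
    hence "- (\<bar>c1\<bar> / \<epsilon>) \<le> c1" by linarith
    finally show ?thesis .
  qed
  ultimately have "\<exists>s K. sol s K \<and> \<Phi> s K \<epsilon> = c1" by (intro Phi_intermediate[OF sa(1) sb(1) \<epsilon>(1)])
  moreover have "\<Phi> s2 K2 \<epsilon> \<noteq> c1" if ord: "soliton_ordered \<alpha> lam c0 s1 K1 s2 K2" and P1: "\<Phi> s1 K1 \<epsilon> = c1" for s1 K1 s2 K2
  proof
    interpret soliton_ordered \<alpha> lam c0 s1 K1 s2 K2 by (rule ord)
    assume P2: "\<Phi> s2 K2 \<epsilon> = c1"
    have ge: "0 \<le> V s K \<epsilon> \<and> sqrt c0 \<le> s \<epsilon>" if sol: "sol s K" and P: "\<Phi> s K \<epsilon> = c1" for s K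
    proof -
      have V: "0 \<le> V s K \<epsilon>" using P[unfolded \<Phi>_def] \<epsilon>(4) lam0 by simp
      have mono: "(s u)\<^sup>2 \<le> (s \<epsilon>)\<^sup>2" if "0 < u" "u \<le> \<epsilon>" for u
      proof (rule DERIV_nonneg_imp_nondecreasing[OF that(2), of "\<lambda>u. (s u)\<^sup>2"])
        fix x assume "u \<le> x" "x \<le> \<epsilon>"
        thus "\<exists>y. ((\<lambda>u. (s u)\<^sup>2) has_real_derivative y) (at x) \<and> 0 \<le> y"
          using DERIV_sq[OF sol, of x] V_nonneg_backward[OF sol lam0 \<gamma>(1) _ _ V, of x] that
          by (intro exI[of _ "x powr \<alpha> * V s K x"]) auto
      qed
      have "sqrt c0 \<le> s \<epsilon>"
      proof (rule tendsto_upperbound[OF sol_lim[OF sol]])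
        show "\<forall>\<^sub>F u in at_right 0. s u \<le> s \<epsilon>"
          unfolding eventually_at_right_field
          using \<epsilon>(1) power2_le_imp_le[OF mono] sol_pos[OF sol \<epsilon>(1)] by (intro exI[of _ \<epsilon>]) auto
      qed simp
      with V show ?thesis by blast
    qed
    have g1: "sqrt c0 \<le> s1 \<epsilon>" and g2: "sqrt c0 \<le> s2 \<epsilon>" "0 \<le> V s2 K2 \<epsilon>" using ge sol1 sol2 P1 P2 by auto
    have "s1 \<epsilon> * \<kappa> \<epsilon> = D \<epsilon> * K2 \<epsilon>" using Phi_diff[of \<epsilon>] P1 P2 lam0 by simp
    hence "2 * (s1 \<epsilon> * s2 \<epsilon>) * \<kappa> \<epsilon> = D \<epsilon> * (2 * s2 \<epsilon> * K2 \<epsilon>)" by simp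
    also have "2 * s2 \<epsilon> * K2 \<epsilon> \<le> \<nu> / \<epsilon>" using g2(2)[unfolded V_def] lam0 by simp
    hence "D \<epsilon> * (2 * s2 \<epsilon> * K2 \<epsilon>) \<le> D \<epsilon> * (\<nu> / \<epsilon>)" using D_pos[OF \<epsilon>(1)] by (intro mult_left_mono) auto
    finally have "2 * (s1 \<epsilon> * s2 \<epsilon>) * \<kappa> \<epsilon> \<le> D \<epsilon> * (\<nu> / \<epsilon>)" .
    moreover have "c0 \<le> s1 \<epsilon> * s2 \<epsilon>" using mult_mono[OF g1 g2(1)] c0_pos g1 by simp
    hence "2 * c0 * \<kappa> \<epsilon> \<le> 2 * (s1 \<epsilon> * s2 \<epsilon>) * \<kappa> \<epsilon>" using kappa_pos[OF \<epsilon>(1)] by simp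
    ultimately have "2 * c0 * \<kappa> \<epsilon> \<le> D \<epsilon> * (\<nu> / \<epsilon>)" by linarith
    hence "(\<epsilon> * \<epsilon> powr \<alpha>) * (2 * c0 * \<kappa> \<epsilon>) \<le> (\<epsilon> * \<epsilon> powr \<alpha>) * (D \<epsilon> * (\<nu> / \<epsilon>))" using \<epsilon>(1) by (intro mult_left_mono) auto
    hence "2 * c0 * (\<epsilon> * \<epsilon> powr \<alpha> * \<kappa> \<epsilon>) \<le> \<epsilon> powr \<alpha> * \<nu> * D \<epsilon>" using \<epsilon>(1) by (simp add: mult_ac)
    moreover have "2 * c0 * ((\<alpha> + 1) * D \<epsilon>) < 2 * c0 * (\<epsilon> * \<epsilon> powr \<alpha> * \<kappa> \<epsilon>)" using D_less_kappa[OF \<epsilon>(1)] c0_pos by simp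
    ultimately have "2 * c0 * ((\<alpha> + 1) * D \<epsilon>) < \<epsilon> powr \<alpha> * \<nu> * D \<epsilon>" by linarith
    hence "2 * c0 * (\<alpha> + 1) * D \<epsilon> < \<epsilon> powr \<alpha> * \<nu> * D \<epsilon>" by (simp only: mult.assoc)
    hence "2 * c0 * (\<alpha> + 1) < \<epsilon> powr \<alpha> * \<nu>" using D_pos[OF \<epsilon>(1)] by simp
    thus False using b(2)[OF \<epsilon>(1,3)] nu_pos by (simp add: field_simps)
  qed
  ultimately show ?thesis using \<epsilon>(1) unfolding well_posed_def by blast
qed

end

section \<open>Expanding solitons\<close>

context soliton_ordered begin

text \<open>This ratio decides the monotonicity of \<open>\<Phi>\<close>. For
  \<open>V \<ge> 0\<close> the unfavourable term \<open>D * 2 * s2 * K2\<close> is at most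
  \<open>D * (\<nu> / r + lam)\<close>. The favourable term \<open>2 * s1 * s2 * \<kappa>\<close>
  covers the part with \<open>\<nu>\<close> precisely when \<open>\<Theta> \<ge> \<nu> / 2\<close>;
  the part with \<open>lam\<close> is left to the logarithm.\<close>

definition \<Theta> :: "real \<Rightarrow> real" where "\<Theta> r = r * \<kappa> r * s1 r * s2 r / D r"

definition \<Theta>' :: "real \<Rightarrow> real" where
  "\<Theta>' r = \<Theta> r / r - (\<beta> + \<alpha> * lam * r / 2) / (2 * r)
     + \<Theta> r * r powr \<alpha> * (V s1 K1 r / (2 * (s1 r)\<^sup>2) + V s2 K2 r / (2 * (s2 r)\<^sup>2))
     + r powr \<alpha> * \<kappa> r / D r * ((\<nu> + lam * r) / 2 - \<Theta> r)"

lemma Theta_pos: "0 < r \<Longrightarrow> 0 < \<Theta> r"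
  using kappa_pos[of r] D_pos[of r] sol_pos[OF sol1, of r] sol_pos[OF sol2, of r] by (simp add: \<Theta>_def)

lemma DERIV_Theta:
  assumes r: "0 < r"
  shows "(\<Theta> has_real_derivative \<Theta>' r) (at r)"
proof -
  have s: "0 < s1 r" "0 < s2 r" "0 < D r" using sol_pos sol1 sol2 D_pos r by auto
  define e where "e = \<beta> + \<alpha> * lam * r / 2"
  define p where "p = r powr \<alpha>"
  define k where "k = \<nu> + lam * r"
  have 1: "(\<kappa> has_real_derivative - e / (2 * r\<^sup>2 * s1 r * s2 r) * D r) (at r)"
    using DERIV_kappa[OF r] by (simp add: e_def)
  have 2: "(D has_real_derivative p * \<kappa> r - p * k / (2 * r * s1 r * s2 r) * D r) (at r)"
    using DERIV_D_kappa[OF r] by (simp add: p_def k_def)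
  have 3: "(s1 has_real_derivative p * V s1 K1 r / (2 * s1 r)) (at r)" "(s2 has_real_derivative p * V s2 K2 r / (2 * s2 r)) (at r)"
    using sol_DERIV_s sol1 sol2 r by (auto simp: p_def)
  have "(\<Theta> has_real_derivative
     (((\<kappa> r + r * (- e / (2 * r\<^sup>2 * s1 r * s2 r) * D r)) * s1 r * s2 r
        + r * \<kappa> r * (p * V s1 K1 r / (2 * s1 r)) * s2 r + r * \<kappa> r * s1 r * (p * V s2 K2 r / (2 * s2 r))) * D r
      - r * \<kappa> r * s1 r * s2 r * (p * \<kappa> r - p * k / (2 * r * s1 r * s2 r) * D r)) / (D r * D r)) (at r)"
    unfolding \<Theta>_def[abs_def]
    by (rule DERIV_cong[OF DERIV_divide[OF DERIV_mult[OF DERIV_mult[OF DERIV_mult[OF DERIV_ident 1] 3(1)] 3(2)] 2]])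
       (use s in \<open>auto simp: algebra_simps\<close>)
  moreover have "(((x + r * (- e / (2 * r\<^sup>2 * a * b) * d)) * a * b
        + r * x * (p * v / (2 * a)) * b + r * x * a * (p * w / (2 * b))) * d
      - r * x * a * b * (p * x - p * k / (2 * r * a * b) * d)) / (d * d)
     = (r * x * a * b / d) / r - e / (2 * r) + (r * x * a * b / d) * p * (v / (2 * a\<^sup>2) + w / (2 * b\<^sup>2))
       + p * x / d * (k / 2 - (r * x * a * b / d))" if "0 < a" "0 < b" "0 < d" for x a b v w d
    using that r by (simp add: divide_simps power2_eq_square) (simp add: algebra_simps)
  ultimately show ?thesis using s by (simp only: e_def p_def k_def \<Theta>_def \<Theta>'_def)
qed

text \<open>While \<open>\<Theta> \<le> \<nu> / 2\<close>, the last summand of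
  \<open>\<Theta>'\<close> is at least \<open>(\<alpha> + 1) * lam / 2\<close>, because
  \<open>r powr \<alpha> * \<kappa> / D \<ge> (\<alpha> + 1) / r\<close>. By
  \<open>2 * \<beta> \<le> lam * r\<close> the negative summand costs at most half of this.\<close>

lemma Theta_growth:
  assumes r: "0 < r" "2 * \<beta> \<le> lam * r" and V: "0 \<le> V s1 K1 r" "0 \<le> V s2 K2 r" and \<Theta>: "\<Theta> r \<le> \<nu> / 2"
    and d: "(\<Theta> has_real_derivative d) (at r)"
  shows "lam / 4 \<le> d"
proof -
  define q where "q = r powr \<alpha> * \<kappa> r / D r"
  have "(\<alpha> + 1) / r \<le> q"
    using D_less_kappa[OF r(1)] D_pos[OF r(1)] r(1) by (simp add: q_def field_simps)
  hence "(\<alpha> + 1) / r * (lam * r / 2) \<le> q * (lam * r / 2)"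
    using r lam_nonneg by (intro mult_right_mono) auto
  also have "q * (lam * r / 2) \<le> q * ((\<nu> + lam * r) / 2 - \<Theta> r)"
    using \<Theta> kappa_pos[OF r(1)] D_pos[OF r(1)] by (intro mult_left_mono) (auto simp: q_def add_divide_distrib)
  finally have "(\<alpha> + 1) * lam / 2 \<le> q * ((\<nu> + lam * r) / 2 - \<Theta> r)" using r by simp
  moreover have "(\<beta> + \<alpha> * lam * r / 2) / (2 * r) \<le> lam / 4 + \<alpha> * lam / 4"
  proof -
    have "(\<beta> + \<alpha> * lam * r / 2) / (2 * r) = \<beta> / (2 * r) + \<alpha> * lam / 4" using r by (simp add: field_simps)
    moreover have "\<beta> / (2 * r) \<le> lam / 4" using r by (simp add: field_simps)
    ultimately show ?thesis by linarith
  qed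
  moreover have "0 \<le> \<Theta> r / r" "0 \<le> \<Theta> r * r powr \<alpha> * (V s1 K1 r / (2 * (s1 r)\<^sup>2) + V s2 K2 r / (2 * (s2 r)\<^sup>2))"
    using Theta_pos[OF r(1)] r V by auto
  moreover have "d = \<Theta> r / r - (\<beta> + \<alpha> * lam * r / 2) / (2 * r)
     + \<Theta> r * r powr \<alpha> * (V s1 K1 r / (2 * (s1 r)\<^sup>2) + V s2 K2 r / (2 * (s2 r)\<^sup>2))
     + q * ((\<nu> + lam * r) / 2 - \<Theta> r)"
    using DERIV_unique[OF d DERIV_Theta[OF r(1)]] by (simp only: q_def \<Theta>'_def)
  moreover have "(\<alpha> + 1) * lam / 2 = \<alpha> * lam / 2 + lam / 2" "0 \<le> \<alpha> * lam"
    using alpha_pos lam_nonneg by (auto simp: algebra_simps add_divide_distrib)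
  ultimately show ?thesis using lam_nonneg by linarith
qed

text \<open>Growth at the rate \<open>lam / 4\<close> over the length \<open>2 * \<nu> / lam\<close>
  lifts \<open>\<Theta>\<close> from a positive value above \<open>\<nu> / 2\<close>, unless it has
  been there before, and then it cannot fall back. The strict inequality comes from
  \<open>ln x < x - 1\<close> at \<open>x = s1 / s2\<close>.\<close>

lemma Phi_less_expanding:
  assumes lam: "0 < lam" and ra: "0 < ra" "2 * \<beta> \<le> lam * ra" and \<epsilon>: "\<epsilon> = ra + 2 * \<nu> / lam"
    and V: "\<And>r. ra \<le> r \<Longrightarrow> r \<le> \<epsilon> \<Longrightarrow> 0 \<le> V s1 K1 r \<and> 0 \<le> V s2 K2 r"
  shows "\<Phi> s1 K1 \<epsilon> < \<Phi> s2 K2 \<epsilon>"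
proof -
  have le: "ra \<le> \<epsilon>" "0 < \<epsilon>" using lam nu_pos ra by (auto simp: \<epsilon> add_pos_nonneg)
  have cont: "continuous_on S \<Theta>" if "S \<subseteq> {0<..}" for S
    by (rule continuous_on_DERIV[OF DERIV_Theta]) (use that in auto)
  have lamr: "2 * \<beta> \<le> lam * r" if "ra \<le> r" for r
  proof -
    have "lam * ra \<le> lam * r" using that lam by (intro mult_left_mono) auto
    thus ?thesis using ra(2) by linarith
  qed
  have "\<nu> / 2 \<le> \<Theta> \<epsilon>"
  proof (rule ccontr)
    assume neg: "\<not> \<nu> / 2 \<le> \<Theta> \<epsilon>"
    have below: "\<Theta> u < \<nu> / 2" if u: "ra \<le> u" "u \<le> \<epsilon>" for u
    proof (rule ccontr)
      assume "\<not> \<Theta> u < \<nu> / 2"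
      hence "\<nu> / 2 - \<Theta> \<epsilon> \<le> 0"
      proof (intro barrier_nonpos[OF u(2), of "\<lambda>r. \<nu> / 2 - \<Theta> r" 1 "\<lambda>r. - \<Theta>' r"])
        show "continuous_on {u..\<epsilon>} (\<lambda>r. \<nu> / 2 - \<Theta> r)" using u ra by (intro continuous_intros cont) auto
        fix r assume r: "u < r" "r < \<epsilon>"
        have r0: "0 < r" "ra \<le> r" using r u ra by auto
        show "((\<lambda>r. \<nu> / 2 - \<Theta> r) has_real_derivative - \<Theta>' r) (at r)"
          using DERIV_diff[OF DERIV_const DERIV_Theta[OF r0(1)], of "\<nu> / 2"] by simp
        assume "0 < \<nu> / 2 - \<Theta> r"
        hence "lam / 4 \<le> \<Theta>' r"
          using V[OF r0(2)] r lamr[OF r0(2)] by (intro Theta_growth[OF r0(1)] DERIV_Theta r0) auto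
        thus "- \<Theta>' r \<le> 0" using lam by linarith
      qed auto
      thus False using neg by simp
    qed
    have "(\<lambda>r. \<Theta> r - lam / 4 * r) ra \<le> (\<lambda>r. \<Theta> r - lam / 4 * r) \<epsilon>"
    proof (rule DERIV_nonneg_imp_nondecreasing[OF le(1), of "\<lambda>r. \<Theta> r - lam / 4 * r"])
      fix r assume r: "ra \<le> r" "r \<le> \<epsilon>"
      have r0: "0 < r" using r ra by simp
      obtain d where d: "(\<Theta> has_real_derivative d) (at r)" using DERIV_Theta[OF r0] by blast
      have "lam / 4 \<le> d" using below[OF r] V[OF r] by (intro Theta_growth[OF r0 lamr[OF r(1)] _ _ _ d]) auto
      moreover have "((\<lambda>r. \<Theta> r - lam / 4 * r) has_real_derivative d - lam / 4) (at r)"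
        by (rule DERIV_cong[OF DERIV_diff[OF d DERIV_cmult_Id]]) simp
      ultimately show "\<exists>y. ((\<lambda>r. \<Theta> r - lam / 4 * r) has_real_derivative y) (at r) \<and> 0 \<le> y" by force
    qed
    moreover have "lam / 4 * \<epsilon> = lam / 4 * ra + \<nu> / 2" using lam by (simp add: \<epsilon> field_simps)
    ultimately show False using neg Theta_pos[OF ra(1)] by simp
  qed
  hence \<Theta>: "\<nu> / \<epsilon> * D \<epsilon> \<le> 2 * s1 \<epsilon> * s2 \<epsilon> * \<kappa> \<epsilon>"
    using D_pos[OF le(2)] le(2) by (simp add: \<Theta>_def field_simps)
  have s: "0 < s1 \<epsilon>" "s1 \<epsilon> < s2 \<epsilon>" using sol_pos[OF sol1 le(2)] s_less[OF le(2)] by auto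
  define x where "x = s1 \<epsilon> / s2 \<epsilon>"
  have x: "0 < x" "x < 1" using s by (auto simp: x_def)
  have "ln x < x - 1" using ln_le_minus_one[OF x(1)] ln_eq_minus_one[OF x(1)] x by fastforce
  hence "1 - x < ln (s2 \<epsilon>) - ln (s1 \<epsilon>)" using s by (simp add: x_def ln_div)
  hence "s2 \<epsilon> * (1 - x) < s2 \<epsilon> * (ln (s2 \<epsilon>) - ln (s1 \<epsilon>))" using s by (intro mult_strict_left_mono) auto
  moreover have "s2 \<epsilon> * (1 - x) = D \<epsilon>" using s by (simp add: x_def D_def right_diff_distrib)
  ultimately have L: "lam * D \<epsilon> < lam * (s2 \<epsilon> * (ln (s2 \<epsilon>) - ln (s1 \<epsilon>)))" using lam by simp
  have "2 * s2 \<epsilon> * K2 \<epsilon> \<le> \<nu> / \<epsilon> + lam" using V[OF le(1)] by (simp add: V_def)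
  hence "D \<epsilon> * (2 * s2 \<epsilon> * K2 \<epsilon>) \<le> D \<epsilon> * (\<nu> / \<epsilon> + lam)" using D_pos[OF le(2)] by (intro mult_left_mono) auto
  moreover have "s2 \<epsilon> * (\<Phi> s2 K2 \<epsilon> - \<Phi> s1 K1 \<epsilon>) = 2 * s1 \<epsilon> * s2 \<epsilon> * \<kappa> \<epsilon> - D \<epsilon> * (2 * s2 \<epsilon> * K2 \<epsilon>)
      + lam * (s2 \<epsilon> * (ln (s2 \<epsilon>) - ln (s1 \<epsilon>)))"
    unfolding Phi_diff by (simp add: algebra_simps)
  moreover have "D \<epsilon> * (\<nu> / \<epsilon> + lam) = \<nu> / \<epsilon> * D \<epsilon> + lam * D \<epsilon>" by (simp add: algebra_simps)
  ultimately have "0 < s2 \<epsilon> * (\<Phi> s2 K2 \<epsilon> - \<Phi> s1 K1 \<epsilon>)" using \<Theta> L by linarith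
  thus ?thesis using s by (simp add: zero_less_mult_iff)
qed

end

context soliton begin

lemma V_nonneg_forward:
  assumes sol: "sol s K" and r: "0 < r" "r \<le> r'" and src: "0 \<le> \<gamma> + \<alpha> * lam * r / 2" and V: "0 \<le> V s K r"
  shows "0 \<le> V s K r'"
proof -
  have "- V s K r' \<le> 0"
  proof (rule linear_ode_nonpos[OF r(2), where z = "\<lambda>r. - V s K r" and p = "\<lambda>r. r powr \<alpha> * (V s K r - (\<nu> / r) - lam) / (2 * (s r)\<^sup>2)"])
    show "continuous_on {r..r'} (\<lambda>r. - V s K r)" using r by (intro continuous_intros V_cont[OF sol]) auto
    show "continuous_on {r..r'} (\<lambda>r. r powr \<alpha> * (V s K r - \<nu> / r - lam) / (2 * (s r)\<^sup>2))"
      by (rule V_coeff_cont[OF sol]) (use r in auto)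
    fix u assume u': "r < u" "u < r'"
    hence u: "0 < u" using r by simp
    show "((\<lambda>r. - V s K r) has_real_derivative - (u powr \<alpha> * V s K u * (V s K u - \<nu> / u - lam) / (2 * (s u)\<^sup>2) + \<gamma> / u\<^sup>2 + \<alpha> * lam / (2 * u))) (at u)"
      by (rule DERIV_minus[OF DERIV_V[OF sol u]])
    have "\<alpha> * lam * r / 2 \<le> \<alpha> * lam * u / 2" using u' alpha_pos lam_nonneg by (intro divide_right_mono mult_left_mono) auto
    hence "0 \<le> (\<gamma> + \<alpha> * lam * u / 2) / u\<^sup>2" using src by (intro divide_nonneg_nonneg) auto
    also have "\<dots> = \<gamma> / u\<^sup>2 + \<alpha> * lam / (2 * u)" using u by (simp add: field_simps power2_eq_square)
    finally show "- (u powr \<alpha> * V s K u * (V s K u - \<nu> / u - lam) / (2 * (s u)\<^sup>2) + \<gamma> / u\<^sup>2 + \<alpha> * lam / (2 * u))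
       \<le> u powr \<alpha> * (V s K u - \<nu> / u - lam) / (2 * (s u)\<^sup>2) * - V s K u"
      by (simp add: mult_ac)
  qed (use V in auto)
  thus ?thesis by simp
qed

text \<open>If \<open>V\<close> were negative somewhere in \<open>[ra, \<epsilon>]\<close>, it would
  be negative on \<open>[rs, ra]\<close>, so \<open>s\<close> would decrease there and end below a
  bound given by \<open>sb\<close>, independent of \<open>ra\<close>. On the rest \<open>V\<close>
  stays below \<open>C * L / ra\<close>, so \<open>(s \<epsilon>)\<^sup>2\<close> would be small
  compared with \<open>\<epsilon> powr \<alpha>\<close>. The level condition forbids this, because
  for \<open>lam > 0\<close> the logarithm in \<open>\<Phi>\<close> bounds
  \<open>(s \<epsilon>)\<^sup>2 / \<epsilon> powr \<alpha>\<close> from below.\<close>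

lemma V_nonneg_expanding:
  assumes lam: "0 < lam" and L: "0 \<le> L" and rs: "1 \<le> rs" "0 \<le> \<gamma> + \<alpha> * lam * rs / 2" "rs \<le> ra"
    and sb: "sol sb Kb" "Kb rs \<le> 0"
    and C: "C = \<bar>\<gamma>\<bar> + \<alpha> * lam / 2" and \<eta>: "C * L / ra < lam" and \<epsilon>: "\<epsilon> = ra + L"
    and gap: "((sb rs)\<^sup>2 + \<epsilon> powr \<alpha> * (C * L / ra) * L) < \<epsilon> powr \<alpha> * (c0 * exp (2 * (c1 - lam - \<bar>\<gamma>\<bar>) / lam))"
    and sol: "sol s K" "\<Phi> s K \<epsilon> = c1" and r: "ra \<le> r" "r \<le> \<epsilon>"
  shows "0 \<le> V s K r"
proof (rule ccontr)
  assume neg: "\<not> 0 \<le> V s K r"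
  have ra: "0 < ra" "1 \<le> ra" using rs by auto
  have \<epsilon>0: "0 < \<epsilon>" "1 \<le> \<epsilon>" using ra L \<epsilon> by auto
  have C0: "0 \<le> C" using C alpha_pos lam by simp
  have Vneg: "V s K u < 0" if u: "rs \<le> u" "u \<le> ra" for u
  proof (rule ccontr)
    assume "\<not> V s K u < 0"
    moreover have "\<alpha> * lam * rs \<le> \<alpha> * lam * u" using u alpha_pos lam by (intro mult_left_mono) auto
    hence "0 \<le> \<gamma> + \<alpha> * lam * u / 2" using rs(2) by linarith
    ultimately have "0 \<le> V s K r" using u r rs by (intro V_nonneg_forward[OF sol(1), of u r]) auto
    thus False using neg by simp
  qed
  have K: "0 < K rs"
  proof -
    have "0 \<le> \<nu> / rs + lam" using nu_pos rs lam by simp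
    moreover have "\<nu> / rs + lam - 2 * s rs * K rs < 0" using Vneg[of rs] rs by (simp add: V_def)
    ultimately have "0 < 2 * s rs * K rs" by linarith
    moreover have "0 < 2 * s rs" using sol_pos[OF sol(1), of rs] rs by simp
    ultimately show ?thesis by (rule zero_less_mult_pos)
  qed
  interpret soliton_ordered \<alpha> lam c0 s K sb Kb
    by (rule soliton_orderedI[OF sol(1) sb(1), of rs]) (use K sb rs in auto)
  have "(s ra)\<^sup>2 \<le> (s rs)\<^sup>2"
  proof (rule DERIV_nonpos_imp_nonincreasing[OF rs(3), of "\<lambda>u. (s u)\<^sup>2"])
    fix u assume u: "rs \<le> u" "u \<le> ra"
    hence "0 < u" using rs by simp
    thus "\<exists>y. ((\<lambda>u. (s u)\<^sup>2) has_real_derivative y) (at u) \<and> y \<le> 0"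
      using DERIV_sq[OF sol(1), of u] Vneg[OF u] by (intro exI[of _ "u powr \<alpha> * V s K u"]) (auto simp: mult_nonneg_nonpos)
  qed
  also have "\<dots> \<le> (sb rs)\<^sup>2" using s_less[of rs] sol_pos[OF sol(1), of rs] rs by (intro power_mono) auto
  finally have W: "(s ra)\<^sup>2 \<le> (sb rs)\<^sup>2" .
  \<comment> \<open>While \<open>0 < V < lam\<close> the quadratic term of \<open>V'\<close> is
    nonpositive and only the source, at most \<open>C / ra\<close>, can raise \<open>V\<close>. The
    assumption on \<open>C * L / ra\<close> keeps \<open>V\<close> in this range.\<close>
  have Vle: "V s K u \<le> C * L / ra" if u: "ra \<le> u" "u \<le> \<epsilon>" for u
  proof -
    have "V s K u - C / ra * (u - ra) \<le> 0"
    proof (rule barrier_nonpos[OF u(1), where z = "\<lambda>u. V s K u - C / ra * (u - ra)" and \<eta> = "lam - C * L / ra"])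
      show "continuous_on {ra..u} (\<lambda>u. V s K u - C / ra * (u - ra))"
        using ra by (intro continuous_intros V_cont[OF sol(1)]) auto
      show "V s K ra - C / ra * (ra - ra) \<le> 0" using Vneg[of ra] rs by simp
      show "0 < lam - C * L / ra" using \<eta> by simp
      fix v assume v: "ra < v" "v < u"
      have v0: "0 < v" using v ra by simp
      show "((\<lambda>u. V s K u - C / ra * (u - ra)) has_real_derivative
          (v powr \<alpha> * V s K v * (V s K v - \<nu> / v - lam) / (2 * (s v)\<^sup>2) + \<gamma> / v\<^sup>2 + \<alpha> * lam / (2 * v)) - C / ra) (at v)"
        using ra by (auto intro!: derivative_eq_intros DERIV_V[OF sol(1) v0])
      assume z: "0 < V s K v - C / ra * (v - ra)" "V s K v - C / ra * (v - ra) < lam - C * L / ra"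
      have "0 \<le> C / ra * (v - ra)" using C0 ra v by simp
      hence Vp: "0 < V s K v" using z by linarith
      have "C / ra * (v - ra) \<le> C / ra * L" using C0 ra v u \<epsilon> by (intro mult_left_mono) auto
      hence Vl: "V s K v < lam" using z(2) by simp
      have "V s K v - \<nu> / v - lam \<le> 0" using Vl nu_pos v0 by (smt (verit) divide_pos_pos)
      hence "v powr \<alpha> * V s K v * (V s K v - \<nu> / v - lam) \<le> 0" using Vp by (intro mult_nonneg_nonpos) auto
      hence "v powr \<alpha> * V s K v * (V s K v - \<nu> / v - lam) / (2 * (s v)\<^sup>2) \<le> 0" by (intro divide_nonpos_nonneg) auto
      moreover have "\<gamma> / v\<^sup>2 + \<alpha> * lam / (2 * v) \<le> C / ra"
      proof -
        have "\<gamma> / v\<^sup>2 \<le> \<bar>\<gamma>\<bar> / v\<^sup>2" by (intro divide_right_mono) auto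
        also have "\<dots> \<le> \<bar>\<gamma>\<bar> / ra"
        proof (rule divide_left_mono)
          have "ra * 1 \<le> v * v" using v ra by (intro mult_mono) auto
          thus "ra \<le> v\<^sup>2" by (simp add: power2_eq_square)
        qed (use ra v0 in auto)
        finally have "\<gamma> / v\<^sup>2 \<le> \<bar>\<gamma>\<bar> / ra" .
        moreover have "\<alpha> * lam / (2 * v) \<le> \<alpha> * lam / (2 * ra)" using v ra alpha_pos lam by (intro divide_left_mono) auto
        moreover have "C / ra = \<bar>\<gamma>\<bar> / ra + \<alpha> * lam / (2 * ra)" by (simp add: C add_divide_distrib)
        ultimately show ?thesis by linarith
      qed
      ultimately show "(v powr \<alpha> * V s K v * (V s K v - \<nu> / v - lam) / (2 * (s v)\<^sup>2) + \<gamma> / v\<^sup>2 + \<alpha> * lam / (2 * v)) - C / ra \<le> 0"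
        by linarith
    qed
    moreover have "C / ra * (u - ra) \<le> C / ra * L" using C0 ra u \<epsilon> by (intro mult_left_mono) auto
    ultimately show ?thesis by simp
  qed
  define M where "M = \<epsilon> powr \<alpha> * (C * L / ra)"
  have "(s \<epsilon>)\<^sup>2 - M * \<epsilon> \<le> (s ra)\<^sup>2 - M * ra"
  proof (rule DERIV_nonpos_imp_nonincreasing[of ra \<epsilon> "\<lambda>u. (s u)\<^sup>2 - M * u"])
    show "ra \<le> \<epsilon>" using \<epsilon> L by simp
    fix u assume u: "ra \<le> u" "u \<le> \<epsilon>"
    have u0: "0 < u" using u ra by simp
    have "u powr \<alpha> * V s K u \<le> u powr \<alpha> * (C * L / ra)" using Vle[OF u] by (intro mult_left_mono) auto
    also have "\<dots> \<le> M" unfolding M_def using u u0 alpha_pos C0 L ra by (intro mult_right_mono powr_mono2) auto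
    finally have "u powr \<alpha> * V s K u - M \<le> 0" by simp
    moreover have "((\<lambda>u. (s u)\<^sup>2 - M * u) has_real_derivative u powr \<alpha> * V s K u - M) (at u)"
      by (rule DERIV_cong[OF DERIV_diff[OF DERIV_sq[OF sol(1) u0] DERIV_cmult_Id]]) simp
    ultimately show "\<exists>y. ((\<lambda>u. (s u)\<^sup>2 - M * u) has_real_derivative y) (at u) \<and> y \<le> 0" by blast
  qed
  hence "(s \<epsilon>)\<^sup>2 \<le> (s ra)\<^sup>2 + M * L" by (simp add: \<epsilon> algebra_simps)
  hence upper: "(s \<epsilon>)\<^sup>2 < \<epsilon> powr \<alpha> * (c0 * exp (2 * (c1 - lam - \<bar>\<gamma>\<bar>) / lam))" using W gap unfolding M_def by linarith
  have "\<gamma> / \<epsilon> \<le> \<bar>\<gamma>\<bar>"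
  proof -
    have "\<gamma> / \<epsilon> \<le> \<bar>\<gamma>\<bar> / \<epsilon>" using \<epsilon>0 by (intro divide_right_mono) auto
    also have "\<dots> \<le> \<bar>\<gamma>\<bar> / 1" using \<epsilon>0 by (intro divide_left_mono) auto
    finally show ?thesis by simp
  qed
  moreover have "V s K \<epsilon> \<le> lam" using Vle[of \<epsilon>] \<eta> \<epsilon> L by simp
  ultimately have "c1 - lam - \<bar>\<gamma>\<bar> \<le> lam * ln (s \<epsilon>) - lam / 2 * ln c0 - \<alpha> * lam / 2 * ln \<epsilon>"
    using sol(2) by (simp add: \<Phi>_def)
  hence "2 * (c1 - lam - \<bar>\<gamma>\<bar>) / lam \<le> 2 * (lam * ln (s \<epsilon>) - lam / 2 * ln c0 - \<alpha> * lam / 2 * ln \<epsilon>) / lam"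
    using lam by (intro divide_right_mono mult_left_mono) auto
  also have "\<dots> = 2 * ln (s \<epsilon>) - ln c0 - \<alpha> * ln \<epsilon>" using lam by (simp add: field_simps)
  finally have "exp (2 * (c1 - lam - \<bar>\<gamma>\<bar>) / lam) \<le> exp (2 * ln (s \<epsilon>) - ln c0 - \<alpha> * ln \<epsilon>)" by simp
  also have "\<dots> = (s \<epsilon>)\<^sup>2 / (c0 * \<epsilon> powr \<alpha>)"
    using sol_pos[OF sol(1) \<epsilon>0(1)] c0_pos \<epsilon>0
    by (simp add: exp_diff powr_def exp_double)
  finally have "\<epsilon> powr \<alpha> * (c0 * exp (2 * (c1 - lam - \<bar>\<gamma>\<bar>) / lam)) \<le> (s \<epsilon>)\<^sup>2"
    using c0_pos \<epsilon>0 by (simp add: field_simps)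
  thus False using upper by simp
qed

section \<open>Values of the level function in both directions\<close>

lemma ex_Phi_large:
  assumes "0 < \<epsilon>"
  shows "\<exists>s K. sol s K \<and> y \<le> \<Phi> s K \<epsilon>"
proof -
  obtain s0 K0 where ref: "sol s0 K0" by (rule ex_sol)
  have s0: "0 < s0 \<epsilon>" using sol_pos[OF ref assms] .
  define c where "c = \<beta> / \<epsilon> + lam + lam * ln (s0 \<epsilon>) - lam / 2 * ln c0 - \<alpha> * lam / 2 * ln \<epsilon>"
  obtain s K where s: "sol s K" "\<And>u. 0 < u \<Longrightarrow> s0 u < s u" "K \<epsilon> \<le> - (\<bar>y - c\<bar> / (2 * s0 \<epsilon>))"
    using sol_growth[OF ref assms] by blast
  have "2 * s0 \<epsilon> * (\<bar>y - c\<bar> / (2 * s0 \<epsilon>)) \<le> 2 * s \<epsilon> * - K \<epsilon>"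
    using s(2)[OF assms] s(3) s0 by (intro mult_mono) auto
  hence "\<bar>y - c\<bar> \<le> - (2 * s \<epsilon> * K \<epsilon>)" using s0 by simp
  moreover have "lam * ln (s0 \<epsilon>) \<le> lam * ln (s \<epsilon>)"
    using s(2)[OF assms] s0 lam_nonneg by (intro mult_left_mono) auto
  ultimately have "y \<le> \<Phi> s K \<epsilon>" unfolding Phi_eq c_def by linarith
  thus ?thesis using s by blast
qed

text \<open>A large \<open>N\<close> at \<open>\<epsilon> / 2\<close> persists by monotonicity, and
  as \<open>s\<close> is bounded by \<open>S\<close>, it makes \<open>K\<close> large on
  \<open>[\<epsilon> / 2, \<epsilon>]\<close>. As long as \<open>s \<ge> \<delta>\<close>, the slope
  is at most \<open>- 2 * S / \<epsilon>\<close>, which would use up all of \<open>S\<close> on this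
  interval. So \<open>s\<close> reaches \<open>\<delta>\<close>, and the same slope prevents a
  return above \<open>\<delta>\<close>.\<close>

lemma ex_sol_small:
  assumes \<epsilon>: "0 < \<epsilon>" and \<delta>: "0 < \<delta>"
  shows "\<exists>s K. sol s K \<and> s \<epsilon> \<le> \<delta> \<and> 0 < K \<epsilon>"
proof -
  obtain s0 K0 where ref: "sol s0 K0" by (rule ex_sol)
  have "continuous_on {\<epsilon>/2..\<epsilon>} s0" by (rule sol_cont[OF ref]) (use \<epsilon> in auto)
  then obtain v where v: "v \<in> {\<epsilon>/2..\<epsilon>}" "\<And>u. u \<in> {\<epsilon>/2..\<epsilon>} \<Longrightarrow> s0 u \<le> s0 v"
    using continuous_attains_sup[of "{\<epsilon>/2..\<epsilon>}" s0] \<epsilon> by auto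
  define S where "S = s0 v"
  have S: "0 < S" using sol_pos[OF ref, of v] v \<epsilon> by (simp add: S_def)
  \<comment> \<open>A bound for the part of the slope without \<open>K\<close> while
    \<open>s \<ge> \<delta>\<close>. In \<open>M\<close> the summand \<open>\<epsilon> * P\<close>
    outweighs it, and \<open>2 * S\<close> yields the required slope.\<close>
  define P where "P = \<epsilon> powr \<alpha> * (2 * \<nu> / \<epsilon> + lam) / (2 * \<delta>)"
  have P: "0 \<le> P" using \<epsilon> \<delta> nu_pos lam_nonneg by (simp add: P_def)
  define M where "M = (\<alpha> + 1) * S + 2 * S + \<epsilon> * P"
  have e2: "0 < \<epsilon> / 2" using \<epsilon> by simp
  obtain s K where s: "sol s K" "\<And>u. 0 < u \<Longrightarrow> s u < s0 u" "M \<le> N s K (\<epsilon> / 2)"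
    using sol_crash[OF ref e2] by blast
  have sS: "s u < S" if "\<epsilon> / 2 \<le> u" "u \<le> \<epsilon>" for u
    using s(2)[of u] v(2)[of u] that \<epsilon> by (simp add: S_def)
  have rK: "2 * S + \<epsilon> * P \<le> u * u powr \<alpha> * K u" if u: "\<epsilon> / 2 \<le> u" "u \<le> \<epsilon>" for u
  proof -
    have "M \<le> N s K u" using s(3) N_mono[OF s(1) e2 u(1)] by simp
    moreover have "(\<alpha> + 1) * s u \<le> (\<alpha> + 1) * S" using sS[OF u] alpha_pos by (intro mult_left_mono) auto
    ultimately show ?thesis by (simp add: N_def M_def)
  qed
  have K_pos: "0 < K \<epsilon>"
  proof -
    have "0 < \<epsilon> * \<epsilon> powr \<alpha> * K \<epsilon>" using rK[of \<epsilon>] S P \<epsilon> by (intro less_le_trans[OF _ rK[of \<epsilon>]] add_pos_nonneg) auto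
    thus ?thesis using zero_less_mult_pos[of "\<epsilon> * \<epsilon> powr \<alpha>" "K \<epsilon>"] \<epsilon> by simp
  qed
  have slope: "u powr \<alpha> * V s K u / (2 * s u) \<le> - (2 * S / \<epsilon>)" if u: "\<epsilon> / 2 \<le> u" "u \<le> \<epsilon>" "\<delta> \<le> s u" for u
  proof -
    have u0: "0 < u" using u \<epsilon> by simp
    have "u powr \<alpha> * V s K u / (2 * s u) = u powr \<alpha> * (\<nu> / u + lam) / (2 * s u) - u powr \<alpha> * K u"
      using sol_pos[OF s(1) u0] by (simp add: V_def field_simps)
    also have "u powr \<alpha> * (\<nu> / u + lam) / (2 * s u) \<le> P"
      unfolding P_def
    proof (rule frac_le)
      have "\<nu> / u \<le> \<nu> / (\<epsilon> / 2)" using u \<epsilon> nu_pos by (intro divide_left_mono) auto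
      hence "\<nu> / u \<le> 2 * \<nu> / \<epsilon>" by (simp only: divide_divide_eq_right mult.commute)
      thus "u powr \<alpha> * (\<nu> / u + lam) \<le> \<epsilon> powr \<alpha> * (2 * \<nu> / \<epsilon> + lam)"
        using u u0 alpha_pos nu_pos lam_nonneg by (intro mult_mono powr_mono2) auto
    qed (use u \<delta> \<epsilon> nu_pos lam_nonneg in auto)
    finally have "u powr \<alpha> * V s K u / (2 * s u) \<le> P - u powr \<alpha> * K u" by simp
    moreover have "(2 * S + \<epsilon> * P) / \<epsilon> \<le> u powr \<alpha> * K u"
    proof -
      have "(2 * S + \<epsilon> * P) / \<epsilon> \<le> (2 * S + \<epsilon> * P) / u" using u u0 \<epsilon> S P by (intro divide_left_mono) auto
      also have "\<dots> \<le> u powr \<alpha> * K u" using rK[OF u(1,2)] u0 by (simp add: pos_divide_le_eq mult_ac)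
      finally show ?thesis .
    qed
    hence "P + 2 * S / \<epsilon> \<le> u powr \<alpha> * K u" using \<epsilon> by (simp add: add_divide_distrib)
    ultimately show ?thesis by simp
  qed
  have "\<exists>u0\<in>{\<epsilon>/2..\<epsilon>}. s u0 \<le> \<delta>"
  proof (rule ccontr)
    assume "\<not> ?thesis"
    hence big: "\<delta> < s u" if "\<epsilon> / 2 \<le> u" "u \<le> \<epsilon>" for u using that by force
    have "(\<lambda>u. s u + 2 * S / \<epsilon> * u) \<epsilon> \<le> (\<lambda>u. s u + 2 * S / \<epsilon> * u) (\<epsilon> / 2)"
    proof (rule DERIV_nonpos_imp_nonincreasing[of "\<epsilon>/2" \<epsilon> "\<lambda>u. s u + 2 * S / \<epsilon> * u"])
      fix u assume u: "\<epsilon> / 2 \<le> u" "u \<le> \<epsilon>"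
      have u0: "0 < u" using u \<epsilon> by simp
      have "((\<lambda>u. s u + 2 * S / \<epsilon> * u) has_real_derivative u powr \<alpha> * V s K u / (2 * s u) + 2 * S / \<epsilon>) (at u)"
        by (rule DERIV_cong[OF DERIV_add[OF sol_DERIV_s[OF s(1) u0] DERIV_cmult_Id]]) simp
      moreover have "u powr \<alpha> * V s K u / (2 * s u) + 2 * S / \<epsilon> \<le> 0" using slope[OF u] big[OF u] by simp
      ultimately show "\<exists>y. ((\<lambda>u. s u + 2 * S / \<epsilon> * u) has_real_derivative y) (at u) \<and> y \<le> 0" by blast
    qed (use \<epsilon> in simp)
    moreover have "2 * S / \<epsilon> * \<epsilon> = 2 * S" "2 * S / \<epsilon> * (\<epsilon> / 2) = S" using \<epsilon> by simp_all
    ultimately have "s \<epsilon> + S \<le> s (\<epsilon> / 2)" by simp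
    thus False using sS[of "\<epsilon> / 2"] sol_pos[OF s(1) \<epsilon>] \<epsilon> by simp
  qed
  then obtain u0 where u0: "\<epsilon> / 2 \<le> u0" "u0 \<le> \<epsilon>" "s u0 \<le> \<delta>" by auto
  have "s \<epsilon> - \<delta> \<le> 0"
  proof (rule barrier_nonpos[OF u0(2), where z = "\<lambda>u. s u - \<delta>" and \<eta> = 1])
    show "continuous_on {u0..\<epsilon>} (\<lambda>u. s u - \<delta>)" using u0 \<epsilon> by (intro continuous_intros sol_cont[OF s(1)]) auto
    fix u assume u: "u0 < u" "u < \<epsilon>"
    have "0 < u" using u u0 \<epsilon> by simp
    thus "((\<lambda>u. s u - \<delta>) has_real_derivative u powr \<alpha> * V s K u / (2 * s u)) (at u)"
      using DERIV_diff[OF sol_DERIV_s[OF s(1)] DERIV_const, of u \<delta>] by simp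
    assume "0 < s u - \<delta>"
    moreover have "0 \<le> 2 * S / \<epsilon>" using S \<epsilon> by simp
    ultimately show "u powr \<alpha> * V s K u / (2 * s u) \<le> 0" using slope[of u] u u0 by simp
  qed (use u0 in auto)
  thus ?thesis using s(1) K_pos by auto
qed

text \<open>For \<open>lam > 0\<close> the term \<open>lam * ln (s \<epsilon>)\<close> is unbounded
  below along solutions with small \<open>s \<epsilon>\<close>, and \<open>K \<epsilon> > 0\<close>
  only helps.\<close>

lemma ex_Phi_small:
  assumes "0 < lam" "0 < \<epsilon>"
  shows "\<exists>s K. sol s K \<and> \<Phi> s K \<epsilon> \<le> y"
proof -
  define c where "c = (y - \<beta> / \<epsilon> - lam + lam / 2 * ln c0 + \<alpha> * lam / 2 * ln \<epsilon>) / lam"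
  obtain s K where s: "sol s K" "s \<epsilon> \<le> exp c" "0 < K \<epsilon>" using ex_sol_small[OF assms(2), of "exp c"] by auto
  have p: "0 < s \<epsilon>" using sol_pos[OF s(1) assms(2)] .
  have "ln (s \<epsilon>) \<le> c" using s(2) p by (metis ln_exp ln_le_cancel_iff exp_gt_zero)
  hence "lam * ln (s \<epsilon>) \<le> lam * c" using assms(1) by (intro mult_left_mono) auto
  moreover have "lam * c = y - \<beta> / \<epsilon> - lam + lam / 2 * ln c0 + \<alpha> * lam / 2 * ln \<epsilon>" using assms(1) by (simp add: c_def)
  moreover have "0 < 2 * s \<epsilon> * K \<epsilon>" using p s(3) by simp
  ultimately have "\<Phi> s K \<epsilon> \<le> y" unfolding Phi_eq by linarith
  thus ?thesis using s(1) by blast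
qed

lemma well_posed_expanding:
  assumes lam: "0 < lam"
  shows "\<exists>\<epsilon>>0. well_posed c1 \<epsilon>"
proof -
  define L where "L = 2 * \<nu> / lam"
  define C where "C = \<bar>\<gamma>\<bar> + \<alpha> * lam / 2"
  \<comment> \<open>From \<open>rs\<close> on the source of \<open>V'\<close> is nonnegative, even
    if \<open>\<gamma> < 0\<close>.\<close>
  define rs where "rs = max 1 (2 * \<bar>\<gamma>\<bar> / (\<alpha> * lam))"
  have rs: "1 \<le> rs" "0 \<le> \<gamma> + \<alpha> * lam * rs / 2"
  proof -
    have "2 * \<bar>\<gamma>\<bar> / (\<alpha> * lam) \<le> rs" by (simp add: rs_def)
    hence "\<bar>\<gamma>\<bar> \<le> \<alpha> * lam * rs / 2" using alpha_pos lam by (simp add: field_simps)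
    thus "0 \<le> \<gamma> + \<alpha> * lam * rs / 2" by linarith
  qed (simp add: rs_def)
  obtain s0 K0 where ref: "sol s0 K0" by (rule ex_sol)
  have "0 < rs" using rs by simp
  then obtain sb Kb where sb: "sol sb Kb" "Kb rs \<le> - 0" using sol_growth[OF ref] by blast
  define \<Gamma> where "\<Gamma> = c0 * exp (2 * (c1 - lam - \<bar>\<gamma>\<bar>) / lam)"
  have \<Gamma>: "0 < \<Gamma>" using c0_pos by (simp add: \<Gamma>_def)
  have lim1: "((\<lambda>ra. C * L / ra) \<longlongrightarrow> 0) at_top" by real_asymp
  \<comment> \<open>The upper bound for \<open>(s \<epsilon>)\<^sup>2\<close>, divided by
    \<open>\<epsilon> powr \<alpha>\<close>, tends to \<open>0\<close>, while the lower bound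
    \<open>\<Gamma>\<close> is fixed. \<open>L\<close> is fixed as well, so \<open>ra\<close> can be
    taken large enough.\<close>
  have lim2: "((\<lambda>ra. (sb rs)\<^sup>2 * (ra + L) powr (- \<alpha>) + C * L / ra * L) \<longlongrightarrow> (sb rs)\<^sup>2 * 0 + 0 * L) at_top"
  proof (intro tendsto_intros lim1)
    show "((\<lambda>ra. (ra + L) powr (- \<alpha>)) \<longlongrightarrow> 0) at_top" using alpha_pos by real_asymp
  qed
  have "\<forall>\<^sub>F ra in at_top. C * L / ra < lam" using order_tendstoD(2)[OF lim1 lam] .
  moreover have "\<forall>\<^sub>F ra in at_top. (sb rs)\<^sup>2 * (ra + L) powr (- \<alpha>) + C * L / ra * L < \<Gamma>"
    using order_tendstoD(2)[OF lim2, of \<Gamma>] \<Gamma> by simp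
  moreover have "\<forall>\<^sub>F ra in at_top. max rs (2 * \<beta> / lam) \<le> ra" by (rule eventually_ge_at_top)
  ultimately have "\<forall>\<^sub>F ra in at_top. C * L / ra < lam \<and> (sb rs)\<^sup>2 * (ra + L) powr (- \<alpha>) + C * L / ra * L < \<Gamma> \<and> max rs (2 * \<beta> / lam) \<le> ra"
    by (intro eventually_conj)
  then obtain ra where ra: "C * L / ra < lam" "(sb rs)\<^sup>2 * (ra + L) powr (- \<alpha>) + C * L / ra * L < \<Gamma>" "max rs (2 * \<beta> / lam) \<le> ra"
    using eventually_happens[of _ at_top] trivial_limit_at_top_linorder by blast
  define \<epsilon> where "\<epsilon> = ra + L"
  have L: "0 \<le> L" using nu_pos lam by (simp add: L_def)
  have ra0: "0 < ra" "rs \<le> ra" "2 * \<beta> \<le> lam * ra" using ra(3) rs lam by (auto simp: field_simps)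
  have \<epsilon>: "0 < \<epsilon>" using ra0 L by (simp add: \<epsilon>_def)
  have gap: "(sb rs)\<^sup>2 + \<epsilon> powr \<alpha> * (C * L / ra) * L < \<epsilon> powr \<alpha> * (c0 * exp (2 * (c1 - lam - \<bar>\<gamma>\<bar>) / lam))"
  proof -
    have "\<epsilon> powr \<alpha> * ((sb rs)\<^sup>2 * \<epsilon> powr (- \<alpha>) + C * L / ra * L) < \<epsilon> powr \<alpha> * \<Gamma>"
      using ra(2) \<epsilon> by (simp add: \<epsilon>_def)
    moreover have "\<epsilon> powr \<alpha> * ((sb rs)\<^sup>2 * \<epsilon> powr (- \<alpha>) + C * L / ra * L) = (\<epsilon> powr \<alpha> * \<epsilon> powr (- \<alpha>)) * (sb rs)\<^sup>2 + \<epsilon> powr \<alpha> * (C * L / ra) * L"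
      by (simp add: algebra_simps)
    moreover have "\<epsilon> powr \<alpha> * \<epsilon> powr (- \<alpha>) = 1" using \<epsilon> by (simp flip: powr_add)
    ultimately show ?thesis by (simp add: \<Gamma>_def)
  qed
  have Vnn: "0 \<le> V s K r" if "sol s K" "\<Phi> s K \<epsilon> = c1" "ra \<le> r" "r \<le> \<epsilon>" for s K r
    using V_nonneg_expanding[OF lam L rs ra0(2) sb(1) _ C_def ra(1) \<epsilon>_def gap that] sb(2) by simp
  have "\<exists>s K. sol s K \<and> \<Phi> s K \<epsilon> = c1"
    using ex_Phi_small[OF lam \<epsilon>, of c1] ex_Phi_large[OF \<epsilon>, of c1] Phi_intermediate[OF _ _ \<epsilon>] by blast
  moreover have "\<Phi> s2 K2 \<epsilon> \<noteq> c1" if ord: "soliton_ordered \<alpha> lam c0 s1 K1 s2 K2" and P1: "\<Phi> s1 K1 \<epsilon> = c1" for s1 K1 s2 K2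
  proof
    interpret soliton_ordered \<alpha> lam c0 s1 K1 s2 K2 by (rule ord)
    assume P2: "\<Phi> s2 K2 \<epsilon> = c1"
    have "\<Phi> s1 K1 \<epsilon> < \<Phi> s2 K2 \<epsilon>"
      by (rule Phi_less_expanding[OF lam ra0(1,3)]) (use \<epsilon>_def L_def Vnn sol1 sol2 P1 P2 in auto)
    thus False using P1 P2 by simp
  qed
  ultimately show ?thesis using \<epsilon> unfolding well_posed_def by blast
qed

end

section \<open>Steady solitons: the fold\<close>

text \<open>Two points of the graph of \<open>Y\<close> over \<open>w\<close> span a line \<open>A + q w\<close> with \<open>q \<ge> 0\<close> and \<open>A < 0\<close>. On this line
  \<open>Y (Y - d) / w\<close> equals \<open>A (A - d) / w\<close> up to an affine function of \<open>w\<close>, hence is strictly convex.\<close>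
lemma chord_inequality:
  fixes w1 w2 w3 Y1 Y2 Y3 d :: real
  assumes w: "0 < w1" "w1 < w3" "w3 < w2" and Y: "Y1 < 0" "Y2 < 0" "Y1 \<le> Y2" "Y3 < d" and d: "0 < d"
    and above: "0 \<le> (w2 - w1) * Y3 - (w2 - w3) * Y1 - (w3 - w1) * Y2"
  shows "(w2 - w1) * ((Y3 - d) * Y3 / w3) - (w2 - w3) * ((Y1 - d) * Y1 / w1) - (w3 - w1) * ((Y2 - d) * Y2 / w2) < 0"
proof -
  define q where "q = (Y2 - Y1) / (w2 - w1)"
  define A where "A = Y1 - q * w1"
  define Yc where "Yc = A + q * w3"
  have q: "0 \<le> q" "q * (w2 - w1) = Y2 - Y1" using w Y by (auto simp: q_def)
  have A: "A < 0" using q w Y by (smt (verit) A_def mult_nonneg_nonneg)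
  have Y12: "Y1 = A + q * w1" "Y2 = A + q * w2" using q by (auto simp: A_def algebra_simps)
  have "q * w3 \<le> q * w2" using q w by (intro mult_left_mono) auto
  hence Yc: "Yc < 0" using Y12 Y by (simp add: Yc_def)
  have "(w2 - w1) * Yc = (w2 - w3) * Y1 + (w3 - w1) * Y2" unfolding Yc_def Y12 by (simp add: algebra_simps)
  hence "0 \<le> (w2 - w1) * (Y3 - Yc)" using above by (simp add: algebra_simps)
  hence z: "0 \<le> Y3 - Yc" using w by (simp add: zero_le_mult_iff)
  have "(Y3 - d) * Y3 - (Yc - d) * Yc = (Y3 - Yc) * ((Y3 - d) + Yc)" by (simp add: algebra_simps)
  also have "\<dots> \<le> 0" using z Yc Y(4) by (intro mult_nonneg_nonpos) auto
  finally have "(Y3 - d) * Y3 / w3 \<le> (Yc - d) * Yc / w3" using w by (intro divide_right_mono) auto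
  hence "(w2 - w1) * ((Y3 - d) * Y3 / w3) \<le> (w2 - w1) * ((Yc - d) * Yc / w3)" using w by (intro mult_left_mono) auto
  moreover have "(w2 - w1) * ((Yc - d) * Yc / w3) - (w2 - w3) * ((Y1 - d) * Y1 / w1) - (w3 - w1) * ((Y2 - d) * Y2 / w2)
      = - (A * (A - d) * ((w2 - w1) * (w3 - w1) * (w2 - w3) / (w1 * w2 * w3)))"
    unfolding Yc_def Y12 using w by (simp add: divide_simps) (simp add: algebra_simps)
  moreover have "0 < A * (A - d) * ((w2 - w1) * (w3 - w1) * (w2 - w3) / (w1 * w2 * w3))"
    using A d w by (intro mult_pos_pos mult_neg_neg divide_pos_pos) auto
  ultimately show ?thesis by linarith
qed

text \<open>The last assumption, with the other two, makes \<open>c1\<close> lie strictly below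
  \<open>\<gamma> / r\<close> for every \<open>r > 0\<close>. Hence \<open>\<Phi> \<le> c1\<close>
  implies \<open>V < 0\<close>, so \<open>w\<close> decreases.\<close>

locale soliton_fold = soliton +
  fixes c1 :: real
  assumes lam0: "lam = 0" and c1: "c1 \<le> 0" and alpha: "1 < \<alpha> \<or> \<alpha> = 1 \<and> c1 < 0"
begin

lemma gamma_nonneg: "0 \<le> \<gamma>" and alpha_ge1: "1 \<le> \<alpha>" and nu_le_beta: "\<nu> \<le> \<beta>" and gamma_or: "0 < \<gamma> \<or> c1 < 0"
proof -
  show 1: "0 \<le> \<gamma>" "1 \<le> \<alpha>" "0 < \<gamma> \<or> c1 < 0" using alpha nu_pos by (auto simp: \<gamma>_def)
  show "\<nu> \<le> \<beta>" using 1 beta_gamma by simp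
qed

lemma level_neg: "0 < r \<Longrightarrow> c1 - \<gamma> / r < 0"
  using gamma_or gamma_nonneg c1 by (smt (verit) divide_nonneg_pos divide_pos_pos)

lemma Phi0: "\<Phi> s K r = \<beta> / r - 2 * s r * K r" "V s K r = \<Phi> s K r - \<gamma> / r" "V s K r - \<nu> / r = - (2 * s r * K r)"
  unfolding Phi_eq unfolding V_def beta_gamma using lam0 by (simp_all add: add_divide_distrib)

lemma below_level:
  assumes "0 < r" "\<Phi> s K r \<le> c1"
  shows "V s K r < 0" "V s K r - \<nu> / r < 0"
proof -
  show 1: "V s K r < 0" using level_neg[OF assms(1)] assms(2) by (simp add: Phi0(2))
  have "0 < \<nu> / r" using nu_pos assms(1) by simp
  with 1 show "V s K r - \<nu> / r < 0" by linarith
qed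

lemma Phi_slope_pos:
  assumes "sol s K" "0 < r" "\<Phi> s K r \<le> c1"
  shows "0 < r powr \<alpha> * V s K r * (V s K r - \<nu> / r) / (2 * (s r)\<^sup>2)"
  using below_level[OF assms(2,3)] sol_pos[OF assms(1,2)] assms(2)
  by (intro divide_pos_pos[OF mult_neg_neg[OF mult_pos_neg]]) auto

text \<open>\<open>\<Phi>\<close> is strictly increasing wherever it is at most \<open>c1\<close>,
  so a crossing from above to below the level is impossible.\<close>

lemma Phi_below_before:
  assumes sol: "sol s K" and r: "0 < r" "r < r1" and le: "\<Phi> s K r1 \<le> c1"
  shows "\<Phi> s K r < c1"
proof (rule ccontr)
  assume neg: "\<not> \<Phi> s K r < c1"
  have r1: "0 < r1" using r by simp
  obtain d where d: "0 < d" "\<And>h. 0 < h \<Longrightarrow> h < d \<Longrightarrow> \<Phi> s K (r1 - h) < \<Phi> s K r1"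
    using DERIV_pos_inc_left[OF DERIV_Phi[OF sol r1] Phi_slope_pos[OF sol r1 le]] by blast
  define h where "h = min (d / 2) ((r1 - r) / 2)"
  have h: "0 < h" "h < d" "r < r1 - h" using d r by (auto simp: h_def min_def field_simps)
  have "c1 - \<Phi> s K (r1 - h) \<le> 0"
  proof (rule barrier_nonpos[of r "r1 - h" "\<lambda>u. c1 - \<Phi> s K u" 1 "\<lambda>u. - (u powr \<alpha> * V s K u * (V s K u - \<nu> / u) / (2 * (s u)\<^sup>2))"])
    show "continuous_on {r..r1 - h} (\<lambda>u. c1 - \<Phi> s K u)"
      by (intro continuous_intros continuous_on_DERIV[OF DERIV_Phi[OF sol]]) (use r in auto)
    fix u assume u: "r < u" "u < r1 - h"
    have u0: "0 < u" using u r by simp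
    show "((\<lambda>u. c1 - \<Phi> s K u) has_real_derivative - (u powr \<alpha> * V s K u * (V s K u - \<nu> / u) / (2 * (s u)\<^sup>2))) (at u)"
      using DERIV_diff[OF DERIV_const DERIV_Phi[OF sol u0], of c1] by simp
    assume "0 < c1 - \<Phi> s K u"
    thus "- (u powr \<alpha> * V s K u * (V s K u - \<nu> / u) / (2 * (s u)\<^sup>2)) \<le> 0"
      using Phi_slope_pos[OF sol u0] by simp
  qed (use neg h in auto)
  thus False using d(2)[OF h(1,2)] le by simp
qed

lemma rPhi_lim:
  assumes "sol s K"
  shows "((\<lambda>r. r * \<Phi> s K r) \<longlongrightarrow> 0) (at_right 0)"
proof -
  have "((\<lambda>r. \<beta> - 2 * s r * (r * K r)) \<longlongrightarrow> \<beta> - 2 * sqrt c0 * (\<beta> / (2 * sqrt c0))) (at_right 0)"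
    by (intro tendsto_intros sol_lim[OF assms] rK_lim[OF assms])
  moreover have "\<forall>\<^sub>F r in at_right 0. \<beta> - 2 * s r * (r * K r) = r * \<Phi> s K r"
    unfolding eventually_at_right_field by (intro exI[of _ 1]) (auto simp: Phi0(1) right_diff_distrib)
  ultimately show ?thesis using c0_pos by (simp add: tendsto_cong)
qed

text \<open>Together with \<open>rPhi_lim\<close> this provides the initial value \<open>0\<close>
  of the chord defect in the convexity proof. Here \<open>\<alpha> \<ge> 1\<close> enters: it gives
  \<open>D r / r \<le> r * \<kappa> r\<close> for \<open>r < 1\<close>, and
  \<open>r * \<kappa> r\<close> tends to \<open>0\<close>.\<close>

lemma sq_diff_lim:
  assumes "soliton_ordered \<alpha> lam c0 s1 K1 s2 K2"
  shows "((\<lambda>r. ((s2 r)\<^sup>2 - (s1 r)\<^sup>2) / r) \<longlongrightarrow> 0) (at_right 0)"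
proof -
  interpret soliton_ordered \<alpha> lam c0 s1 K1 s2 K2 by (rule assms)
  have kap: "((\<lambda>r. r * \<kappa> r) \<longlongrightarrow> 0) (at_right 0)"
    using tendsto_diff[OF rK_lim[OF sol1] rK_lim[OF sol2]] by (simp add: \<kappa>_def[abs_def] right_diff_distrib)
  have D: "((\<lambda>r. D r / r) \<longlongrightarrow> 0) (at_right 0)"
  proof (rule tendsto_sandwich[OF _ _ tendsto_const kap])
    show "\<forall>\<^sub>F r in at_right 0. 0 \<le> D r / r"
      unfolding eventually_at_right_field using D_pos by (intro exI[of _ 1]) (auto intro: less_imp_le)
    have "D r / r \<le> r * \<kappa> r" if r: "0 < r" "r < 1" for r
    proof -
      have "D r \<le> (\<alpha> + 1) * D r" using D_pos[OF r(1)] alpha_pos by simp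
      also have "\<dots> \<le> r * r powr \<alpha> * \<kappa> r" using D_less_kappa[OF r(1)] by simp
      also have "\<dots> \<le> r * r * \<kappa> r"
      proof -
        have "r powr \<alpha> \<le> r powr 1" using r alpha_ge1 by (intro powr_mono') auto
        thus ?thesis using r kappa_pos[OF r(1)] by (intro mult_right_mono mult_left_mono) auto
      qed
      finally show ?thesis using r by (simp add: pos_divide_le_eq mult_ac)
    qed
    thus "\<forall>\<^sub>F r in at_right 0. D r / r \<le> r * \<kappa> r"
      unfolding eventually_at_right_field by (intro exI[of _ 1]) auto
  qed
  have "((\<lambda>r. D r / r * (s2 r + s1 r)) \<longlongrightarrow> 0 * (sqrt c0 + sqrt c0)) (at_right 0)"
    by (intro tendsto_intros D sol_lim[OF sol1] sol_lim[OF sol2])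
  thus ?thesis by (simp add: D_def power2_eq_square algebra_simps)
qed

text \<open>The signed height of the third point above the chord, in the plane of \<open>w\<close>
  and \<open>\<Phi>\<close>, is followed from \<open>r = 0\<close>, where its multiple
  \<open>\<Delta>\<close> tends to \<open>0\<close>. By \<open>chord_inequality\<close>
  \<open>\<Delta>\<close> has a negative derivative whenever it is nonnegative, so it never becomes
  positive and is negative at \<open>\<epsilon>\<close>.\<close>

lemma Phi_strictly_convex:
  assumes o13: "soliton_ordered \<alpha> lam c0 s1 K1 s3 K3" and o32: "soliton_ordered \<alpha> lam c0 s3 K3 s2 K2"
    and \<epsilon>: "0 < \<epsilon>" and P1: "\<Phi> s1 K1 \<epsilon> = c1" and P2: "\<Phi> s2 K2 \<epsilon> = c1"
  shows "\<Phi> s3 K3 \<epsilon> < c1"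
proof -
  interpret p13: soliton_ordered \<alpha> lam c0 s1 K1 s3 K3 by (rule o13)
  interpret p32: soliton_ordered \<alpha> lam c0 s3 K3 s2 K2 by (rule o32)
  have o12: "soliton_ordered \<alpha> lam c0 s1 K1 s2 K2"
    by (rule soliton_orderedI[OF p13.sol1 p32.sol2 zero_less_one])
       (use p13.s_less[OF zero_less_one] p32.s_less[OF zero_less_one] in simp)
  interpret p12: soliton_ordered \<alpha> lam c0 s1 K1 s2 K2 by (rule o12)
  note sols = p13.sol1 p32.sol2 p13.sol2
  have y12: "\<Phi> s1 K1 r \<le> c1" "\<Phi> s2 K2 r \<le> c1" if "0 < r" "r \<le> \<epsilon>" for r
    using Phi_below_before[OF sols(1) that(1), of \<epsilon>] Phi_below_before[OF sols(2) that(1), of \<epsilon>] P1 P2 that by force+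
  have spos: "0 < s1 r" "0 < s2 r" "0 < s3 r" "s1 r < s3 r" "s3 r < s2 r" if "0 < r" for r
    using sol_pos sols p13.s_less p32.s_less that by auto
  \<comment> \<open>The chord inequality requires a nonnegative slope. A negative slope would
    persist up to \<open>\<epsilon>\<close>, where both values equal \<open>c1\<close>.\<close>
  have slope_ge: "\<Phi> s1 K1 r \<le> \<Phi> s2 K2 r" if r: "0 < r" "r \<le> \<epsilon>" for r
  proof (rule ccontr)
    assume neg: "\<not> \<Phi> s1 K1 r \<le> \<Phi> s2 K2 r"
    have "\<Phi> s2 K2 \<epsilon> - \<Phi> s1 K1 \<epsilon> < 0"
    proof (rule linear_ode_neg[OF r(2), where z = "\<lambda>r. \<Phi> s2 K2 r - \<Phi> s1 K1 r"
          and p = "\<lambda>r. r powr \<alpha> * ((V s2 K2 r - \<nu> / r) + V s1 K1 r) / (2 * (s2 r)\<^sup>2)"])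
      show "continuous_on {r..\<epsilon>} (\<lambda>r. \<Phi> s2 K2 r - \<Phi> s1 K1 r)"
        by (intro continuous_on_diff continuous_on_DERIV[OF DERIV_Phi[OF sols(1)]] continuous_on_DERIV[OF DERIV_Phi[OF sols(2)]])
           (use r in auto)
      have sub: "{r..\<epsilon>} \<subseteq> {0<..}" using r by auto
      have "2 * (s2 y)\<^sup>2 \<noteq> 0" "y \<noteq> 0" if "y \<in> {r..\<epsilon>}" for y using that r spos[of y] by auto
      thus "continuous_on {r..\<epsilon>} (\<lambda>r. r powr \<alpha> * ((V s2 K2 r - \<nu> / r) + V s1 K1 r) / (2 * (s2 r)\<^sup>2))"
        by (intro continuous_intros sol_cont[OF sols(2) sub] V_cont[OF sols(1) sub] V_cont[OF sols(2) sub]) auto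
      fix u assume u: "r < u" "u < \<epsilon>"
      have u0: "0 < u" "u \<le> \<epsilon>" using u r by auto
      define X1 Y1 X2 Y2 where "X1 = V s1 K1 u - \<nu> / u" and "Y1 = V s1 K1 u" and "X2 = V s2 K2 u - \<nu> / u" and "Y2 = V s2 K2 u"
      show "((\<lambda>r. \<Phi> s2 K2 r - \<Phi> s1 K1 r) has_real_derivative
          u powr \<alpha> * V s2 K2 u * (V s2 K2 u - \<nu> / u) / (2 * (s2 u)\<^sup>2) - u powr \<alpha> * V s1 K1 u * (V s1 K1 u - \<nu> / u) / (2 * (s1 u)\<^sup>2)) (at u)"
        by (rule DERIV_diff[OF DERIV_Phi[OF sols(2) u0(1)] DERIV_Phi[OF sols(1) u0(1)]])
      have XY: "0 < X1 * Y1" unfolding X1_def Y1_def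
        using below_level[OF u0(1) y12(1)[OF u0]] by (intro mult_neg_neg)
      have "(s1 u)\<^sup>2 \<le> (s2 u)\<^sup>2" using spos[OF u0(1)] by (intro power_mono) auto
      hence "u powr \<alpha> * (X1 * Y1) / (2 * (s2 u)\<^sup>2) \<le> u powr \<alpha> * (X1 * Y1) / (2 * (s1 u)\<^sup>2)"
        using XY spos[OF u0(1)] u0 by (intro divide_left_mono mult_nonneg_nonneg[OF powr_ge_zero]) auto
      moreover have "u powr \<alpha> * Y2 * X2 / (2 * (s2 u)\<^sup>2) - u powr \<alpha> * (X1 * Y1) / (2 * (s2 u)\<^sup>2)
          = u powr \<alpha> * (X2 + Y1) / (2 * (s2 u)\<^sup>2) * (\<Phi> s2 K2 u - \<Phi> s1 K1 u)"
      proof -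
        have "\<Phi> s2 K2 u - \<Phi> s1 K1 u = Y2 - Y1" "X2 - X1 = Y2 - Y1" by (simp_all add: X1_def X2_def Y1_def Y2_def Phi0(2))
        moreover have "Y2 * X2 - X1 * Y1 = (X2 + Y1) * (Y2 - Y1)" if "X2 - X1 = Y2 - Y1"
        proof -
          have X1: "X1 = X2 - (Y2 - Y1)" using that by simp
          show ?thesis unfolding X1 by (simp add: algebra_simps)
        qed
        ultimately show ?thesis by (metis (no_types, lifting) diff_divide_distrib mult.assoc right_diff_distrib times_divide_eq_left)
      qed
      ultimately show "u powr \<alpha> * V s2 K2 u * (V s2 K2 u - \<nu> / u) / (2 * (s2 u)\<^sup>2) - u powr \<alpha> * V s1 K1 u * (V s1 K1 u - \<nu> / u) / (2 * (s1 u)\<^sup>2)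
          \<le> u powr \<alpha> * ((V s2 K2 u - \<nu> / u) + V s1 K1 u) / (2 * (s2 u)\<^sup>2) * (\<Phi> s2 K2 u - \<Phi> s1 K1 u)"
        unfolding X1_def Y1_def X2_def Y2_def by (simp add: mult_ac)
    qed (use neg in auto)
    thus False using P1 P2 by simp
  qed
  define w1 w2 w3 where "w1 = (\<lambda>r. (s1 r)\<^sup>2)" and "w2 = (\<lambda>r. (s2 r)\<^sup>2)" and "w3 = (\<lambda>r. (s3 r)\<^sup>2)"
  have w: "0 < w1 r" "w1 r < w3 r" "w3 r < w2 r" if "0 < r" for r
    using spos[OF that] by (auto simp: w1_def w2_def w3_def intro!: power_strict_mono)
  \<comment> \<open>In \<open>\<Delta>'\<close> the derivatives of \<open>w1\<close>,
    \<open>w2\<close>, \<open>w3\<close> contribute nothing: they are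
    \<open>r powr \<alpha> * (\<Phi> - \<gamma> / r)\<close>, affine in \<open>\<Phi>\<close> with
    common coefficients, so their contributions cancel identically.\<close>
  define \<Delta> where "\<Delta> = (\<lambda>r. (w2 r - w1 r) * \<Phi> s3 K3 r - (w2 r - w3 r) * \<Phi> s1 K1 r - (w3 r - w1 r) * \<Phi> s2 K2 r)"
  define \<Delta>' where "\<Delta>' = (\<lambda>r. r powr \<alpha> / 2 * ((w2 r - w1 r) * ((V s3 K3 r - \<nu> / r) * V s3 K3 r / w3 r)
      - (w2 r - w3 r) * ((V s1 K1 r - \<nu> / r) * V s1 K1 r / w1 r) - (w3 r - w1 r) * ((V s2 K2 r - \<nu> / r) * V s2 K2 r / w2 r)))"
  have dD: "(\<Delta> has_real_derivative \<Delta>' r) (at r)" if r: "0 < r" for r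
  proof -
    define p where "p = r powr \<alpha>"
    define P1 where "P1 = \<Phi> s1 K1 r"
    define P2 where "P2 = \<Phi> s2 K2 r"
    define P3 where "P3 = \<Phi> s3 K3 r"
    have VP: "V s1 K1 r = P1 - \<gamma> / r" "V s2 K2 r = P2 - \<gamma> / r" "V s3 K3 r = P3 - \<gamma> / r"
      by (simp_all add: P1_def P2_def P3_def Phi0(2))
    have dw: "(w1 has_real_derivative p * V s1 K1 r) (at r)" "(w2 has_real_derivative p * V s2 K2 r) (at r)"
        "(w3 has_real_derivative p * V s3 K3 r) (at r)"
      unfolding w1_def w2_def w3_def p_def by (intro DERIV_sq sols r)+
    have dy: "(\<Phi> s1 K1 has_real_derivative p * V s1 K1 r * (V s1 K1 r - \<nu> / r) / (2 * w1 r)) (at r)"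
        "(\<Phi> s2 K2 has_real_derivative p * V s2 K2 r * (V s2 K2 r - \<nu> / r) / (2 * w2 r)) (at r)"
        "(\<Phi> s3 K3 has_real_derivative p * V s3 K3 r * (V s3 K3 r - \<nu> / r) / (2 * w3 r)) (at r)"
      unfolding w1_def w2_def w3_def p_def by (intro DERIV_Phi sols r)+
    have "(\<Delta> has_real_derivative
       ((p * V s2 K2 r - p * V s1 K1 r) * P3 + (p * V s3 K3 r * (V s3 K3 r - \<nu> / r) / (2 * w3 r)) * (w2 r - w1 r))
       - ((p * V s2 K2 r - p * V s3 K3 r) * P1 + (p * V s1 K1 r * (V s1 K1 r - \<nu> / r) / (2 * w1 r)) * (w2 r - w3 r))
       - ((p * V s3 K3 r - p * V s1 K1 r) * P2 + (p * V s2 K2 r * (V s2 K2 r - \<nu> / r) / (2 * w2 r)) * (w3 r - w1 r))) (at r)"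
      unfolding \<Delta>_def P1_def P2_def P3_def
      by (intro DERIV_diff DERIV_mult dw dy)
    moreover have "(p * V s2 K2 r - p * V s1 K1 r) * P3 - (p * V s2 K2 r - p * V s3 K3 r) * P1 - (p * V s3 K3 r - p * V s1 K1 r) * P2 = 0"
      unfolding VP by (simp add: algebra_simps)
    moreover have "a1 + p * v3 * x3 / (2 * b3) * c3 - (a2 + p * v1 * x1 / (2 * b1) * d3) - (a3 + p * v2 * x2 / (2 * b2) * e3)
        = p / 2 * (c3 * (x3 * v3 / b3) - d3 * (x1 * v1 / b1) - e3 * (x2 * v2 / b2))" if "a1 - a2 - a3 = 0"
      for a1 a2 a3 v1 v2 v3 x1 x2 x3 b1 b2 b3 c3 d3 e3
    proof -
      have "p * v * x / (2 * b) * c = p / 2 * (c * (x * v / b))" for v x b c by simp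
      moreover have "a1 = a2 + a3" using that by simp
      ultimately show ?thesis by (simp only: right_diff_distrib)
    qed
    ultimately show ?thesis unfolding \<Delta>'_def p_def[symmetric] by metis
  qed
  have neg: "\<Delta>' r < 0" if r: "0 < r" "r \<le> \<epsilon>" and "0 \<le> \<Delta> r" for r
  proof -
    have V3: "V s3 K3 r < \<nu> / r"
    proof -
      have "0 < 2 * s2 r * K2 r" using below_level(2)[OF r(1) y12(2)[OF r]] Phi0(3)[of s2 K2 r] by linarith
      hence "0 < K2 r" using spos(2)[OF r(1)] by (metis mult_pos_pos zero_less_mult_pos zero_less_numeral)
      hence "0 < K3 r" using p32.K_less[OF r(1)] by simp
      hence "0 < 2 * s3 r * K3 r" using spos(3)[OF r(1)] by simp
      thus ?thesis using Phi0(3)[of s3 K3 r] by linarith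
    qed
    have "(w2 r - w1 r) * ((V s3 K3 r - \<nu> / r) * V s3 K3 r / w3 r)
      - (w2 r - w3 r) * ((V s1 K1 r - \<nu> / r) * V s1 K1 r / w1 r) - (w3 r - w1 r) * ((V s2 K2 r - \<nu> / r) * V s2 K2 r / w2 r) < 0"
    proof (rule chord_inequality[OF w[OF r(1)]])
      show "V s1 K1 r < 0" "V s2 K2 r < 0" using below_level(1)[OF r(1)] y12[OF r] by auto
      show "V s1 K1 r \<le> V s2 K2 r" using slope_ge[OF r] by (simp add: Phi0(2))
      show "0 < \<nu> / r" using nu_pos r by simp
      have "(w2 r - w1 r) * V s3 K3 r - (w2 r - w3 r) * V s1 K1 r - (w3 r - w1 r) * V s2 K2 r = \<Delta> r"
        unfolding \<Delta>_def Phi0(2) by (simp add: algebra_simps)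
      thus "0 \<le> (w2 r - w1 r) * V s3 K3 r - (w2 r - w3 r) * V s1 K1 r - (w3 r - w1 r) * V s2 K2 r" using \<open>0 \<le> \<Delta> r\<close> by simp
    qed (rule V3)
    thus ?thesis unfolding \<Delta>'_def using r by (intro mult_pos_neg) auto
  qed
  have lim: "(\<Delta> \<longlongrightarrow> 0) (at_right 0)"
  proof -
    have "((\<lambda>r. (w2 r - w1 r) / r * (r * \<Phi> s3 K3 r) - (w2 r - w3 r) / r * (r * \<Phi> s1 K1 r) - (w3 r - w1 r) / r * (r * \<Phi> s2 K2 r))
        \<longlongrightarrow> 0 * 0 - 0 * 0 - 0 * 0) (at_right 0)"
      unfolding w1_def w2_def w3_def
      by (intro tendsto_diff tendsto_mult rPhi_lim sols sq_diff_lim[OF o12] sq_diff_lim[OF o13] sq_diff_lim[OF o32])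
    moreover have "\<forall>\<^sub>F r in at_right 0. (w2 r - w1 r) / r * (r * \<Phi> s3 K3 r) - (w2 r - w3 r) / r * (r * \<Phi> s1 K1 r) - (w3 r - w1 r) / r * (r * \<Phi> s2 K2 r) = \<Delta> r"
      unfolding eventually_at_right_field by (intro exI[of _ 1]) (auto simp: \<Delta>_def)
    ultimately show ?thesis by (simp add: tendsto_cong)
  qed
  have nonpos: "\<Delta> r \<le> 0" if r: "0 < r" "r \<le> \<epsilon>" for r
  proof (rule field_le_epsilon)
    fix e :: real assume e: "0 < e"
    obtain b where b: "0 < b" "\<And>u. 0 < u \<Longrightarrow> u < b \<Longrightarrow> \<Delta> u < e"
      using order_tendstoD(2)[OF lim e] unfolding eventually_at_right_field by blast
    define u where "u = min (b / 2) r"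
    have u: "0 < u" "u < b" "u \<le> r" using b r by (auto simp: u_def)
    have "\<Delta> r - e \<le> 0"
    proof (rule barrier_nonpos[OF u(3), where z = "\<lambda>r. \<Delta> r - e" and \<eta> = 1 and z' = \<Delta>'])
      show "continuous_on {u..r} (\<lambda>r. \<Delta> r - e)"
        by (intro continuous_intros continuous_on_DERIV[OF dD]) (use u in auto)
      show "\<Delta> u - e \<le> 0" using b(2)[OF u(1,2)] by simp
      fix v assume v: "u < v" "v < r"
      show "((\<lambda>r. \<Delta> r - e) has_real_derivative \<Delta>' v) (at v)"
        using DERIV_diff[OF dD DERIV_const, of v e] v u by simp
      assume "0 < \<Delta> v - e"
      thus "\<Delta>' v \<le> 0" using neg[of v] v u r e by simp
    qed simp
    thus "\<Delta> r \<le> 0 + e" by simp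
  qed
  have "\<Delta> \<epsilon> < 0"
  proof (rule ccontr)
    assume "\<not> \<Delta> \<epsilon> < 0"
    hence 0: "0 \<le> \<Delta> \<epsilon>" by simp
    obtain d where d: "0 < d" "\<And>h. 0 < h \<Longrightarrow> h < d \<Longrightarrow> \<Delta> \<epsilon> < \<Delta> (\<epsilon> - h)"
      using DERIV_neg_dec_left[OF dD[OF \<epsilon>] neg[OF \<epsilon> order_refl 0]] by blast
    define h where "h = min (d / 2) (\<epsilon> / 2)"
    have h: "0 < h" "h < d" "h < \<epsilon>" using d \<epsilon> by (auto simp: h_def)
    show False using d(2)[OF h(1,2)] nonpos[of "\<epsilon> - h"] h 0 by simp
  qed
  moreover have "\<Delta> \<epsilon> = (w2 \<epsilon> - w1 \<epsilon>) * (\<Phi> s3 K3 \<epsilon> - c1)" unfolding \<Delta>_def P1 P2 by (simp add: algebra_simps)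
  ultimately show ?thesis using w[OF \<epsilon>] by (simp add: mult_less_0_iff)
qed

end

section \<open>A priori bounds below the level and compactness\<close>

context soliton_fold begin

text \<open>Below the level \<open>w' \<le> r powr \<alpha> * (c1 - \<gamma> / r)\<close>, and the
  integral of the right-hand side decreases at least linearly for \<open>r \<ge> 1\<close>. It would
  exhaust the initial value \<open>c0\<close> of \<open>w\<close> in a bounded distance.\<close>

lemma below_level_bounded:
  obtains T where "\<And>s K r. sol s K \<Longrightarrow> 0 < r \<Longrightarrow> \<Phi> s K r \<le> c1 \<Longrightarrow> r \<le> T"
proof -
  define e where "e = - c1 / (\<alpha> + 1) + \<gamma> / \<alpha>"
  have e: "0 < e"
  proof -
    have nn: "0 \<le> - c1 / (\<alpha> + 1)" "0 \<le> \<gamma> / \<alpha>"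
      using c1 gamma_nonneg alpha_pos by (intro divide_nonneg_pos; simp)+
    have "0 < - c1 / (\<alpha> + 1) \<or> 0 < \<gamma> / \<alpha>"
      using gamma_or alpha_pos divide_pos_pos[of "- c1" "\<alpha> + 1"] divide_pos_pos[of \<gamma> \<alpha>] by linarith
    thus ?thesis using nn unfolding e_def by linarith
  qed
  show ?thesis
  proof (rule that[of "max 1 (c0 / e)"])
    fix s K r assume sol: "sol s K" and r: "0 < r" and le: "\<Phi> s K r \<le> c1"
    show "r \<le> max 1 (c0 / e)"
    proof (cases "r \<le> 1")
      case False
      \<comment> \<open>\<open>w\<close> minus the explicit antiderivative of
        \<open>r powr \<alpha> * (c1 - \<gamma> / r)\<close>; it is nonincreasing and starts at
        \<open>c0\<close>.\<close>
      define g where "g = (\<lambda>u. (s u)\<^sup>2 - c1 * (u * u powr \<alpha>) / (\<alpha> + 1) + \<gamma> * u powr \<alpha> / \<alpha>)"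
      have lim: "(g \<longlongrightarrow> (sqrt c0)\<^sup>2 - c1 * (0 * 0) / (\<alpha> + 1) + \<gamma> * 0 / \<alpha>) (at_right 0)"
        unfolding g_def by (intro tendsto_intros sol_lim[OF sol] tendsto_powr_alpha) (use alpha_pos in auto)
      have "g r \<le> g u" if u: "0 < u" "u \<le> r" for u
      proof (rule DERIV_nonpos_imp_nonincreasing[OF u(2)])
        fix v assume v: "u \<le> v" "v \<le> r"
        have v0: "0 < v" using u v by simp
        have "\<Phi> s K v \<le> c1" using Phi_below_before[OF sol v0 _ le] le v by (cases "v = r") (auto intro: less_imp_le)
        hence "v powr \<alpha> * (\<Phi> s K v - c1) \<le> 0" by (intro mult_nonneg_nonpos) auto
        moreover have "(g has_real_derivative v powr \<alpha> * V s K v - c1 * v powr \<alpha> + \<gamma> * v powr \<alpha> / v) (at v)"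
        proof -
          have a: "((\<lambda>u. u * u powr \<alpha>) has_real_derivative (\<alpha> + 1) * v powr \<alpha>) (at v)"
            by (rule DERIV_cong[OF DERIV_mult[OF DERIV_ident DERIV_powr_pos[OF v0]]]) (use v0 in \<open>simp add: algebra_simps\<close>)
          show ?thesis unfolding g_def
            by (rule DERIV_cong[OF DERIV_add[OF DERIV_diff[OF DERIV_sq[OF sol v0] DERIV_cdivide[OF DERIV_cmult[OF a]]]
                  DERIV_cdivide[OF DERIV_cmult[OF DERIV_powr_pos[OF v0]]]]])
               (use alpha_pos in \<open>simp add: field_simps\<close>)
        qed
        moreover have "v powr \<alpha> * V s K v - c1 * v powr \<alpha> + \<gamma> * v powr \<alpha> / v = v powr \<alpha> * (\<Phi> s K v - c1)"
          by (simp add: Phi0(2) algebra_simps)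
        ultimately show "\<exists>y. (g has_real_derivative y) (at v) \<and> y \<le> 0" by metis
      qed
      hence "\<forall>\<^sub>F u in at_right 0. g r \<le> g u"
        unfolding eventually_at_right_field using r by (intro exI[of _ r]) auto
      hence "g r \<le> (sqrt c0)\<^sup>2 - c1 * (0 * 0) / (\<alpha> + 1) + \<gamma> * 0 / \<alpha>" by (intro tendsto_lowerbound[OF lim]) auto
      hence "g r \<le> c0" using c0_pos by simp
      moreover have "r * e \<le> \<gamma> * r powr \<alpha> / \<alpha> - c1 * (r * r powr \<alpha>) / (\<alpha> + 1)"
      proof -
        have "r powr 1 \<le> r powr \<alpha>" using False alpha_ge1 by (intro powr_mono) auto
        hence p: "r \<le> r powr \<alpha>" using r by simp
        have "r * 1 \<le> r * r powr \<alpha>" using p False by (intro mult_left_mono) auto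
        moreover have "0 \<le> - c1 / (\<alpha> + 1)" using c1 alpha_pos by (intro divide_nonneg_pos) auto
        ultimately have "- c1 / (\<alpha> + 1) * r \<le> - c1 / (\<alpha> + 1) * (r * r powr \<alpha>)" by (intro mult_left_mono) auto
        moreover have "\<gamma> / \<alpha> * r \<le> \<gamma> / \<alpha> * r powr \<alpha>" using p gamma_nonneg alpha_pos by (intro mult_left_mono) auto
        moreover have "r * e = - c1 / (\<alpha> + 1) * r + \<gamma> / \<alpha> * r" by (simp add: e_def algebra_simps)
        ultimately show ?thesis by simp
      qed
      moreover have "0 < (s r)\<^sup>2" using sol_pos[OF sol r] by simp
      ultimately have "r * e \<le> c0" unfolding g_def by linarith
      thus ?thesis using e by (simp add: pos_le_divide_eq le_max_iff_disj)
    qed simp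
  qed
qed

text \<open>This confines the parameters to a compact interval. Below the level \<open>r * K\<close>
  is nondecreasing, so a large \<open>\<delta> * K \<delta>\<close> keeps \<open>K\<close> large on
  \<open>[r0 / 2, r0]\<close> and makes \<open>s\<close> fall steeply there, although it has at most
  \<open>sqrt c0\<close> to lose.\<close>

lemma below_level_K_bound:
  assumes r0: "0 < r0"
  obtains C where "0 \<le> C" "\<And>s K \<delta>. sol s K \<Longrightarrow> \<Phi> s K r0 \<le> c1 \<Longrightarrow> 0 < \<delta> \<Longrightarrow> \<delta> \<le> r0 / 2 \<Longrightarrow> 0 < K \<delta> \<and> \<delta> * K \<delta> \<le> C"
proof -
  \<comment> \<open>Below the level \<open>2 * u * s u * K u \<ge> b\<close> for
    \<open>u \<ge> r0 / 2\<close>. Since \<open>b > \<nu>\<close>, the term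
    \<open>\<nu> / (2 * u * s u)\<close> compensates only the fraction \<open>\<nu> / b\<close> of
    \<open>K u\<close> in \<open>s'\<close>, and the fraction \<open>g0\<close> remains.\<close>
  define b where "b = \<beta> - c1 * (r0 / 2)"
  have b: "\<nu> < b" "0 < b"
  proof -
    show "\<nu> < b"
    proof (cases "0 < \<gamma>")
      case True
      have "c1 * (r0 / 2) \<le> 0" using c1 r0 by (intro mult_nonpos_nonneg) auto
      thus ?thesis using True by (simp add: b_def beta_gamma)
    next
      case False
      hence "c1 * (r0 / 2) < 0" using gamma_or r0 by (intro mult_neg_pos) auto
      thus ?thesis using nu_le_beta by (simp add: b_def)
    qed
    thus "0 < b" using nu_pos by simp
  qed
  define g0 where "g0 = 1 - \<nu> / b"
  have g0: "0 < g0" using b by (simp add: g0_def)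
  define C where "C = sqrt c0 * 2 / (g0 * (r0 / 2) powr \<alpha>)"
  have p: "0 < g0 * (r0 / 2) powr \<alpha>" using g0 r0 by simp
  show ?thesis
  proof (rule that[of C])
    show "0 \<le> C" using p c0_pos by (auto simp: C_def intro!: divide_nonneg_pos)
    fix s K \<delta> assume sol: "sol s K" and le: "\<Phi> s K r0 \<le> c1" and \<delta>: "0 < \<delta>" "\<delta> \<le> r0 / 2"
    have below: "\<Phi> s K u \<le> c1" if "0 < u" "u \<le> r0" for u
      using Phi_below_before[OF sol that(1) _ le] le that by (cases "u = r0") (auto intro: less_imp_le)
    have sK: "\<beta> / u - c1 \<le> 2 * s u * K u" if "0 < u" "u \<le> r0" for u
      using below[OF that] by (simp add: Phi0(1))
    have K_pos: "0 < K u" if u: "0 < u" "u \<le> r0" for u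
    proof -
      have "0 < \<beta> / u" using beta_pos u by simp
      hence "0 < 2 * s u * K u" using sK[OF u] c1 by linarith
      moreover have "0 < 2 * s u" using sol_pos[OF sol u(1)] by simp
      ultimately show ?thesis by (rule zero_less_mult_pos)
    qed
    have rK_mono: "\<delta> * K \<delta> \<le> u * K u" if u: "\<delta> \<le> u" "u \<le> r0" for u
    proof (rule DERIV_nonneg_imp_nondecreasing[OF u(1), of "\<lambda>u. u * K u"])
      fix v assume v: "\<delta> \<le> v" "v \<le> u"
      have v0: "0 < v" "v \<le> r0" using v \<delta> u by auto
      have s: "0 < s v" using sol_pos[OF sol v0(1)] .
      have "((\<lambda>u. u * K u) has_real_derivative K v - \<beta> / (2 * v * s v)) (at v)"
        by (rule DERIV_cong[OF DERIV_mult[OF DERIV_ident sol_DERIV_K[OF sol v0(1)]]])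
           (use v0 s lam0 in \<open>simp add: power2_eq_square\<close>)
      moreover have "\<beta> / v \<le> 2 * s v * K v" using sK[OF v0] c1 by linarith
      hence "\<beta> / (2 * v * s v) \<le> K v" using v0 s by (simp add: field_simps)
      ultimately show "\<exists>y. ((\<lambda>u. u * K u) has_real_derivative y) (at v) \<and> 0 \<le> y" by (intro exI conjI) auto
    qed
    define M where "M = g0 * (r0 / 2) powr \<alpha> * (\<delta> * K \<delta> / r0)"
    have "(\<lambda>u. s u + M * u) r0 \<le> (\<lambda>u. s u + M * u) (r0 / 2)"
    proof (rule DERIV_nonpos_imp_nonincreasing[of "r0 / 2" r0 "\<lambda>u. s u + M * u"])
      fix u assume u: "r0 / 2 \<le> u" "u \<le> r0"
      have u0: "0 < u" using u r0 by simp
      have s: "0 < s u" using sol_pos[OF sol u0] .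
      have "u powr \<alpha> * V s K u / (2 * s u) = u powr \<alpha> * (\<nu> / (2 * u * s u) - K u)"
        using s u0 lam0 unfolding V_def by (simp add: field_simps)
      also have "\<dots> \<le> u powr \<alpha> * - (g0 * K u)"
      proof (intro mult_left_mono)
        have "b \<le> \<beta> - c1 * u" using u c1 mult_left_mono_neg[of "r0/2" u c1] by (simp add: b_def)
        also have "\<dots> = u * (\<beta> / u - c1)" using u0 by (simp add: algebra_simps)
        also have "\<dots> \<le> u * (2 * s u * K u)" using sK[OF u0 u(2)] u0 by (intro mult_left_mono) auto
        finally have "\<nu> * b \<le> \<nu> * (u * (2 * s u * K u))" using nu_pos by (intro mult_left_mono) auto
        hence "\<nu> / (2 * u * s u) \<le> \<nu> / b * K u" using u0 s b by (simp add: field_simps)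
        thus "\<nu> / (2 * u * s u) - K u \<le> - (g0 * K u)" by (simp add: g0_def algebra_simps)
      qed auto
      also have "\<dots> \<le> - M"
      proof -
        have "\<delta> * K \<delta> / r0 \<le> K u"
        proof -
          have "\<delta> * K \<delta> \<le> u * K u" using u \<delta> by (intro rK_mono) auto
          also have "\<dots> \<le> r0 * K u" using u K_pos[OF u0 u(2)] by (intro mult_right_mono) auto
          finally show ?thesis using r0 by (simp add: pos_divide_le_eq mult.commute)
        qed
        moreover have "(r0 / 2) powr \<alpha> \<le> u powr \<alpha>" using u r0 alpha_pos by (intro powr_mono2) auto
        ultimately have "g0 * (r0 / 2) powr \<alpha> * (\<delta> * K \<delta> / r0) \<le> g0 * u powr \<alpha> * K u"
          using g0 r0 \<delta> K_pos[of \<delta>] by (intro mult_mono mult_nonneg_nonneg divide_nonneg_pos) auto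
        thus ?thesis by (simp add: M_def mult_ac)
      qed
      finally have "u powr \<alpha> * V s K u / (2 * s u) + M \<le> 0" by simp
      moreover have "((\<lambda>u. s u + M * u) has_real_derivative u powr \<alpha> * V s K u / (2 * s u) + M) (at u)"
        by (rule DERIV_cong[OF DERIV_add[OF sol_DERIV_s[OF sol u0] DERIV_cmult_Id]]) simp
      ultimately show "\<exists>y. ((\<lambda>u. s u + M * u) has_real_derivative y) (at u) \<and> y \<le> 0" by blast
    qed (use r0 in simp)
    hence 1: "M * (r0 / 2) \<le> s (r0 / 2)" using sol_pos[OF sol r0] by (simp add: algebra_simps)
    have "s (r0 / 2) \<le> sqrt c0"
    proof (rule tendsto_lowerbound[OF sol_lim[OF sol]])
      have "s (r0 / 2) \<le> s u" if u: "0 < u" "u \<le> r0 / 2" for u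
      proof (rule DERIV_nonpos_imp_nonincreasing[OF u(2)])
        fix v assume v: "u \<le> v" "v \<le> r0 / 2"
        have v0: "0 < v" "v \<le> r0" using v u r0 by auto
        have "v powr \<alpha> * V s K v / (2 * s v) \<le> 0"
          using below_level(1)[OF v0(1) below[OF v0]] sol_pos[OF sol v0(1)]
          by (intro divide_nonpos_pos mult_nonneg_nonpos) auto
        thus "\<exists>y. (s has_real_derivative y) (at v) \<and> y \<le> 0" using sol_DERIV_s[OF sol v0(1)] by blast
      qed
      thus "\<forall>\<^sub>F u in at_right 0. s (r0 / 2) \<le> s u"
        unfolding eventually_at_right_field using r0 by (intro exI[of _ "r0 / 2"]) auto
    qed simp
    with 1 have "M * (r0 / 2) \<le> sqrt c0" by simp
    moreover have "M * (r0 / 2) = g0 * (r0 / 2) powr \<alpha> * (\<delta> * K \<delta>) / 2" using r0 by (simp add: M_def)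
    ultimately have "g0 * (r0 / 2) powr \<alpha> * (\<delta> * K \<delta>) \<le> sqrt c0 * 2" by simp
    hence "\<delta> * K \<delta> \<le> C" unfolding C_def using p by (simp add: pos_le_divide_eq mult_ac)
    thus "0 < K \<delta> \<and> \<delta> * K \<delta> \<le> C" using K_pos[of \<delta>] \<delta> r0 by simp
  qed
qed

lemma ex_below_level:
  obtains s K r where "sol s K" "0 < r" "\<Phi> s K r \<le> c1"
proof -
  \<comment> \<open>With \<open>K R = B / R\<close> and \<open>s R \<ge> sqrt c0 / 2\<close> one
    gets \<open>\<Phi> \<le> - (\<bar>c1\<bar> / R)\<close>, which is at most \<open>c1\<close>
    because \<open>R \<le> 1\<close>.\<close>
  define B where "B = (\<beta> + \<bar>c1\<bar>) / sqrt c0"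
  have B: "0 \<le> B" using beta_pos c0_pos by (simp add: B_def)
  obtain R where R: "0 < R" "R \<le> 1"
    "\<And>x. R * \<bar>x\<bar> \<le> B \<Longrightarrow> \<exists>s K. sol s K \<and> K R = x \<and> sqrt c0 / 2 \<le> s R"
    using sol_exists[OF B] by (metis order_refl)
  have "R * \<bar>B / R\<bar> \<le> B" using R(1) B by simp
  then obtain s K where s: "sol s K" "K R = B / R" "sqrt c0 / 2 \<le> s R" using R(3) by blast
  have "sqrt c0 / 2 * (B / R) \<le> s R * (B / R)" using s(3) B R(1) by (intro mult_right_mono) auto
  hence "\<Phi> s K R \<le> \<beta> / R - 2 * (sqrt c0 / 2 * (B / R))" unfolding Phi0(1) s(2) mult.assoc by linarith
  also have "\<dots> = - (\<bar>c1\<bar> / R)" using c0_pos R(1) by (simp add: B_def field_simps)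
  also have "\<bar>c1\<bar> \<le> \<bar>c1\<bar> / R" using R(1,2) by (simp add: pos_le_divide_eq mult_left_le)
  hence "- (\<bar>c1\<bar> / R) \<le> c1" by linarith
  finally show ?thesis using that s(1) R(1) by blast
qed

text \<open>The last radius at which some solution lies below the level \<open>c1\<close> is attained by compactness, and at this
  radius no solution lies strictly below. For smaller radii there are two solutions on the level.\<close>
lemma well_posed_fold: "\<exists>\<epsilon>>0. well_posed c1 \<epsilon>"
proof -
  obtain sI KI r0 where I: "sol sI KI" "0 < r0" "\<Phi> sI KI r0 \<le> c1" by (rule ex_below_level)
  obtain C where C: "0 \<le> C" "\<And>s K \<delta>. sol s K \<Longrightarrow> \<Phi> s K r0 \<le> c1 \<Longrightarrow> 0 < \<delta> \<Longrightarrow> \<delta> \<le> r0 / 2 \<Longrightarrow> 0 < K \<delta> \<and> \<delta> * K \<delta> \<le> C"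
    using below_level_K_bound[OF I(2)] by blast
  obtain T where T: "\<And>s K r. sol s K \<Longrightarrow> 0 < r \<Longrightarrow> \<Phi> s K r \<le> c1 \<Longrightarrow> r \<le> T" using below_level_bounded by blast
  obtain R0 where R0: "0 < R0" "R0 \<le> 1"
    "\<And>R. 0 < R \<Longrightarrow> R \<le> R0 \<Longrightarrow> \<exists>\<sigma> k. (\<forall>x\<in>{-(C/R)..C/R}. sol (\<sigma> x) (k x) \<and> k x R = x \<and> sqrt c0 / 2 \<le> \<sigma> x R) \<and>
       (\<forall>r\<ge>R. continuous_on {-(C/R)..C/R} (\<lambda>x. \<sigma> x r) \<and> continuous_on {-(C/R)..C/R} (\<lambda>x. k x r))"
    using sol_family[OF C(1)] by blast
  define R where "R = min R0 (r0 / 2)"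
  have R: "0 < R" "R \<le> R0" "R \<le> r0 / 2" using R0 I(2) by (auto simp: R_def)
  define X where "X = {-(C/R)..C/R}"
  obtain \<sigma> k where sk: "\<And>x. x \<in> X \<Longrightarrow> sol (\<sigma> x) (k x)" "\<And>x. x \<in> X \<Longrightarrow> k x R = x"
      "\<And>r. R \<le> r \<Longrightarrow> continuous_on X (\<lambda>x. \<sigma> x r)" "\<And>r. R \<le> r \<Longrightarrow> continuous_on X (\<lambda>x. k x r)"
    using R0(3)[OF R(1,2)] unfolding X_def by blast
  define P where "P = (\<lambda>x r. \<Phi> (\<sigma> x) (k x) r)"
  have P_cont: "continuous_on X (\<lambda>x. P x r)" if "R \<le> r" for r
    unfolding P_def Phi0(1) by (intro continuous_intros sk that)
  have P_contr: "continuous_on S (P x)" if "x \<in> X" "S \<subseteq> {0<..}" for x S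
    unfolding P_def by (rule continuous_on_DERIV[OF DERIV_Phi[OF sk(1)[OF that(1)]]]) (use that in auto)
  have before: "P x r \<le> c1" if "x \<in> X" "0 < r" "r \<le> r'" "P x r' \<le> c1" for x r r'
    using Phi_below_before[OF sk(1)[OF that(1)] that(2), of r'] that by (cases "r = r'") (auto simp: P_def intro: less_imp_le)
  \<comment> \<open>Every solution below the level at a radius beyond \<open>r0\<close> is below it
    at \<open>r0\<close> too, so the bound \<open>C\<close> places its parameter in the compact
    interval \<open>X\<close>.\<close>
  have param: "\<exists>x\<in>X. P x r \<le> c1" if s: "sol s K" "r0 \<le> r" "\<Phi> s K r \<le> c1" for s K r
  proof -
    have r: "0 < r" using s I(2) by simp
    have "\<Phi> s K r0 \<le> c1" using Phi_below_before[OF s(1) I(2), of r] s by (cases "r0 = r") (auto intro: less_imp_le)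
    hence K: "0 < K R" "R * K R \<le> C" using C(2)[OF s(1) _ R(1,3)] by auto
    have "0 \<le> C / R" using C(1) R(1) by simp
    moreover have "K R \<le> C / R" using K R(1) by (simp add: pos_le_divide_eq mult.commute)
    ultimately have x: "K R \<in> X" using K(1) unfolding X_def atLeastAtMost_iff by linarith
    have "P (K R) r = \<Phi> s K r"
      using sol_eq_of_K_eq[OF sk(1)[OF x] s(1) R(1) sk(2)[OF x] r] by (simp add: P_def Phi0(1))
    thus ?thesis using x s(3) by (intro bexI[of _ "K R"]) auto
  qed
  define S where "S = {r. r0 \<le> r \<and> (\<exists>x\<in>X. P x r \<le> c1)}"
  have S0: "r0 \<in> S" using param[OF I(1) order_refl I(3)] by (simp add: S_def)
  have bdd: "bdd_above S"
    by (rule bdd_aboveI[of _ T]) (use T sk(1) I(2) in \<open>force simp: S_def P_def\<close>)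
  define \<epsilon> where "\<epsilon> = Sup S"
  have \<epsilon>r0: "r0 \<le> \<epsilon>" unfolding \<epsilon>_def by (rule cSup_upper[OF S0 bdd])
  have \<epsilon>: "0 < \<epsilon>" using \<epsilon>r0 I(2) by simp
  \<comment> \<open>A solution strictly below the level at \<open>\<epsilon>\<close> would still be
    below it slightly later, beyond the supremum of \<open>S\<close>.\<close>
  have no_lower: "c1 \<le> \<Phi> s K \<epsilon>" if s: "sol s K" for s K
  proof (rule ccontr)
    assume "\<not> c1 \<le> \<Phi> s K \<epsilon>"
    hence lt: "\<Phi> s K \<epsilon> < c1" by simp
    have "isCont (\<Phi> s K) \<epsilon>" by (rule DERIV_isCont[OF DERIV_Phi[OF s \<epsilon>]])
    hence "\<forall>\<^sub>F r in at \<epsilon>. \<Phi> s K r < c1" using lt by (auto simp: isCont_def intro: order_tendstoD)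
    then obtain d where d: "0 < d" "\<And>r. r \<noteq> \<epsilon> \<Longrightarrow> dist r \<epsilon> < d \<Longrightarrow> \<Phi> s K r < c1"
      by (auto simp: eventually_at)
    have "\<Phi> s K (\<epsilon> + d / 2) \<le> c1" using d by (intro less_imp_le d) (auto simp: dist_real_def)
    hence "\<epsilon> + d / 2 \<in> S" using param[OF s, of "\<epsilon> + d/2"] \<epsilon>r0 d(1) by (simp add: S_def)
    hence "\<epsilon> + d / 2 \<le> \<epsilon>" unfolding \<epsilon>_def using bdd by (rule cSup_upper)
    thus False using d(1) by simp
  qed
  have "\<exists>x\<in>X. P x \<epsilon> \<le> c1"
  proof (cases "\<epsilon> = r0")
    case True thus ?thesis using S0 by (simp add: S_def)
  next
    case False
    hence gt: "r0 < \<epsilon>" using \<epsilon>r0 by simp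
    have "\<exists>x\<in>X. P x r \<le> c1" if r: "r0 \<le> r" "r < \<epsilon>" for r
    proof -
      obtain r' where r': "r' \<in> S" "r < r'" using less_cSup_iff[OF _ bdd, of r] S0 r unfolding \<epsilon>_def by blast
      then obtain x where "x \<in> X" "P x r' \<le> c1" by (auto simp: S_def)
      thus ?thesis using before[of x r r'] r r' I(2) by auto
    qed
    \<comment> \<open>Radii tending to \<open>\<epsilon>\<close> from below. A limit point of the
      corresponding parameters is below the level at every \<open>r < \<epsilon>\<close>, since
      lying below at \<open>q n\<close> includes all earlier radii, and hence also at
      \<open>\<epsilon>\<close> by continuity in \<open>r\<close>.\<close>
    moreover define q where "q = (\<lambda>n::nat. \<epsilon> - (\<epsilon> - r0) / (real n + 1))"
    have "r0 \<le> q n" "q n < \<epsilon>" for n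
    proof -
      have "0 < (\<epsilon> - r0) / (real n + 1)" using gt by simp
      thus "q n < \<epsilon>" unfolding q_def by linarith
      have "(\<epsilon> - r0) / (real n + 1) \<le> (\<epsilon> - r0) / 1" using gt by (intro divide_left_mono) auto
      thus "r0 \<le> q n" unfolding q_def by simp
    qed
    ultimately have "\<forall>n. \<exists>x. x \<in> X \<and> P x (q n) \<le> c1" by blast
    then obtain f where f: "\<And>n. f n \<in> X" "\<And>n. P (f n) (q n) \<le> c1" by metis
    have "compact X" by (simp add: X_def)
    then obtain x \<tau> where x: "x \<in> X" "strict_mono \<tau>" "(f \<circ> \<tau>) \<longlonglongrightarrow> x"
      using f(1) unfolding compact_def by blast
    have qlim: "q \<longlonglongrightarrow> \<epsilon>"
    proof -
      have "(\<lambda>n. \<epsilon> - (\<epsilon> - r0) / (real n + 1)) \<longlonglongrightarrow> \<epsilon> - 0" by (intro tendsto_intros) real_asymp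
      thus ?thesis by (simp add: q_def)
    qed
    have below: "P x r \<le> c1" if r: "r0 \<le> r" "r < \<epsilon>" for r
    proof -
      have Rr: "R \<le> r" using R(3) I(2) r by simp
      have "((\<lambda>y. P y r) \<longlongrightarrow> P x r) (at x within X)" using P_cont[OF Rr] x(1) by (auto simp: continuous_on_def)
      hence "(\<lambda>n. P ((f \<circ> \<tau>) n) r) \<longlonglongrightarrow> P x r"
        using P_cont[OF Rr] x(1,3) f(1) by (auto simp: continuous_on_sequentially o_def)
      moreover have "\<forall>\<^sub>F n in sequentially. P ((f \<circ> \<tau>) n) r \<le> c1"
      proof -
        have "\<forall>\<^sub>F n in sequentially. r < (q \<circ> \<tau>) n"
          using order_tendstoD(1)[OF LIMSEQ_subseq_LIMSEQ[OF qlim x(2)] r(2)] .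
        thus ?thesis
        proof eventually_elim
          case (elim n)
          thus ?case using before[OF f(1)[of "\<tau> n"], of r "q (\<tau> n)"] f(2)[of "\<tau> n"] r I(2) by simp
        qed
      qed
      ultimately show ?thesis by (rule tendsto_upperbound) simp
    qed
    have "isCont (P x) \<epsilon>" unfolding P_def by (rule DERIV_isCont[OF DERIV_Phi[OF sk(1)[OF x(1)] \<epsilon>]])
    hence "(P x \<longlongrightarrow> P x \<epsilon>) (at_left \<epsilon>)" by (auto simp: isCont_def intro: filterlim_at_within_not_equal tendsto_within_subset[of _ _ _ UNIV])
    moreover have "\<forall>\<^sub>F r in at_left \<epsilon>. P x r \<le> c1"
      unfolding eventually_at_left_field using below gt by (intro exI[of _ r0]) auto
    ultimately have "P x \<epsilon> \<le> c1" by (rule tendsto_upperbound) simp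
    thus ?thesis using x(1) by blast
  qed
  then obtain x where x: "x \<in> X" "P x \<epsilon> \<le> c1" by blast
  have "\<Phi> (\<sigma> x) (k x) \<epsilon> = c1" using no_lower[OF sk(1)[OF x(1)]] x(2) by (simp add: P_def)
  hence "\<exists>s K. sol s K \<and> \<Phi> s K \<epsilon> = c1" using sk(1)[OF x(1)] by blast
  moreover have "\<Phi> s2 K2 \<epsilon> \<noteq> c1" if ord: "soliton_ordered \<alpha> lam c0 s1 K1 s2 K2" and P1: "\<Phi> s1 K1 \<epsilon> = c1" for s1 K1 s2 K2
  proof
    interpret soliton_ordered \<alpha> lam c0 s1 K1 s2 K2 by (rule ord)
    assume P2: "\<Phi> s2 K2 \<epsilon> = c1"
    \<comment> \<open>The third solution is chosen by an intermediate value of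
      \<open>K \<epsilon>\<close>; this places it strictly between the other two at all
      radii.\<close>
    define y where "y = (K1 \<epsilon> + K2 \<epsilon>) / 2"
    have y: "K2 \<epsilon> < y" "y < K1 \<epsilon>" using K_less[OF \<epsilon>] by (auto simp: y_def)
    obtain s3 K3 where s3: "sol s3 K3" "K3 \<epsilon> = y"
      using sol_intermediate[OF sol2 sol1 \<epsilon>, of "\<lambda>s K. K" y] y by auto
    have "soliton_ordered \<alpha> lam c0 s1 K1 s3 K3" "soliton_ordered \<alpha> lam c0 s3 K3 s2 K2"
      using soliton_orderedI[OF sol1 s3(1) \<epsilon>] soliton_orderedI[OF s3(1) sol2 \<epsilon>] y s3(2) by auto
    hence "\<Phi> s3 K3 \<epsilon> < c1" using Phi_strictly_convex \<epsilon> P1 P2 by blast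
    thus False using no_lower[OF s3(1)] by simp
  qed
  ultimately show ?thesis using \<epsilon> unfolding well_posed_def by blast
qed

end

section \<open>Back to the soliton equation\<close>

context soliton begin

text \<open>The integral over \<open>[0, r]\<close> is a logarithm and those over
  \<open>[r, \<epsilon>]\<close> combine to \<open>\<Phi> s K r - \<Phi> s K \<epsilon>\<close>. The
  remaining terms make up \<open>\<Phi> s K r\<close>, so \<open>r\<close> drops out.\<close>

lemma integral_identity_iff:
  assumes sol: "sol s K" and r: "0 < r" "r < \<epsilon>" and n: "real n - 1 = \<nu>"
    and w: "\<And>x. 0 < x \<Longrightarrow> w x = (s x)\<^sup>2" "\<And>x. 0 < x \<Longrightarrow> deriv w x = x powr \<alpha> * V s K x"
  shows "integral_identity n lam \<alpha> c1 \<gamma> \<epsilon> w r \<longleftrightarrow> \<Phi> s K \<epsilon> = c1"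
proof -
  \<comment> \<open>The value \<open>ln c0\<close> at \<open>0\<close> is the limit of
    \<open>2 * ln (s x)\<close>. It makes \<open>F\<close> continuous on \<open>[0, r]\<close>, and
    the fundamental theorem then yields the integrability up to \<open>0\<close> as well.\<close>
  define F where "F = (\<lambda>x. if x = 0 then ln c0 else 2 * ln (s x))"
  have "((\<lambda>x. deriv w x / w x) has_integral F r - F 0) {0..r}"
  proof (rule fundamental_theorem_of_calculus_interior)
    have dF: "(F has_real_derivative deriv w x / w x) (at x)" if x: "0 < x" for x
    proof -
      have s: "0 < s x" using sol_pos[OF sol x] .
      have "((\<lambda>x. 2 * ln (s x)) has_real_derivative 2 * ((x powr \<alpha> * V s K x / (2 * s x)) / s x)) (at x)"
        using s by (auto intro!: derivative_eq_intros sol_DERIV_s[OF sol x])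
      moreover have "2 * ((x powr \<alpha> * V s K x / (2 * s x)) / s x) = deriv w x / w x"
        using s x by (simp add: w power2_eq_square)
      ultimately have "((\<lambda>x. 2 * ln (s x)) has_real_derivative deriv w x / w x) (at x)" by simp
      thus ?thesis
        by (rule has_field_derivative_transform_within_open[of _ _ _ "{0<..}"]) (use x in \<open>auto simp: F_def\<close>)
    qed
    show "(F has_vector_derivative deriv w x / w x) (at x)" if "x \<in> {0<..<r}" for x
      using dF[of x] that by (simp add: has_real_derivative_iff_has_vector_derivative)
    show "continuous_on {0..r} F"
      unfolding continuous_on_eq_continuous_within
    proof
      fix x assume x: "x \<in> {0..r}"
      show "continuous (at x within {0..r}) F"
      proof (cases "x = 0")
        case True
        have "((\<lambda>x. 2 * ln (s x)) \<longlongrightarrow> 2 * ln (sqrt c0)) (at_right 0)"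
          by (intro tendsto_intros sol_lim[OF sol]) (use c0_pos in simp)
        moreover have "2 * ln (sqrt c0) = ln c0" using c0_pos by (simp add: ln_sqrt)
        ultimately have "((\<lambda>x. 2 * ln (s x)) \<longlongrightarrow> ln c0) (at_right 0)" by simp
        hence "(F \<longlongrightarrow> ln c0) (at_right 0)"
          by (rule Lim_transform_eventually) (auto simp: F_def eventually_at_right_field intro!: exI[of _ 1])
        moreover have "at (0::real) within {0..r} = at_right 0" using r by (intro at_within_Icc_at_right) auto
        ultimately show ?thesis using True by (simp add: continuous_within F_def)
      next
        case False
        hence "isCont F x" using dF[of x] x by (intro DERIV_isCont[OF dF]) auto
        thus ?thesis by (rule continuous_at_imp_continuous_at_within)
      qed
    qed
  qed (use r in simp)
  hence I0: "(\<lambda>x. deriv w x / w x) integrable_on {0..r}" "integral {0..r} (\<lambda>x. deriv w x / w x) = 2 * ln (s r) - ln c0"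
    using r by (auto simp: F_def has_integral_integrable integral_unique)
  define f1 where "f1 = (\<lambda>x. inverse x * deriv w x / w x)"
  define f3 where "f3 = (\<lambda>x. x powr (- \<alpha>) * (deriv w x)\<^sup>2 / w x)"
  have sub: "{r..\<epsilon>} \<subseteq> {0<..}" using r by auto
  have nz: "(s x)\<^sup>2 \<noteq> 0" "x \<noteq> 0" if "x \<in> {r..\<epsilon>}" for x using that r sol_pos[OF sol, of x] by auto
  have "continuous_on {r..\<epsilon>} (\<lambda>x. inverse x * (x powr \<alpha> * V s K x) / (s x)\<^sup>2)"
    by (intro continuous_intros sol_cont[OF sol sub] V_cont[OF sol sub]) (use nz in auto)
  hence "continuous_on {r..\<epsilon>} f1" by (rule continuous_on_eq) (use r in \<open>auto simp: f1_def w\<close>)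
  hence i1: "f1 integrable_on {r..\<epsilon>}" by (rule integrable_continuous_interval)
  have "continuous_on {r..\<epsilon>} (\<lambda>x. x powr (- \<alpha>) * (x powr \<alpha> * V s K x)\<^sup>2 / (s x)\<^sup>2)"
    by (intro continuous_intros sol_cont[OF sol sub] V_cont[OF sol sub]) (use nz in auto)
  hence "continuous_on {r..\<epsilon>} f3" by (rule continuous_on_eq) (use r in \<open>auto simp: f3_def w\<close>)
  hence i3: "f3 integrable_on {r..\<epsilon>}" by (rule integrable_continuous_interval)
  have "((\<lambda>x. - (\<nu> / 2 * f1 x - 1 / 2 * f3 x)) has_integral \<Phi> s K \<epsilon> - \<Phi> s K r) {r..\<epsilon>}"
  proof (rule fundamental_theorem_of_calculus)
    fix x assume x: "x \<in> {r..\<epsilon>}"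
    hence x0: "0 < x" using r by simp
    have s: "0 < s x" using sol_pos[OF sol x0] .
    have p: "x powr (- \<alpha>) = 1 / x powr \<alpha>" by (simp add: powr_minus_divide)
    have "x powr \<alpha> * V s K x * (V s K x - \<nu> / x) / (2 * (s x)\<^sup>2) = - (\<nu> / 2 * f1 x - 1 / 2 * f3 x)"
      unfolding f1_def f3_def w(1)[OF x0] w(2)[OF x0] p using x0 s
      by (simp add: divide_simps power2_eq_square) (simp add: algebra_simps)
    hence "(\<Phi> s K has_real_derivative - (\<nu> / 2 * f1 x - 1 / 2 * f3 x)) (at x)" using DERIV_Phi[OF sol x0] by simp
    thus "(\<Phi> s K has_vector_derivative - (\<nu> / 2 * f1 x - 1 / 2 * f3 x)) (at x within {r..\<epsilon>})"
      by (auto simp: has_real_derivative_iff_has_vector_derivative intro: has_vector_derivative_at_within)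
  qed (use r in simp)
  moreover have "((\<lambda>x. - (\<nu> / 2 * f1 x - 1 / 2 * f3 x)) has_integral
      - (\<nu> / 2 * integral {r..\<epsilon>} f1 - 1 / 2 * integral {r..\<epsilon>} f3)) {r..\<epsilon>}"
    by (intro has_integral_neg has_integral_diff has_integral_mult_right integrable_integral i1 i3)
  ultimately have I: "\<nu> / 2 * integral {r..\<epsilon>} f1 - 1 / 2 * integral {r..\<epsilon>} f3 = \<Phi> s K r - \<Phi> s K \<epsilon>"
    by (auto dest: has_integral_unique)
  have "integral_identity n lam \<alpha> c1 \<gamma> \<epsilon> w r \<longleftrightarrow>
     r powr \<alpha> * V s K r = - \<gamma> * r powr (\<alpha> - 1) + c1 * r powr \<alpha> + \<alpha> * lam / 2 * r powr \<alpha> * ln r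
       + r powr \<alpha> * (\<nu> / 2 * integral {r..\<epsilon>} f1 - lam / 2 * (2 * ln (s r) - ln c0) - 1 / 2 * integral {r..\<epsilon>} f3)"
    unfolding integral_identity_def n I0(2) w(2)[OF r(1)] f1_def[symmetric] f3_def[symmetric] using I0(1) by simp
  also have "\<dots> \<longleftrightarrow> r powr \<alpha> * V s K r = r powr \<alpha> * (- \<gamma> / r + c1 + \<alpha> * lam / 2 * ln r
       + (\<Phi> s K r - \<Phi> s K \<epsilon>) - lam / 2 * (2 * ln (s r) - ln c0))"
    unfolding I[symmetric] using r by (simp add: powr_diff algebra_simps)
  also have "\<dots> \<longleftrightarrow> V s K r = - \<gamma> / r + c1 + \<alpha> * lam / 2 * ln r
       + (\<Phi> s K r - \<Phi> s K \<epsilon>) - lam / 2 * (2 * ln (s r) - ln c0)"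
    using r by simp
  also have "\<dots> \<longleftrightarrow> \<Phi> s K \<epsilon> = c1"
  proof -
    have "lam / 2 * (2 * ln (s r) - ln c0) = lam * ln (s r) - lam / 2 * ln c0" by (simp add: algebra_simps)
    moreover have "- \<gamma> / r = - (\<gamma> / r)" by simp
    ultimately show ?thesis unfolding \<Phi>_def[of s K r] by linarith
  qed
  finally show ?thesis .
qed

lemma sol_imp_singular_solution:
  assumes sol: "sol s K" and \<Phi>: "\<Phi> s K \<epsilon> = c1" and n: "real n - 1 = \<nu>"
  shows "singular_solution n lam \<alpha> c0 c1 \<gamma> \<epsilon> (\<lambda>r. (s r)\<^sup>2 / r powr \<alpha>)"
proof -
  define h where "h = (\<lambda>r. (s r)\<^sup>2 / r powr \<alpha>)"
  have h_pos: "0 < h r" if "0 < r" for r using sol_pos[OF sol that] that by (simp add: h_def)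
  have d1: "(h has_real_derivative V s K r - \<alpha> * h r / r) (at r)" if r: "0 < r" for r
  proof -
    have p: "0 < r powr \<alpha>" using r by simp
    have "(h has_real_derivative (r powr \<alpha> * V s K r * r powr \<alpha> - (s r)\<^sup>2 * (\<alpha> * r powr \<alpha> / r)) / (r powr \<alpha> * r powr \<alpha>)) (at r)"
      unfolding h_def using p by (intro DERIV_divide DERIV_sq[OF sol r] DERIV_powr_pos r) simp
    moreover have "(q * v * q - w * (\<alpha> * q / r)) / (q * q) = v - \<alpha> * (w / q) / r" if "0 < q" for q v w :: real
      using that r by (simp add: field_simps)
    ultimately show ?thesis using p by (simp add: h_def)
  qed
  have deriv1: "deriv h r = V s K r - \<alpha> * h r / r" if "0 < r" for r using DERIV_imp_deriv[OF d1[OF that]] .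
  define h2 where "h2 = (\<lambda>r. V s K r * (V s K r - \<nu> / r - lam) / (2 * h r) + \<gamma> / r\<^sup>2 + \<alpha> * lam / (2 * r)
      - (\<alpha> * (V s K r - \<alpha> * h r / r) * r - \<alpha> * h r) / r\<^sup>2)"
  have d2: "(deriv h has_real_derivative h2 r) (at r)" if r: "0 < r" for r
  proof -
    have "((\<lambda>r. V s K r - \<alpha> * h r / r) has_real_derivative
        (r powr \<alpha> * V s K r * (V s K r - \<nu> / r - lam) / (2 * (s r)\<^sup>2) + \<gamma> / r\<^sup>2 + \<alpha> * lam / (2 * r))
        - (\<alpha> * (V s K r - \<alpha> * h r / r) * r - \<alpha> * h r * 1) / (r * r)) (at r)"
      using r by (intro DERIV_diff DERIV_V[OF sol r] DERIV_divide DERIV_cmult d1 DERIV_ident) auto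
    moreover have "r powr \<alpha> * x / (2 * (s r)\<^sup>2) = x / (2 * h r)" for x
      using r sol_pos[OF sol r] by (simp add: h_def)
    ultimately have "((\<lambda>r. V s K r - \<alpha> * h r / r) has_real_derivative h2 r) (at r)"
      unfolding h2_def by (simp add: mult.assoc power2_eq_square)
    thus ?thesis
      by (rule has_field_derivative_transform_within_open[of _ _ _ "{0<..}"]) (use r deriv1 in auto)
  qed
  have deriv2: "deriv (deriv h) r = h2 r" if "0 < r" for r using DERIV_imp_deriv[OF d2[OF that]] .
  have hc: "continuous_on {0<..} h" by (rule continuous_on_DERIV[OF d1]) auto
  have "C2_on h {0<..}"
    unfolding C2_on_def
  proof (intro conjI)
    show "h differentiable_on {0<..}" "deriv h differentiable_on {0<..}"
      using d1 d2 unfolding differentiable_on_def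
      by (meson differentiable_at_withinI greaterThan_iff real_differentiable_def)+
    have "2 * h r \<noteq> 0" if "r \<in> {0<..}" for r using h_pos[of r] that by auto
    hence "continuous_on {0<..} h2"
      unfolding h2_def by (intro continuous_intros V_cont[OF sol order_refl] hc) auto
    thus "continuous_on {0<..} (deriv (deriv h))"
      by (rule continuous_on_eq) (auto simp: deriv2)
  qed
  moreover have "soliton_ode n lam h r" if r: "0 < r" for r
  proof -
    have "2 * r\<^sup>2 * y * (v * (v - \<nu> / r - lam) / (2 * y) + \<gamma> / r\<^sup>2 + \<alpha> * lam / (2 * r) - (\<alpha> * (v - \<alpha> * y / r) * r - \<alpha> * y) / r\<^sup>2)
        = \<nu> * y * (y - 1) + r * (v - \<alpha> * y / r) * (r * (v - \<alpha> * y / r) - lam * r - \<nu>)" if "0 < y" for y v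
      using that r unfolding \<gamma>_def \<nu>_def
      by (simp add: divide_simps power2_eq_square) (simp add: algebra_simps)
    from this[OF h_pos[OF r], of "V s K r"] show ?thesis
      unfolding soliton_ode_def n deriv1[OF r] deriv2[OF r] h2_def .
  qed
  moreover have w: "weighted \<alpha> h x = (s x)\<^sup>2" if "0 < x" for x using that by (simp add: weighted_def h_def)
  have "(weighted \<alpha> h \<longlongrightarrow> c0) (at_right 0)"
  proof -
    have "((\<lambda>x. (s x)\<^sup>2) \<longlongrightarrow> (sqrt c0)\<^sup>2) (at_right 0)" by (intro tendsto_intros sol_lim[OF sol])
    hence "((\<lambda>x. (s x)\<^sup>2) \<longlongrightarrow> c0) (at_right 0)" using c0_pos by simp
    thus ?thesis
      by (rule Lim_transform_eventually) (auto simp: w eventually_at_right_field intro!: exI[of _ 1])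
  qed
  moreover have "integral_identity n lam \<alpha> c1 \<gamma> \<epsilon> (weighted \<alpha> h) r" if "0 < r" "r < \<epsilon>" for r
  proof -
    have "deriv (weighted \<alpha> h) x = x powr \<alpha> * V s K x" if "0 < x" for x
      by (rule DERIV_imp_deriv, rule has_field_derivative_transform_within_open[OF DERIV_sq[OF sol that], of "{0<..}"])
         (use that w in auto)
    thus ?thesis using integral_identity_iff[OF sol that n, of "weighted \<alpha> h"] w \<Phi> by blast
  qed
  ultimately show ?thesis using h_pos unfolding singular_solution_def h_def by blast
qed

text \<open>\<open>K\<close> is defined by solving the formula for \<open>V\<close>, so the equation
  for \<open>s\<close> holds by construction and the soliton equation becomes the one for
  \<open>K\<close>. Condition (iii) is used at the single radius
  \<open>\<epsilon> / 2\<close>.\<close>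

lemma singular_solution_imp_sol:
  assumes h: "singular_solution n lam \<alpha> c0 c1 \<gamma> \<epsilon> h" and n: "real n - 1 = \<nu>" and \<epsilon>: "0 < \<epsilon>"
  obtains s K where "sol s K" "\<Phi> s K \<epsilon> = c1" "\<And>r. 0 < r \<Longrightarrow> h r = (s r)\<^sup>2 / r powr \<alpha>"
proof -
  have C2: "h differentiable_on {0<..}" "deriv h differentiable_on {0<..}"
    and pos: "\<And>r. 0 < r \<Longrightarrow> 0 < h r" and ode: "\<And>r. 0 < r \<Longrightarrow> soliton_ode n lam h r"
    and lim: "(weighted \<alpha> h \<longlongrightarrow> c0) (at_right 0)"
    and ident: "\<And>r. 0 < r \<Longrightarrow> r < \<epsilon> \<Longrightarrow> integral_identity n lam \<alpha> c1 \<gamma> \<epsilon> (weighted \<alpha> h) r"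
    using h unfolding singular_solution_def C2_on_def by blast+
  have dh: "(h has_real_derivative deriv h r) (at r)" "(deriv h has_real_derivative deriv (deriv h) r) (at r)" if "0 < r" for r
    using C2 that
    by (auto simp: differentiable_on_def at_within_open[of _ "{0<..}"] DERIV_deriv_iff_real_differentiable)
  define v where "v = (\<lambda>r. deriv h r + \<alpha> * h r / r)"
  define w where "w = weighted \<alpha> h"
  define s where "s = (\<lambda>r. sqrt (w r))"
  define K where "K = (\<lambda>r. (\<nu> / r + lam - v r) / (2 * s r))"
  have w: "0 < w r" "w r = r powr \<alpha> * h r" if "0 < r" for r
    using pos[OF that] that by (auto simp: w_def weighted_def)
  have s: "0 < s r" "(s r)\<^sup>2 = r powr \<alpha> * h r" if "0 < r" for r
    using w[OF that] by (auto simp: s_def)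
  have V: "V s K r = v r" if "0 < r" for r using s(1)[OF that] by (simp add: V_def K_def)
  have dw: "(w has_real_derivative r powr \<alpha> * v r) (at r)" if r: "0 < r" for r
  proof -
    have "((\<lambda>r. r powr \<alpha> * h r) has_real_derivative (\<alpha> * r powr \<alpha> / r) * h r + deriv h r * r powr \<alpha>) (at r)"
      by (intro DERIV_mult DERIV_powr_pos dh r)
    moreover have "(\<alpha> * r powr \<alpha> / r) * h r + deriv h r * r powr \<alpha> = r powr \<alpha> * v r"
      by (simp add: v_def algebra_simps)
    ultimately show ?thesis by (simp add: w_def weighted_def[abs_def])
  qed
  have ds: "(s has_real_derivative r powr \<alpha> * v r / (2 * s r)) (at r)" if r: "0 < r" for r
  proof -
    have "((\<lambda>r. sqrt (w r)) has_real_derivative inverse (sqrt (w r)) / 2 * (r powr \<alpha> * v r)) (at r)"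
      using DERIV_chain2[of sqrt "inverse (sqrt (w r)) / 2" w r, OF DERIV_real_sqrt[OF w(1)[OF r]] dw[OF r]] .
    moreover have "inverse x / 2 * y = y / (2 * x)" for x y :: real by (simp add: divide_simps)
    ultimately show ?thesis by (simp only: s_def)
  qed
  have dK: "(K has_real_derivative - (\<beta> + \<alpha> * lam * r / 2) / (2 * r\<^sup>2 * s r)) (at r)" if r: "0 < r" for r
  proof -
    define v' where "v' = deriv (deriv h) r + (\<alpha> * deriv h r * r - \<alpha> * h r) / r\<^sup>2"
    have dv: "(v has_real_derivative v') (at r)"
      unfolding v_def v'_def
      by (rule DERIV_cong[OF DERIV_add[OF dh(2)[OF r] DERIV_divide[OF DERIV_cmult[OF dh(1)[OF r]] DERIV_ident]]])
         (use r in \<open>simp_all add: power2_eq_square\<close>)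
    have "(K has_real_derivative ((- \<nu> / r\<^sup>2 - v') * (2 * s r) - (\<nu> / r + lam - v r) * (2 * (r powr \<alpha> * v r / (2 * s r)))) / ((2 * s r) * (2 * s r))) (at r)"
    proof -
      have "((\<lambda>r. \<nu> / r + lam - v r) has_real_derivative - \<nu> / r\<^sup>2 - v') (at r)"
        by (rule DERIV_cong[OF DERIV_diff[OF DERIV_add[OF DERIV_divide[OF DERIV_const DERIV_ident] DERIV_const] dv]])
           (use r in \<open>simp_all add: power2_eq_square\<close>)
      thus ?thesis unfolding K_def by (rule DERIV_divide[OF _ DERIV_cmult[OF ds[OF r]]]) (use s(1)[OF r] in simp)
    qed
    moreover have "((- \<nu> / r\<^sup>2 - v') * (2 * s r) - (\<nu> / r + lam - v r) * (2 * (r powr \<alpha> * v r / (2 * s r)))) / ((2 * s r) * (2 * s r))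
        = - (\<beta> + \<alpha> * lam * r / 2) / (2 * r\<^sup>2 * s r)"
    proof -
      define y where "y = h r"
      define z where "z = deriv h r"
      define q where "q = deriv (deriv h) r"
      \<comment> \<open>The only place in this proof where the soliton equation enters;
        multiplication by \<open>2 * r\<^sup>2\<close> and \<open>y\<close> turns the claim into a
        polynomial identity modulo this equation.\<close>
      have o: "2 * r\<^sup>2 * y * q = \<nu> * y * (y - 1) + r * z * (r * z - lam * r - \<nu>)"
        using ode[OF r] by (simp add: soliton_ode_def n y_def z_def q_def)
      have "2 * r\<^sup>2 * ((\<nu> / r\<^sup>2 + v') * y + (\<nu> / r + lam - v r) * v r / 2)
          = 2 * \<nu> * y + 2 * r\<^sup>2 * y * q + 2 * y * (\<alpha> * z * r - \<alpha> * y) + (\<nu> + lam * r - (r * z + \<alpha> * y)) * (r * z + \<alpha> * y)"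
        unfolding v'_def v_def y_def z_def q_def using r
        by (simp add: divide_simps power2_eq_square) (simp add: algebra_simps)
      also have "\<dots> = 2 * y * (\<beta> + \<alpha> * lam * r / 2)"
        unfolding o \<beta>_def \<nu>_def by (simp add: algebra_simps power2_eq_square)
      finally have "r\<^sup>2 * ((\<nu> / r\<^sup>2 + v') * y + (\<nu> / r + lam - v r) * v r / 2) = y * (\<beta> + \<alpha> * lam * r / 2)" by simp
      hence E: "(\<nu> / r\<^sup>2 + v') * y + (\<nu> / r + lam - v r) * v r / 2 = y * ((\<beta> + \<alpha> * lam * r / 2) / r\<^sup>2)"
        using r by (simp add: field_simps)
      have "((- a - b) * (2 * x) - c * (2 * (p * u / (2 * x)))) / ((2 * x) * (2 * x))
          = - ((a + b) * x\<^sup>2 + c * u / 2 * p) / (2 * x * x\<^sup>2)" if "0 < x" for a b c p u x :: real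
        using that by (simp add: divide_simps power2_eq_square) (simp add: algebra_simps)
      from this[OF s(1)[OF r], of "\<nu> / r\<^sup>2" v' "\<nu> / r + lam - v r" "r powr \<alpha>" "v r"]
      have "((- \<nu> / r\<^sup>2 - v') * (2 * s r) - (\<nu> / r + lam - v r) * (2 * (r powr \<alpha> * v r / (2 * s r)))) / ((2 * s r) * (2 * s r))
          = - ((\<nu> / r\<^sup>2 + v') * (s r)\<^sup>2 + (\<nu> / r + lam - v r) * v r / 2 * r powr \<alpha>) / (2 * s r * (s r)\<^sup>2)"
        by (simp only: minus_divide_left)
      also have "(\<nu> / r\<^sup>2 + v') * (s r)\<^sup>2 + (\<nu> / r + lam - v r) * v r / 2 * r powr \<alpha>
          = r powr \<alpha> * ((\<nu> / r\<^sup>2 + v') * y + (\<nu> / r + lam - v r) * v r / 2)"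
        unfolding s(2)[OF r] y_def by (simp add: algebra_simps)
      also have "\<dots> = (s r)\<^sup>2 * ((\<beta> + \<alpha> * lam * r / 2) / r\<^sup>2)" unfolding E s(2)[OF r] by (simp add: y_def)
      also have "- ((s r)\<^sup>2 * ((\<beta> + \<alpha> * lam * r / 2) / r\<^sup>2)) / (2 * s r * (s r)\<^sup>2) = - (\<beta> + \<alpha> * lam * r / 2) / (2 * r\<^sup>2 * s r)"
      proof -
        have "- (x\<^sup>2 * (b / r\<^sup>2)) / (2 * x * x\<^sup>2) = - b / (2 * r\<^sup>2 * x)" if "0 < x" for x b :: real
          using that r by (simp add: divide_simps)
        thus ?thesis using s(1)[OF r] by blast
      qed
      finally show ?thesis .
    qed
    ultimately show ?thesis by simp
  qed
  have "sol s K"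
    unfolding sol_def
  proof (intro conjI allI impI)
    show "(s \<longlongrightarrow> sqrt c0) (at_right 0)" unfolding s_def w_def by (intro tendsto_intros lim)
  qed (use s dK ds V in auto)
  moreover have "\<Phi> s K \<epsilon> = c1"
  proof -
    have "deriv w x = x powr \<alpha> * V s K x" if "0 < x" for x
      using DERIV_imp_deriv[OF dw[OF that]] V[OF that] by simp
    moreover have "w x = (s x)\<^sup>2" if "0 < x" for x using w[OF that] s[OF that] by simp
    ultimately show ?thesis
      using integral_identity_iff[OF \<open>sol s K\<close> _ _ n, of "\<epsilon> / 2" \<epsilon> w] ident[of "\<epsilon> / 2"] \<epsilon> by (simp add: w_def)
  qed
  ultimately show ?thesis using s(2) by (intro that) auto
qed

lemma well_posed_exists: "\<exists>\<epsilon>>0. well_posed c1 \<epsilon>"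
proof (cases "lam = 0")
  case False
  thus ?thesis using lam_nonneg well_posed_expanding by simp
next
  case lam0: True
  show ?thesis
  proof (cases "0 < c1 \<or> \<alpha> < 1 \<or> \<alpha> = 1 \<and> c1 = 0")
    case True
    thus ?thesis
      using well_posed_steady_pos[OF lam0] well_posed_small[OF lam0] by (cases "0 < c1") (blast, simp)
  next
    case False
    then interpret soliton_fold \<alpha> lam c0 c1 using lam0 by unfold_locales auto
    show ?thesis by (rule well_posed_fold)
  qed
qed

end

theorem theorem1p1:
  fixes n :: nat and lam \<alpha> c0 c1 c2 :: real
  assumes "n \<ge> 2" and "lam \<ge> 0" and "\<alpha> = sqrt (real n) - 1" and "c0 > 0"
    and "c2 = (real n - 1) * (\<alpha> - 1) / 2"
  shows "\<exists>\<epsilon>>0.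
      (\<exists>h. singular_solution n lam \<alpha> c0 c1 c2 \<epsilon> h) \<and>
      (\<forall>h1 h2. singular_solution n lam \<alpha> c0 c1 c2 \<epsilon> h1 \<and> singular_solution n lam \<alpha> c0 c1 c2 \<epsilon> h2
         \<longrightarrow> (\<forall>r>0. h1 r = h2 r))"
proof -
  have "1 < sqrt (real n)" using assms(1) by simp
  then interpret soliton \<alpha> lam c0 using assms by unfold_locales auto
  have "\<alpha> * (\<alpha> + 2) = (sqrt (real n))\<^sup>2 - 1" unfolding assms(3) by (simp add: algebra_simps power2_eq_square)
  hence n: "real n - 1 = \<nu>" by (simp add: \<nu>_def)
  have c2: "c2 = \<gamma>" unfolding assms(5) n \<gamma>_def ..
  obtain \<epsilon> where \<epsilon>: "0 < \<epsilon>" "well_posed c1 \<epsilon>" using well_posed_exists by blast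
  have "\<exists>h. singular_solution n lam \<alpha> c0 c1 c2 \<epsilon> h"
    using \<epsilon>(2) sol_imp_singular_solution[OF _ _ n] unfolding c2 well_posed_def by blast
  moreover have "h1 r = h2 r"
    if h: "singular_solution n lam \<alpha> c0 c1 c2 \<epsilon> h1" "singular_solution n lam \<alpha> c0 c1 c2 \<epsilon> h2" and r: "0 < r" for h1 h2 r
  proof -
    obtain s1 K1 where 1: "sol s1 K1" "\<Phi> s1 K1 \<epsilon> = c1" "\<And>r. 0 < r \<Longrightarrow> h1 r = (s1 r)\<^sup>2 / r powr \<alpha>"
      using singular_solution_imp_sol[OF h(1)[unfolded c2] n \<epsilon>(1)] by blast
    obtain s2 K2 where 2: "sol s2 K2" "\<Phi> s2 K2 \<epsilon> = c1" "\<And>r. 0 < r \<Longrightarrow> h2 r = (s2 r)\<^sup>2 / r powr \<alpha>"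
      using singular_solution_imp_sol[OF h(2)[unfolded c2] n \<epsilon>(1)] by blast
    \<comment> \<open>Both solutions lie on the level \<open>c1\<close> at
      \<open>\<epsilon>\<close>, so neither order is possible and they coincide.\<close>
    have "\<not> soliton_ordered \<alpha> lam c0 s1 K1 s2 K2" "\<not> soliton_ordered \<alpha> lam c0 s2 K2 s1 K1"
      using \<epsilon>(2) 1(2) 2(2) unfolding well_posed_def by blast+
    hence "s1 r = s2 r" by (rule sol_eqI(1)[OF 1(1) 2(1) _ _ r])
    thus ?thesis using 1(3)[OF r] 2(3)[OF r] by simp
  qed
  ultimately show ?thesis using \<epsilon>(1) by blast
qed

end
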